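(* Let $\mathcal{P}$ be a hereditary class of finite graphs and let $r = \operatorname{col}(\mathcal{P})$. (1) If $3 \leq r < \infty$ and none of the graphs $G_{r+1}$, $B_{r+1}$, $H_{r+1}$ belongs to $\mathcal{P}$ (equivalently, $\mathcal{P}$ contains no graph having one of them as an induced subgraph), then every graph limit in $\widehat{\mathcal{P}}^{\max}$ is represented by $W^r_a$ for some $a \in [0,1]$. (2) If $r = 2$ and neither $G_3$ nor $B_3$ belongs to $\mathcal{P}$, then every graph limit in $\widehat{\mathcal{P}}^{\max}$ is represented by $W^2_a$ for some $a\in[0,1]$.
   Context: A graphon is a measurable symmetric function $W:[0,1]^2\to[0,1]$. Every graphon represents a graph limit (the limit of a convergent graph sequence in the sense of Lovász–Szegedy). Every graph limit is represented by some graphon, and two graphons are equivalent if they represent the same graph limit. The entropy of a graphon is $\operatorname{Ent}(W)=\int_0^1\int_0^1 h(W(x,y))\,dx\,dy$, where $h(x)=-x\log_2 x-(1-x)\log_2(1-x)$; equivalent graphons have the same entropy. For a graph class $\mathcal{P}$, $\widehat{\mathcal{P}}$ is the set of graph limits $\Gamma$ such that some sequence $G_n\in\mathcal{P}$ with $|V(G_n)|\to\infty$ converges to $\Gamma$, and $\widehat{\mathcal{P}}^{\max}$ is the set of elements of $\widehat{\mathcal{P}}$ of maximal entropy. For $t\ge1$ and $0\le s\le t$, $\mathcal{C}(t,s)$ is the class of graphs whose vertex set can be partitioned into $s$ cliques and $t-s$ independent sets (all possibly empty). The coloring number $\operatorname{col}(\mathcal{P})$ of a hereditary class $\mathcal{P}$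 is the largest $t$ such that $\mathcal{C}(t,s)\subseteq\mathcal{P}$ for some $s\le t$ ($\operatorname{col}=\infty$ if $\mathcal{P}$ is the class of all graphs). For $k\ge1$ let $I_i=[(i-1)/k,i/k)$, $i\in[k]$ (graphons may be taken on $[0,1)^2$). For $a\in[0,1]$, $W^k_a$ is the graphon equal to $1/2$ on $\bigcup_{i\neq j}I_i\times I_j$, equal to $1$ on $I_i\times I_i$ for $2\le i\le k$, and on $I_1\times I_1$ equal to $1$ on $[0,a/k)^2\cup[a/k,1/k)^2$ and $0$ on the rest of $I_1\times I_1$. For $k\ge3$, the graphs $G_k$, $B_k$ (and $H_k$ for $k\ge4$) all have vertex set the $k+\binom{k}{2}$ subsets of $[k]$ of size one or two, with vertex $v_S$ for subset $S$. In $G_k$, $v_S\sim v_T$ iff $S\cap T\neq\emptyset$. $B_k$ is defined the same way except that there are no edges between two vertices corresponding to 2-element subsets (so $B_k$ is bipartite). $H_k$ is $G_k$ with the three edges $v_{\{1,2\}}v_{\{1,3\}}$, $v_{\{1,2\}}v_{\{2,3\}}$, $v_{\{1,3\}}v_{\{2,3\}}$ removed. *)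

theory Defs
  imports
    "HOL-Analysis.Analysis"
    "HOL-Library.Extended_Nat"
    "Graph_Theory.Pair_Digraph"
    "Graph_Theory.Digraph_Isomorphism"
begin

text \<open>
  Finite simple graphs are the symmetric loop-free digraphs of locale \<^locale>\<open>pair_graph\<close>
  (finite by definition, every edge stored as both of its arcs). Up to isomorphism, every finite
  graph has its vertices in \<^typ>\<open>nat\<close>, so a graph class is a set of graphs on \<^typ>\<open>nat\<close>
  that is closed under isomorphism.
\<close>

type_synonym ngraph = "nat pair_pre_digraph"

definition graph_isomorphic :: "'a pair_pre_digraph \<Rightarrow> 'b pair_pre_digraph \<Rightarrow> bool" where
  "graph_isomorphic G H \<longleftrightarrow> digraph_iso (with_proj G) (with_proj H)"

definition hereditary :: "ngraph set \<Rightarrow> bool" where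
  "hereditary P \<longleftrightarrow>
     (\<forall>G\<in>P. pair_graph G) \<and>
     (\<forall>G\<in>P. \<forall>H :: ngraph. graph_isomorphic G H \<longrightarrow> H \<in> P) \<and>
     (\<forall>G\<in>P. \<forall>H :: ngraph. pair_graph H \<and> induced_subgraph (with_proj H) (with_proj G) \<longrightarrow> H \<in> P)"

text \<open>Membership in a graph class of a graph on an arbitrary vertex type.\<close>

definition belongs_to :: "'a pair_pre_digraph \<Rightarrow> ngraph set \<Rightarrow> bool" where
  "belongs_to H P \<longleftrightarrow> (\<exists>G\<in>P. graph_isomorphic G H)"

definition clique :: "'a pair_pre_digraph \<Rightarrow> 'a set \<Rightarrow> bool" where
  "clique G A \<longleftrightarrow> (\<forall>u\<in>A. \<forall>v\<in>A. u \<noteq> v \<longrightarrow> (u, v) \<in> parcs G)"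

definition independent :: "'a pair_pre_digraph \<Rightarrow> 'a set \<Rightarrow> bool" where
  "independent G A \<longleftrightarrow> (\<forall>u\<in>A. \<forall>v\<in>A. (u, v) \<notin> parcs G)"

definition colorable_class :: "nat \<Rightarrow> nat \<Rightarrow> ngraph set" where
  "colorable_class t s = {G. pair_graph G \<and>
     (\<exists>A :: nat \<Rightarrow> nat set. disjoint_family_on A {1..t} \<and> (\<Union>i\<in>{1..t}. A i) = pverts G \<and>
        (\<forall>i\<in>{1..s}. clique G (A i)) \<and> (\<forall>i\<in>{s<..t}. independent G (A i)))}"

text \<open>
  The supremum is a maximum when it is finite and nonzero. It is infinite exactly for the class of
  all graphs, because every graph on \<open>n\<close> vertices lies in every \<open>colorable_class t s\<close>
  with \<open>n \<le> t\<close>. It is \<open>0\<close> if no \<open>t\<close> qualifies.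
\<close>

definition coloring_number :: "ngraph set \<Rightarrow> enat" where
  "coloring_number P = Sup {enat t | t. t \<ge> 1 \<and> (\<exists>s\<le>t. colorable_class t s \<subseteq> P)}"

definition unit_measure :: "real measure" where
  "unit_measure = restrict_space lborel {0..1}"

definition graphon :: "(real \<Rightarrow> real \<Rightarrow> real) \<Rightarrow> bool" where
  "graphon W \<longleftrightarrow>
     (\<lambda>(x, y). W x y) \<in> borel_measurable (unit_measure \<Otimes>\<^sub>M unit_measure) \<and>
     (\<forall>x\<in>{0..1}. \<forall>y\<in>{0..1}. W x y = W y x \<and> 0 \<le> W x y \<and> W x y \<le> 1)"

definition graph_homs :: "'a pair_pre_digraph \<Rightarrow> 'b pair_pre_digraph \<Rightarrow> ('a \<Rightarrow> 'b) set" where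
  "graph_homs F G = {\<phi> \<in> pverts F \<rightarrow>\<^sub>E pverts G. \<forall>(u, v)\<in>parcs F. (\<phi> u, \<phi> v) \<in> parcs G}"

definition graph_hom_density :: "'a pair_pre_digraph \<Rightarrow> 'b pair_pre_digraph \<Rightarrow> real" where
  "graph_hom_density F G =
     real (card (graph_homs F G)) / real (card (pverts G)) ^ card (pverts F)"

text \<open>The condition \<open>u < v\<close> selects one of the two arcs of each edge.\<close>

definition graphon_hom_density :: "ngraph \<Rightarrow> (real \<Rightarrow> real \<Rightarrow> real) \<Rightarrow> real" where
  "graphon_hom_density F W =
     (LINT x | PiM (pverts F) (\<lambda>_. unit_measure).
        (\<Prod>(u, v)\<in>{(u, v). (u, v) \<in> parcs F \<and> u < v}. W (x u) (x v)))"

text \<open>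
  A graph limit in the sense of Lovasz and Szegedy is encoded by its homomorphism densities: it is
  the function sending each finite graph \<open>F\<close> to the limit of the densities of \<open>F\<close>.
  Extensionality makes it unique, by fixing its value off the finite graphs.
\<close>

type_synonym graph_limit = "ngraph \<Rightarrow> real"

definition graphs_converge :: "(nat \<Rightarrow> ngraph) \<Rightarrow> graph_limit \<Rightarrow> bool" where
  "graphs_converge G \<Gamma> \<longleftrightarrow>
     \<Gamma> \<in> extensional {F. pair_graph F} \<and>
     (\<forall>n. pair_graph (G n)) \<and>
     filterlim (\<lambda>n. card (pverts (G n))) at_top sequentially \<and>
     (\<forall>F. pair_graph F \<longrightarrow> (\<lambda>n. graph_hom_density F (G n)) \<longlonglongrightarrow> \<Gamma> F)"

definition represents :: "(real \<Rightarrow> real \<Rightarrow> real) \<Rightarrow> graph_limit \<Rightarrow> bool" where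
  "represents W \<Gamma> \<longleftrightarrow>
     graphon W \<and> (\<forall>F. pair_graph F \<longrightarrow> graphon_hom_density F W = \<Gamma> F)"

text \<open>The value \<open>0\<close> at \<open>0\<close> and \<open>1\<close> is automatic, since \<^prop>\<open>log 2 0 = 0\<close>.\<close>

definition binary_entropy :: "real \<Rightarrow> real" where
  "binary_entropy x = - x * log 2 x - (1 - x) * log 2 (1 - x)"

definition graphon_entropy :: "(real \<Rightarrow> real \<Rightarrow> real) \<Rightarrow> real" where
  "graphon_entropy W =
     (LINT x | unit_measure. (LINT y | unit_measure. binary_entropy (W x y)))"

text \<open>
  The entropy of a graph limit is that of any graphon representing it. As a relation, it does not
  presuppose that equivalent graphons have the same entropy.
\<close>

definition has_entropy :: "graph_limit \<Rightarrow> real \<Rightarrow> bool" where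
  "has_entropy \<Gamma> e \<longleftrightarrow> (\<exists>W. represents W \<Gamma> \<and> graphon_entropy W = e)"

definition class_limits :: "ngraph set \<Rightarrow> graph_limit set" where
  "class_limits P = {\<Gamma>. \<exists>G. (\<forall>n. G n \<in> P) \<and> graphs_converge G \<Gamma>}"

definition max_entropy_limits :: "ngraph set \<Rightarrow> graph_limit set" where
  "max_entropy_limits P = {\<Gamma> \<in> class_limits P.
     \<exists>e. has_entropy \<Gamma> e \<and> (\<forall>\<Gamma>'\<in>class_limits P. \<forall>e'. has_entropy \<Gamma>' e' \<longrightarrow> e' \<le> e)}"

definition part :: "nat \<Rightarrow> nat \<Rightarrow> real set" where
  "part k i = {(real i - 1) / real k ..< real i / real k}"

text \<open>
  The parts cover \<open>[0,1)\<close>; the last case also assigns the value \<open>1/2\<close> on the null set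
  where a coordinate is \<open>1\<close>, which has no effect on densities.
\<close>

definition W_graphon :: "nat \<Rightarrow> real \<Rightarrow> real \<Rightarrow> real \<Rightarrow> real" where
  "W_graphon k a x y =
     (if x \<in> part k 1 \<and> y \<in> part k 1 then
        (if (x, y) \<in> {0 ..< a / real k} \<times> {0 ..< a / real k} \<union>
                     {a / real k ..< 1 / real k} \<times> {a / real k ..< 1 / real k}
         then 1 else 0)
      else if \<exists>i\<in>{2..k}. x \<in> part k i \<and> y \<in> part k i then 1
      else 1 / 2)"

definition small_subsets :: "nat \<Rightarrow> nat set set" where
  "small_subsets k = {S. S \<subseteq> {1..k} \<and> card S \<in> {1, 2}}"

definition G_graph :: "nat \<Rightarrow> nat set pair_pre_digraph" where
  "G_graph k = \<lparr> pverts = small_subsets k,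
     parcs = {(S, T). S \<in> small_subsets k \<and> T \<in> small_subsets k \<and> S \<noteq> T \<and> S \<inter> T \<noteq> {}} \<rparr>"

definition B_graph :: "nat \<Rightarrow> nat set pair_pre_digraph" where
  "B_graph k = \<lparr> pverts = small_subsets k,
     parcs = {(S, T) \<in> parcs (G_graph k). \<not> (card S = 2 \<and> card T = 2)} \<rparr>"

definition H_graph :: "nat \<Rightarrow> nat set pair_pre_digraph" where
  "H_graph k = \<lparr> pverts = small_subsets k,
     parcs = parcs (G_graph k) - {{1, 2}, {1, 3}, {2, 3}} \<times> {{1, 2}, {1, 3}, {2, 3}} \<rparr>"

end

theory Submission
  imports Defs "HOL-Probability.Probability_Measure" "HOL-Library.Ramsey" "HOL-Combinatorics.Transposition"
begin

text \<open>
  Let $r = \operatorname{col}(P)$ and let $W$ represent a limit of \<open>P\<close>. Almost every sample of points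
  is generic: every graph that arises with positive probability from $W$ at these points is in \<open>P\<close>.
  If the graph $\{0 < W < 1\}$ contained a positive measure of $(r+1)$-cliques, then blowing these up
  and applying Ramsey's theorem inside the parts would put some $\mathcal{C}(r+1, s)$ into \<open>P\<close>. So
  it is $K_{r+1}$-free, and Turan's theorem bounds the entropy by $1 - 1/r$. This value is attained by
  limits of $\mathcal{C}(r, s) \subseteq P$, hence a maximal $W$ attains it as well: $\{0 < W < 1\}$ is
  a balanced complete $r$-partite graph on which $W = 1/2$, and $W$ is 0 or 1 within each part.

  Between the parts every adjacency is allowed, so a graph embeds as soon as its vertices are colored
  by the parts in a way that each color class embeds into its part. Two parts with large independent
  sets would give $B_{r+1}$; otherwise, since the remaining parts have large cliques, an induced path
  or an independent triple within a part would give $G_{r+1}$. So every part splits into at most two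
  cliques, and two parts that split properly would give $H_{r+1}$, which for $r = 2$ is $B_3$.
\<close>

section \<open>Almost everywhere statements in finite powers of a probability space\<close>

text \<open>A limit determines its graphon only up to null sets and relabelling, so points are only
  ever chosen outside null sets: every statement concerns an independent sample and says either
  "almost surely" or "not almost never", and Tonelli translates between samples and nested AE
  quantifiers. Two facts then suffice in place of a regularity lemma. Inclusion-exclusion turns
  homomorphism densities, which are all that a limit fixes, into induced densities, and these detect
  membership in \<open>P\<close>. An event of positive probability survives the duplication of a
  coordinate, since a non-null fibre can be hit twice; this is the blow-up. The entropy 1 - 1/r has
  to be attained by an actual convergent sequence in \<open>P\<close>, which is why explicit graphs
  are built from Walsh matrices. At the end no measure preserving map is needed: the densities of a
  step graphon depend only on the masses and weights of its cells, so it is enough to match r + 1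
  cells with those of \<open>W_graphon\<close>.\<close>

context prob_space
begin

text \<open>The measure of the set of y at which Q x y fails is an integral that depends measurably
  on x, and the AE statement says that this integral is zero.\<close>

lemma pred_AE:
  assumes [measurable]: "Measurable.pred (N \<Otimes>\<^sub>M M) (\<lambda>p. Q (fst p) (snd p))"
  shows "Measurable.pred N (\<lambda>x. AE y in M. Q x y)"
proof -
  have [measurable]: "(\<lambda>p. if Q (fst p) (snd p) then 0 else 1 :: ennreal) \<in> borel_measurable (N \<Otimes>\<^sub>M M)"
    by measurable
  have *: "(AE y in M. Q x y) \<longleftrightarrow> (\<integral>\<^sup>+ y. (if Q x y then 0 else 1) \<partial>M) = 0" if "x \<in> space N" for x
  proof -
    have "(\<lambda>y. (\<lambda>p. if Q (fst p) (snd p) then 0 else 1 :: ennreal) (x, y)) \<in> borel_measurable M"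
      using that by (intro measurable_compose[OF measurable_Pair1'[OF that]]) measurable
    then show ?thesis by (subst nn_integral_0_iff_AE) (auto intro!: AE_cong)
  qed
  have "(\<lambda>x. \<integral>\<^sup>+ y. (\<lambda>p. if Q (fst p) (snd p) then 0 else 1 :: ennreal) (x, y) \<partial>M) \<in> borel_measurable N"
    by (intro borel_measurable_nn_integral) simp
  then have "Measurable.pred N (\<lambda>x. (\<integral>\<^sup>+ y. (if Q x y then 0 else 1 :: ennreal) \<partial>M) = 0)"
    by simp
  then show ?thesis by (subst measurable_cong[OF *]) auto
qed

text \<open>Each side asserts that the indicator of the failures of \<open>Q\<close> has integral
  zero, and Tonelli evaluates that integral one coordinate at a time. The second form starts with
  the new coordinate.\<close>

lemma
  assumes V: "finite V" "v \<notin> V" and Q[measurable]: "Measurable.pred (Pi\<^sub>M (insert v V) (\<lambda>_. M)) Q"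
  shows AE_PiM_insert: "(AE x in Pi\<^sub>M (insert v V) (\<lambda>_. M). Q x) \<longleftrightarrow>
      (AE x in Pi\<^sub>M V (\<lambda>_. M). AE y in M. Q (x(v := y)))"
    and AE_PiM_insert_rev: "(AE x in Pi\<^sub>M (insert v V) (\<lambda>_. M). Q x) \<longleftrightarrow>
      (AE y in M. AE x in Pi\<^sub>M V (\<lambda>_. M). Q (x(v := y)))"
proof -
  note measurable_inner = borel_measurable_nn_integral_fst
  interpret product_sigma_finite "\<lambda>_. M" ..
  interpret PV: sigma_finite_measure "Pi\<^sub>M V (\<lambda>_. M)" using V by (intro sigma_finite)
  interpret pair_sigma_finite "Pi\<^sub>M V (\<lambda>_. M)" M ..
  let ?f = "\<lambda>x. if Q x then 0 else 1 :: ennreal"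
  have f[measurable]: "?f \<in> borel_measurable (Pi\<^sub>M (insert v V) (\<lambda>_. M))" by measurable
  have g: "(\<lambda>p. (fst p)(v := snd p)) \<in> measurable (Pi\<^sub>M V (\<lambda>_. M) \<Otimes>\<^sub>M M) (Pi\<^sub>M (insert v V) (\<lambda>_. M))"
    using measurable_add_dim[of v V "\<lambda>_. M"] by (simp add: split_beta')
  have fg[measurable]: "(\<lambda>p. ?f ((fst p)(v := snd p))) \<in> borel_measurable (Pi\<^sub>M V (\<lambda>_. M) \<Otimes>\<^sub>M M)"
    by (rule measurable_compose[OF g f])
  have Qg: "Measurable.pred (Pi\<^sub>M V (\<lambda>_. M) \<Otimes>\<^sub>M M) (\<lambda>p. Q ((fst p)(v := snd p)))"
    by (rule measurable_compose[OF g Q])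
  have inner: "(\<integral>\<^sup>+ y. ?f (x(v := y)) \<partial>M) = 0 \<longleftrightarrow> (AE y in M. Q (x(v := y)))"
    if "x \<in> space (Pi\<^sub>M V (\<lambda>_. M))" for x
  proof -
    have "(\<lambda>y. ?f (x(v := y))) \<in> borel_measurable M"
      using measurable_compose[OF measurable_Pair1'[OF that] fg] by simp
    then show ?thesis by (subst nn_integral_0_iff_AE) (auto intro!: AE_cong)
  qed
  have o: "(\<lambda>x. \<integral>\<^sup>+ y. ?f (x(v := y)) \<partial>M) \<in> borel_measurable (Pi\<^sub>M V (\<lambda>_. M))"
    using measurable_inner[OF fg] by simp
  have "(AE x in Pi\<^sub>M (insert v V) (\<lambda>_. M). Q x) \<longleftrightarrow> (\<integral>\<^sup>+ x. ?f x \<partial>Pi\<^sub>M (insert v V) (\<lambda>_. M)) = 0"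
    by (subst nn_integral_0_iff_AE[OF f]) (auto intro!: AE_cong)
  also have "\<dots> \<longleftrightarrow> (\<integral>\<^sup>+ x. \<integral>\<^sup>+ y. ?f (x(v := y)) \<partial>M \<partial>Pi\<^sub>M V (\<lambda>_. M)) = 0"
    by (subst product_nn_integral_insert[OF V f]) simp
  also have "\<dots> \<longleftrightarrow> (AE x in Pi\<^sub>M V (\<lambda>_. M). (\<integral>\<^sup>+ y. ?f (x(v := y)) \<partial>M) = 0)"
    by (rule nn_integral_0_iff_AE[OF o])
  also have "\<dots> \<longleftrightarrow> (AE x in Pi\<^sub>M V (\<lambda>_. M). AE y in M. Q (x(v := y)))"
    by (rule AE_cong) (rule inner)
  finally show 1: "(AE x in Pi\<^sub>M (insert v V) (\<lambda>_. M). Q x) \<longleftrightarrow>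
      (AE x in Pi\<^sub>M V (\<lambda>_. M). AE y in M. Q (x(v := y)))" .
  show "(AE x in Pi\<^sub>M (insert v V) (\<lambda>_. M). Q x) \<longleftrightarrow>
      (AE y in M. AE x in Pi\<^sub>M V (\<lambda>_. M). Q (x(v := y)))"
    unfolding 1 by (rule AE_commute) (use Qg in \<open>simp add: pred_def\<close>)
qed

lemma pred_component:
  assumes "Measurable.pred M Q" "v \<in> V"
  shows "Measurable.pred (Pi\<^sub>M V (\<lambda>_. M)) (\<lambda>x. Q (x v))"
  using assms by measurable

lemma pred_component_pair:
  assumes Q: "Measurable.pred (M \<Otimes>\<^sub>M M) (\<lambda>p. Q (fst p) (snd p))" and "u \<in> V" "v \<in> V"
  shows "Measurable.pred (Pi\<^sub>M V (\<lambda>_. M)) (\<lambda>x. Q (x u) (x v))"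
proof -
  have "(\<lambda>x. (x u, x v)) \<in> measurable (Pi\<^sub>M V (\<lambda>_. M)) (M \<Otimes>\<^sub>M M)"
    using assms by measurable
  from measurable_compose[OF this Q] show ?thesis by simp
qed

lemma AE_PiM_point:
  assumes "finite V" "v \<in> V" and Q: "Measurable.pred M Q" and ae: "AE y in M. Q y"
  shows "AE x in Pi\<^sub>M V (\<lambda>_. M). Q (x v)"
proof -
  have V: "V = insert v (V - {v})" "finite (V - {v})" "v \<notin> V - {v}" using assms by auto
  show ?thesis
    by (subst V(1), subst AE_PiM_insert[OF V(2,3)]) (use Q ae in \<open>auto intro!: pred_component\<close>)
qed

text \<open>Two distinct coordinates are independent samples from M. For equal coordinates nothing
  could be said, since the diagonal may be null.\<close>

lemma AE_PiM_pair:
  assumes "finite V" "u \<in> V" "v \<in> V" "u \<noteq> v"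
    and Q: "Measurable.pred (M \<Otimes>\<^sub>M M) (\<lambda>p. Q (fst p) (snd p))"
    and ae: "AE a in M. AE b in M. Q a b"
  shows "AE x in Pi\<^sub>M V (\<lambda>_. M). Q (x u) (x v)"
proof -
  have V: "V = insert v (V - {v})" "finite (V - {v})" "v \<notin> V - {v}" "u \<in> V - {v}" using assms by auto
  have "AE x in Pi\<^sub>M (V - {v}) (\<lambda>_. M). AE y in M. Q (x u) y"
    by (rule AE_PiM_point[OF V(2,4) pred_AE[OF Q] ae])
  then show ?thesis
    by (subst V(1), subst AE_PiM_insert[OF V(2,3)])
      (use Q V \<open>u \<noteq> v\<close> in \<open>auto intro!: pred_component_pair\<close>)
qed

lemma pred_restrict:
  assumes "Measurable.pred (Pi\<^sub>M V (\<lambda>_. M)) Q" "V \<subseteq> V'"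
  shows "Measurable.pred (Pi\<^sub>M V' (\<lambda>_. M)) (\<lambda>x. Q (restrict x V))"
  by (rule measurable_compose[OF measurable_restrict_subset[OF assms(2)] assms(1)])

lemma restrict_upd_space:
  assumes "x \<in> space (Pi\<^sub>M V (\<lambda>_. M))" "w \<notin> V"
  shows "restrict (x(w := y)) V = x"
  using assms by (auto simp: space_PiM fun_eq_iff PiE_def extensional_def)

text \<open>Positive probability is phrased as the failure of "almost never", so that Tonelli for AE
  applies to it directly. If the enlarged event were null, then D would be null over almost every x
  with \<open>Q x\<close>.\<close>

lemma positive_extend:
  assumes V: "finite V" "w \<notin> V" and Q: "Measurable.pred (Pi\<^sub>M V (\<lambda>_. M)) Q"
    and pos: "\<not> (AE x in Pi\<^sub>M V (\<lambda>_. M). \<not> Q x)"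
    and D[measurable]: "D \<in> sets M" and D0: "emeasure M D \<noteq> 0"
  shows "\<not> (AE x in Pi\<^sub>M (insert w V) (\<lambda>_. M). \<not> (Q (restrict x V) \<and> x w \<in> D))"
proof
  have [measurable]: "Measurable.pred (Pi\<^sub>M (insert w V) (\<lambda>_. M)) (\<lambda>x. Q (restrict x V))"
    by (rule pred_restrict[OF Q]) auto
  assume "AE x in Pi\<^sub>M (insert w V) (\<lambda>_. M). \<not> (Q (restrict x V) \<and> x w \<in> D)"
  then have "AE x in Pi\<^sub>M V (\<lambda>_. M). AE y in M. \<not> (Q (restrict (x(w := y)) V) \<and> y \<in> D)"
    by (subst (asm) AE_PiM_insert[OF V]) (simp_all del: fun_upd_apply add: fun_upd_same)
  then have "AE x in Pi\<^sub>M V (\<lambda>_. M). \<not> Q x"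
  proof (rule AE_mp[OF _ AE_I2], intro impI notI)
    fix x assume x: "x \<in> space (Pi\<^sub>M V (\<lambda>_. M))" "Q x"
      and "AE y in M. \<not> (Q (restrict (x(w := y)) V) \<and> y \<in> D)"
    then have "AE y in M. y \<notin> D" using restrict_upd_space[OF x(1) V(2)] by simp
    then show False using D0 AE_iff_measurable[OF D, of "\<lambda>y. y \<notin> D"] sets.sets_into_space[OF D] by auto
  qed
  with pos show False ..
qed

text \<open>With the other coordinates shared, two independent draws for v satisfy \<open>Q\<close>
  together with positive probability: for a non-null set of the other coordinates the good values of
  v have positive measure, and so has the square of that set. Iterating this blows up a
  configuration.\<close>

lemma positive_duplicate:
  assumes V: "finite V" "v \<in> V" "w \<notin> V" and Q: "Measurable.pred (Pi\<^sub>M V (\<lambda>_. M)) Q"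
    and pos: "\<not> (AE x in Pi\<^sub>M V (\<lambda>_. M). \<not> Q x)"
  shows "\<not> (AE x in Pi\<^sub>M (insert w V) (\<lambda>_. M). \<not> (Q (restrict x V) \<and> Q ((restrict x V)(v := x w))))"
proof
  let ?V0 = "V - {v}"
  have V0: "insert v ?V0 = V" "finite ?V0" "v \<notin> ?V0" "v \<noteq> w" using V by auto
  have [measurable]: "Measurable.pred (Pi\<^sub>M (insert w V) (\<lambda>_. M)) (\<lambda>x. Q (restrict x V))"
    by (rule pred_restrict[OF Q]) auto
  have up: "(\<lambda>p. (fst p)(v := snd p)) \<in> measurable (Pi\<^sub>M V (\<lambda>_. M) \<Otimes>\<^sub>M M) (Pi\<^sub>M V (\<lambda>_. M))"
    using measurable_add_dim[of v V "\<lambda>_. M"] V by (simp add: split_beta' insert_absorb)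
  have "(\<lambda>x. (restrict x V, x w)) \<in> measurable (Pi\<^sub>M (insert w V) (\<lambda>_. M)) (Pi\<^sub>M V (\<lambda>_. M) \<Otimes>\<^sub>M M)"
    by (intro measurable_Pair measurable_restrict_subset measurable_component_singleton) auto
  from measurable_compose[OF measurable_compose[OF this up] Q]
  have [measurable]: "Measurable.pred (Pi\<^sub>M (insert w V) (\<lambda>_. M)) (\<lambda>x. Q ((restrict x V)(v := x w)))"
    by simp
  assume "AE x in Pi\<^sub>M (insert w V) (\<lambda>_. M). \<not> (Q (restrict x V) \<and> Q ((restrict x V)(v := x w)))"
  then have "AE x in Pi\<^sub>M V (\<lambda>_. M). AE y in M. \<not> (Q (restrict (x(w := y)) V) \<and> Q ((restrict (x(w := y)) V)(v := y)))"
    by (subst (asm) AE_PiM_insert[OF V(1,3)]) (simp_all del: fun_upd_apply add: fun_upd_same)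
  then have 1: "AE x in Pi\<^sub>M V (\<lambda>_. M). AE y in M. \<not> (Q x \<and> Q (x(v := y)))"
    by (rule AE_mp[OF _ AE_I2]) (simp add: restrict_upd_space[OF _ V(3)] del: fun_upd_apply)
  have "Measurable.pred (Pi\<^sub>M V (\<lambda>_. M)) (\<lambda>x. AE y in M. \<not> (Q x \<and> Q (x(v := y))))"
    by (rule pred_AE) (intro pred_intros_logic measurable_compose[OF up Q] measurable_compose[OF measurable_fst Q])
  then have "AE x in Pi\<^sub>M ?V0 (\<lambda>_. M). AE a in M. AE y in M. \<not> (Q (x(v := a)) \<and> Q (x(v := y)))"
    using 1 AE_PiM_insert[OF V0(2,3), of "\<lambda>x. AE y in M. \<not> (Q x \<and> Q (x(v := y)))", unfolded V0(1)]
    by (simp del: de_Morgan_conj)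
  then have "AE x in Pi\<^sub>M ?V0 (\<lambda>_. M). AE a in M. \<not> Q (x(v := a))"
  proof (rule AE_mp[OF _ AE_I2], intro impI)
    fix x assume ae: "AE a in M. AE y in M. \<not> (Q (x(v := a)) \<and> Q (x(v := y)))"
    show "AE a in M. \<not> Q (x(v := a))"
    proof (rule ccontr)
      assume n: "\<not> (AE a in M. \<not> Q (x(v := a)))"
      \<comment> \<open>If all a with \<open>Q\<close> were exceptional, \<open>Q\<close> would
        almost never hold. One good typical a already forces almost every y to fail, which is the
        contradiction.\<close>
      have "\<exists>a. Q (x(v := a)) \<and> (AE y in M. \<not> (Q (x(v := a)) \<and> Q (x(v := y))))"
      proof (rule ccontr)
        assume *: "\<not> ?thesis"
        have "AE a in M. \<not> Q (x(v := a))"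
          using ae by (rule eventually_mono) (use * in blast)
        with n show False ..
      qed
      with n show False by auto
    qed
  qed
  then have "AE x in Pi\<^sub>M V (\<lambda>_. M). \<not> Q x"
    using AE_PiM_insert[OF V0(2,3), of "\<lambda>x. \<not> Q x", unfolded V0(1)] Q by simp
  with pos show False ..
qed

lemma AE_triple_rotate:
  assumes T: "Measurable.pred (M \<Otimes>\<^sub>M M \<Otimes>\<^sub>M M) (\<lambda>q. T (fst q) (fst (snd q)) (snd (snd q)))"
    and ae: "AE x in M. AE y in M. AE z in M. T x y z"
  shows "AE y in M. AE x in M. AE z in M. T x y z"
proof -
  interpret pair_sigma_finite M M ..
  have "(\<lambda>p. (fst (fst p), snd (fst p), snd p)) \<in> measurable ((M \<Otimes>\<^sub>M M) \<Otimes>\<^sub>M M) (M \<Otimes>\<^sub>M M \<Otimes>\<^sub>M M)"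
    by measurable
  from measurable_compose[OF this T]
  have "Measurable.pred ((M \<Otimes>\<^sub>M M) \<Otimes>\<^sub>M M) (\<lambda>p. T (fst (fst p)) (snd (fst p)) (snd p))" by simp
  then have "Measurable.pred (M \<Otimes>\<^sub>M M) (\<lambda>p. AE z in M. T (fst p) (snd p) z)"
    by (rule pred_AE)
  then have "{p \<in> space (M \<Otimes>\<^sub>M M). AE z in M. T (fst p) (snd p) z} \<in> sets (M \<Otimes>\<^sub>M M)"
    by (simp add: pred_def)
  from iffD1[OF AE_commute[OF this] ae] show ?thesis .
qed

lemma AE_triple_swap:
  assumes T: "Measurable.pred (M \<Otimes>\<^sub>M M \<Otimes>\<^sub>M M) (\<lambda>q. T (fst q) (fst (snd q)) (snd (snd q)))"
    and ae: "AE x in M. AE y in M. AE z in M. T x y z"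
  shows "AE x in M. AE z in M. AE y in M. T x y z"
proof (rule AE_mp[OF ae AE_I2], intro impI)
  interpret pair_sigma_finite M M ..
  fix x assume x: "x \<in> space M" and *: "AE y in M. AE z in M. T x y z"
  have "Measurable.pred (M \<Otimes>\<^sub>M M) (\<lambda>p. T x (fst p) (snd p))"
    using measurable_compose[OF measurable_Pair1'[OF x] T] by simp
  then have "{p \<in> space (M \<Otimes>\<^sub>M M). T x (fst p) (snd p)} \<in> sets (M \<Otimes>\<^sub>M M)"
    by (simp add: pred_def)
  from iffD1[OF AE_commute[OF this] *] show "AE z in M. AE y in M. T x y z" .
qed

end

section \<open>Turan's theorem for measurable graphs\<close>

locale measurable_graph = prob_space +
  fixes R :: "'a \<Rightarrow> 'a \<Rightarrow> bool"
  assumes R_sym: "\<And>x y. x \<in> space M \<Longrightarrow> y \<in> space M \<Longrightarrow> R x y \<longleftrightarrow> R y x"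
    and R_pred: "Measurable.pred (M \<Otimes>\<^sub>M M) (\<lambda>p. R (fst p) (snd p))"
begin

definition u :: "'a \<Rightarrow> 'a \<Rightarrow> ennreal" where
  "u x y = (if R x y then 1 else 0)"

lemma R_meas [measurable (raw)]:
  assumes "f \<in> measurable N M" "g \<in> measurable N M"
  shows "Measurable.pred N (\<lambda>w. R (f w) (g w))"
  using measurable_compose[OF measurable_Pair[OF assms] R_pred] by simp

lemma u_meas [measurable (raw)]:
  assumes [measurable]: "f \<in> measurable N M" "g \<in> measurable N M"
  shows "(\<lambda>w. u (f w) (g w)) \<in> borel_measurable N"
  unfolding u_def by measurable

lemma u_sym: "x \<in> space M \<Longrightarrow> y \<in> space M \<Longrightarrow> u x y = u y x"
  using R_sym by (simp add: u_def)

definition deg :: "'a set \<Rightarrow> 'a \<Rightarrow> ennreal" where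
  "deg A x = (\<integral>\<^sup>+ y. indicator A y * u x y \<partial>M)"

text \<open>Ordered pairs are counted, so the balanced complete n-partite graph has mass 1 - 1/n, in
  the same normalisation as the entropy.\<close>

definition edge_mass :: "'a set \<Rightarrow> ennreal" where
  "edge_mass A = (\<integral>\<^sup>+ x. indicator A x * deg A x \<partial>M)"

text \<open>
  The slack in the double count of triples behind Turan's theorem: if it vanishes, non-adjacency
  is almost everywhere transitive, so the graph is complete multipartite.
\<close>

definition defect :: "'a set \<Rightarrow> ennreal" where
  "defect A = (\<integral>\<^sup>+ x. \<integral>\<^sup>+ y. \<integral>\<^sup>+ z. indicator A x * indicator A y * indicator A z *
     (if R x y \<and> \<not> R x z \<and> \<not> R y z then 1 else 0) \<partial>M \<partial>M \<partial>M)"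

definition nbhd :: "'a set \<Rightarrow> 'a \<Rightarrow> 'a set" where
  "nbhd A x = {y \<in> space M. y \<in> A \<and> R x y}"

lemma deg_meas [measurable (raw)]:
  assumes [measurable]: "A \<in> sets M" "f \<in> measurable N M"
  shows "(\<lambda>w. deg A (f w)) \<in> borel_measurable N"
  unfolding deg_def by measurable

lemma nbhd_sets:
  assumes [measurable]: "A \<in> sets M" and [simp]: "x \<in> space M"
  shows "nbhd A x \<in> sets M"
  unfolding nbhd_def by measurable

lemma indicator_nbhd: "y \<in> space M \<Longrightarrow> indicator (nbhd A x) y = indicator A y * u x y"
  by (auto simp: nbhd_def u_def indicator_def)

lemma emeasure_nbhd:
  assumes "A \<in> sets M" "x \<in> space M"
  shows "emeasure M (nbhd A x) = deg A x"
  using nbhd_sets[OF assms] indicator_nbhd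
  by (simp add: deg_def cong: nn_integral_cong flip: nn_integral_indicator)

lemma edge_mass_nbhd:
  assumes [measurable]: "A \<in> sets M" and [simp]: "x \<in> space M"
  shows "edge_mass (nbhd A x) =
    (\<integral>\<^sup>+ y. indicator A y * u x y * (\<integral>\<^sup>+ z. indicator A z * u x z * u y z \<partial>M) \<partial>M)"
  unfolding edge_mass_def deg_def by (intro nn_integral_cong) (simp add: indicator_nbhd cong: nn_integral_cong)

text \<open>Fix an edge xy and a third point z. The number of edges from z to x and y is 0, 1 or 2;
  adding 1 if it is 0 and subtracting 1 if it is 2 always leaves 1. Integrate this identity: the
  paths centred at x and those centred at y contribute D each, the constant 1 contributes
  \<open>emeasure M A * edge_mass A\<close>, and the triangles are the edges inside neighbourhoods,
  which \<beta> bounds.\<close>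

lemma triple_sum_le:
  assumes A[measurable]: "A \<in> sets M"
    and \<beta>: "AE x in M. x \<in> A \<longrightarrow> edge_mass (nbhd A x) \<le> \<beta> * (deg A x)\<^sup>2"
  defines "D \<equiv> \<integral>\<^sup>+ x. indicator A x * (deg A x)\<^sup>2 \<partial>M"
  shows "2 * D + defect A \<le> emeasure M A * edge_mass A + \<beta> * D"
proof -
  let ?a = "indicator A :: 'a \<Rightarrow> ennreal"
  interpret pair_sigma_finite M M ..
  let ?m = "\<lambda>x y z. if R x y \<and> \<not> R x z \<and> \<not> R y z then 1 else 0 :: ennreal"
  have T1: "(\<integral>\<^sup>+ x. \<integral>\<^sup>+ y. \<integral>\<^sup>+ z. ?a x * ?a y * ?a z * (u x y * u x z) \<partial>M \<partial>M \<partial>M) = D"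
  proof -
    have "(\<integral>\<^sup>+ y. \<integral>\<^sup>+ z. ?a x * ?a y * ?a z * (u x y * u x z) \<partial>M \<partial>M) = ?a x * (deg A x)\<^sup>2"
      if [simp]: "x \<in> space M" for x
    proof -
      have "(\<integral>\<^sup>+ z. ?a x * ?a y * ?a z * (u x y * u x z) \<partial>M) = ?a x * deg A x * (?a y * u x y)"
        if [simp]: "y \<in> space M" for y
      proof -
        have "(\<integral>\<^sup>+ z. ?a x * ?a y * ?a z * (u x y * u x z) \<partial>M) = (\<integral>\<^sup>+ z. (?a x * ?a y * u x y) * (?a z * u x z) \<partial>M)"
          by (simp add: ac_simps)
        also have "\<dots> = (?a x * ?a y * u x y) * deg A x"
          unfolding deg_def by (rule nn_integral_cmult) measurable
        finally show ?thesis by (simp add: ac_simps)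
      qed
      then have "(\<integral>\<^sup>+ y. \<integral>\<^sup>+ z. ?a x * ?a y * ?a z * (u x y * u x z) \<partial>M \<partial>M) =
          (\<integral>\<^sup>+ y. ?a x * deg A x * (?a y * u x y) \<partial>M)" by (rule nn_integral_cong)
      also have "\<dots> = ?a x * deg A x * deg A x"
        by (subst nn_integral_cmult) (measurable, simp add: deg_def)
      finally show ?thesis by (simp add: power2_eq_square ac_simps)
    qed
    then show ?thesis unfolding D_def by (rule nn_integral_cong)
  qed
  have T2: "(\<integral>\<^sup>+ x. \<integral>\<^sup>+ y. \<integral>\<^sup>+ z. ?a x * ?a y * ?a z * (u x y * u y z) \<partial>M \<partial>M \<partial>M) = D"
  proof -
    have "(\<integral>\<^sup>+ z. ?a x * ?a y * ?a z * (u x y * u y z) \<partial>M) = ?a y * deg A y * (?a x * u y x)"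
      if [simp]: "x \<in> space M" "y \<in> space M" for x y
    proof -
      have "(\<integral>\<^sup>+ z. ?a x * ?a y * ?a z * (u x y * u y z) \<partial>M) = (\<integral>\<^sup>+ z. (?a x * ?a y * u y x) * (?a z * u y z) \<partial>M)"
        using u_sym[of x y] by (simp add: ac_simps)
      also have "\<dots> = (?a x * ?a y * u y x) * deg A y"
        unfolding deg_def by (rule nn_integral_cmult) measurable
      finally show ?thesis by (simp add: ac_simps)
    qed
    then have "(\<integral>\<^sup>+ x. \<integral>\<^sup>+ y. \<integral>\<^sup>+ z. ?a x * ?a y * ?a z * (u x y * u y z) \<partial>M \<partial>M \<partial>M) =
        (\<integral>\<^sup>+ x. \<integral>\<^sup>+ y. ?a y * deg A y * (?a x * u y x) \<partial>M \<partial>M)"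
      by (intro nn_integral_cong) auto
    also have "\<dots> = (\<integral>\<^sup>+ y. \<integral>\<^sup>+ x. ?a y * deg A y * (?a x * u y x) \<partial>M \<partial>M)"
      using Fubini'[of "\<lambda>y x. ?a y * deg A y * (?a x * u y x)"] by measurable
    also have "\<dots> = (\<integral>\<^sup>+ y. ?a y * deg A y * deg A y \<partial>M)"
    proof (rule nn_integral_cong)
      fix y assume [simp]: "y \<in> space M"
      show "(\<integral>\<^sup>+ x. ?a y * deg A y * (?a x * u y x) \<partial>M) = ?a y * deg A y * deg A y"
        by (subst nn_integral_cmult) (measurable, simp add: deg_def)
    qed
    finally show ?thesis by (simp add: D_def power2_eq_square ac_simps)
  qed
  have T3: "(\<integral>\<^sup>+ x. \<integral>\<^sup>+ y. \<integral>\<^sup>+ z. ?a x * ?a y * ?a z * u x y \<partial>M \<partial>M \<partial>M) = emeasure M A * edge_mass A"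
  proof -
    have "(\<integral>\<^sup>+ y. \<integral>\<^sup>+ z. ?a x * ?a y * ?a z * u x y \<partial>M \<partial>M) = emeasure M A * (?a x * deg A x)"
      if [simp]: "x \<in> space M" for x
    proof -
      have "(\<integral>\<^sup>+ z. ?a x * ?a y * ?a z * u x y \<partial>M) = ?a x * emeasure M A * (?a y * u x y)" for y
      proof -
        have "(\<integral>\<^sup>+ z. ?a x * ?a y * ?a z * u x y \<partial>M) = (\<integral>\<^sup>+ z. (?a x * ?a y * u x y) * ?a z \<partial>M)"
          by (simp add: ac_simps)
        also have "\<dots> = (?a x * ?a y * u x y) * emeasure M A"
          by (subst nn_integral_cmult) simp_all
        finally show ?thesis by (simp add: ac_simps)
      qed
      then have "(\<integral>\<^sup>+ y. \<integral>\<^sup>+ z. ?a x * ?a y * ?a z * u x y \<partial>M \<partial>M) = (\<integral>\<^sup>+ y. ?a x * emeasure M A * (?a y * u x y) \<partial>M)"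
        by simp
      also have "\<dots> = ?a x * emeasure M A * deg A x"
        by (subst nn_integral_cmult) (measurable, simp add: deg_def)
      finally show ?thesis by (simp add: ac_simps)
    qed
    then have "(\<integral>\<^sup>+ x. \<integral>\<^sup>+ y. \<integral>\<^sup>+ z. ?a x * ?a y * ?a z * u x y \<partial>M \<partial>M \<partial>M) = (\<integral>\<^sup>+ x. emeasure M A * (?a x * deg A x) \<partial>M)"
      by (rule nn_integral_cong)
    then show ?thesis by (simp add: nn_integral_cmult edge_mass_def)
  qed
  have "(\<integral>\<^sup>+ x. \<integral>\<^sup>+ y. \<integral>\<^sup>+ z. ?a x * ?a y * ?a z * (u x y * u x z * u y z) \<partial>M \<partial>M \<partial>M) =
      (\<integral>\<^sup>+ x. ?a x * edge_mass (nbhd A x) \<partial>M)"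
  proof (rule nn_integral_cong)
    fix x assume [simp]: "x \<in> space M"
    have "(\<integral>\<^sup>+ z. ?a x * ?a y * ?a z * (u x y * u x z * u y z) \<partial>M) =
        ?a x * (?a y * u x y * (\<integral>\<^sup>+ z. ?a z * u x z * u y z \<partial>M))" if [simp]: "y \<in> space M" for y
    proof -
      have "(\<integral>\<^sup>+ z. ?a x * ?a y * ?a z * (u x y * u x z * u y z) \<partial>M) =
          (\<integral>\<^sup>+ z. (?a x * ?a y * u x y) * (?a z * u x z * u y z) \<partial>M)" by (simp add: ac_simps)
      also have "\<dots> = (?a x * ?a y * u x y) * (\<integral>\<^sup>+ z. ?a z * u x z * u y z \<partial>M)"
        by (rule nn_integral_cmult) measurable
      finally show ?thesis by (simp add: ac_simps)
    qed
    then have "(\<integral>\<^sup>+ y. \<integral>\<^sup>+ z. ?a x * ?a y * ?a z * (u x y * u x z * u y z) \<partial>M \<partial>M) =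
        (\<integral>\<^sup>+ y. ?a x * (?a y * u x y * (\<integral>\<^sup>+ z. ?a z * u x z * u y z \<partial>M)) \<partial>M)" by (rule nn_integral_cong)
    also have "\<dots> = ?a x * (\<integral>\<^sup>+ y. ?a y * u x y * (\<integral>\<^sup>+ z. ?a z * u x z * u y z \<partial>M) \<partial>M)"
      by (rule nn_integral_cmult) measurable
    finally show "(\<integral>\<^sup>+ y. \<integral>\<^sup>+ z. ?a x * ?a y * ?a z * (u x y * u x z * u y z) \<partial>M \<partial>M) = ?a x * edge_mass (nbhd A x)"
      by (simp add: edge_mass_nbhd)
  qed
  also have "\<dots> \<le> (\<integral>\<^sup>+ x. \<beta> * (?a x * (deg A x)\<^sup>2) \<partial>M)"
    by (rule nn_integral_mono_AE) (use \<beta> in \<open>auto simp: indicator_def elim!: eventually_mono\<close>)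
  also have "\<dots> = \<beta> * D"
    unfolding D_def by (rule nn_integral_cmult) measurable
  finally have T4: "(\<integral>\<^sup>+ x. \<integral>\<^sup>+ y. \<integral>\<^sup>+ z. ?a x * ?a y * ?a z * (u x y * u x z * u y z) \<partial>M \<partial>M \<partial>M) \<le> \<beta> * D" .
  have "2 * D + defect A = D + D + defect A" by (simp add: mult_2)
  also have "\<dots> = (\<integral>\<^sup>+ x. \<integral>\<^sup>+ y. \<integral>\<^sup>+ z. ?a x * ?a y * ?a z * (u x y * u x z) +
      ?a x * ?a y * ?a z * (u x y * u y z) + ?a x * ?a y * ?a z * ?m x y z \<partial>M \<partial>M \<partial>M)"
    unfolding T1[symmetric] defect_def
    apply (subst (2) T1) apply (subst T2[symmetric])
    by (simp add: nn_integral_add cong: nn_integral_cong)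
  also have "\<dots> \<le> (\<integral>\<^sup>+ x. \<integral>\<^sup>+ y. \<integral>\<^sup>+ z. ?a x * ?a y * ?a z * u x y +
      ?a x * ?a y * ?a z * (u x y * u x z * u y z) \<partial>M \<partial>M \<partial>M)"
    by (intro nn_integral_mono) (auto simp: u_def indicator_def)
  also have "\<dots> = (\<integral>\<^sup>+ x. \<integral>\<^sup>+ y. \<integral>\<^sup>+ z. ?a x * ?a y * ?a z * u x y \<partial>M \<partial>M \<partial>M) +
      (\<integral>\<^sup>+ x. \<integral>\<^sup>+ y. \<integral>\<^sup>+ z. ?a x * ?a y * ?a z * (u x y * u x z * u y z) \<partial>M \<partial>M \<partial>M)"
    by (simp add: nn_integral_add cong: nn_integral_cong)
  also have "\<dots> \<le> emeasure M A * edge_mass A + \<beta> * D"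
    unfolding T3 by (rule add_left_mono) (rule T4)
  finally show ?thesis .
qed

definition clique_in :: "'a set \<Rightarrow> 'i set \<Rightarrow> ('i \<Rightarrow> 'a) \<Rightarrow> bool" where
  "clique_in A I x \<longleftrightarrow> (\<forall>i\<in>I. x i \<in> A) \<and> (\<forall>i\<in>I. \<forall>j\<in>I. i \<noteq> j \<longrightarrow> R (x i) (x j))"

lemma pred_clique_in:
  assumes [measurable]: "A \<in> sets M" and I: "finite I"
  shows "Measurable.pred (PiM I (\<lambda>_. M)) (clique_in A I)"
proof -
  have 1: "Measurable.pred (PiM I (\<lambda>_. M)) (\<lambda>x. i \<noteq> j \<longrightarrow> R (x i) (x j))" if [simp]: "i \<in> I" "j \<in> I" for i j
    using pred_component_pair[OF R_pred that] by measurable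
  have 2: "Measurable.pred (PiM I (\<lambda>_. M)) (\<lambda>x. x i \<in> A)" if [simp]: "i \<in> I" for i
    by measurable
  show ?thesis unfolding clique_in_def
    by (intro pred_intros_logic pred_intros_finite I 1 2)
qed

text \<open>A point y of A completes a clique inside its neighbourhood to a clique with one more
  vertex. Splitting off the coordinate i makes this a statement about almost every y and lowers the
  clique size for the induction.\<close>

lemma AE_no_clique_nbhd:
  assumes A: "A \<in> sets M" and I: "finite I" "i \<notin> I"
    and ae: "AE x in PiM (insert i I) (\<lambda>_. M). \<not> clique_in A (insert i I) x"
  shows "AE y in M. y \<in> A \<longrightarrow> (AE x in PiM I (\<lambda>_. M). \<not> clique_in (nbhd A y) I x)"
proof -
  have "AE y in M. AE x in PiM I (\<lambda>_. M). \<not> clique_in A (insert i I) (x(i := y))"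
    using ae I by (subst (asm) AE_PiM_insert_rev) (auto intro!: pred_intros_logic pred_clique_in A)
  then show ?thesis
  proof (rule AE_mp[OF _ AE_I2], intro impI)
    fix y assume y: "y \<in> space M" "y \<in> A"
      and ae: "AE x in PiM I (\<lambda>_. M). \<not> clique_in A (insert i I) (x(i := y))"
    show "AE x in PiM I (\<lambda>_. M). \<not> clique_in (nbhd A y) I x"
    proof (rule AE_mp[OF ae AE_I2], intro impI notI)
      fix x assume "x \<in> space (PiM I (\<lambda>_. M))" and n: "\<not> clique_in A (insert i I) (x(i := y))"
        and c: "clique_in (nbhd A y) I x"
      have 1: "x j \<in> A" "R y (x j)" "R (x j) y" if "j \<in> I" for j
        using c that R_sym[of y "x j"] y by (auto simp: clique_in_def nbhd_def)
      have 2: "R (x j) (x k)" if "j \<in> I" "k \<in> I" "j \<noteq> k" for j k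
        using c that by (auto simp: clique_in_def)
      have "clique_in A (insert i I) (x(i := y))"
        using 1 2 I(2) y by (auto simp: clique_in_def)
      with n show False ..
    qed
  qed
qed

lemma deg_le_1:
  assumes "A \<in> sets M"
  shows "deg A x \<le> 1"
proof -
  have "deg A x \<le> (\<integral>\<^sup>+ y. indicator A y \<partial>M)"
    unfolding deg_def by (rule nn_integral_mono) (auto simp: u_def split: split_indicator)
  also have "\<dots> = emeasure M A" using assms by simp
  also have "\<dots> \<le> 1" by (simp add: emeasure_eq_measure)
  finally show ?thesis .
qed

lemma nn_integral_le_1:
  assumes "\<And>x. x \<in> space M \<Longrightarrow> f x \<le> 1"
  shows "(\<integral>\<^sup>+ x. f x \<partial>M) \<le> 1"
proof -
  have "(\<integral>\<^sup>+ x. f x \<partial>M) \<le> (\<integral>\<^sup>+ x. 1 \<partial>M)" by (rule nn_integral_mono) (rule assms)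
  then show ?thesis by (simp add: emeasure_space_1)
qed

text \<open>Real values are extracted because the term \<beta> D of \<open>triple_sum_le\<close>,
  with \<beta> = 1 - 1/n, has to move to the left, where it leaves the factor 2 - \<beta> = 1 + 1/n.
  The last estimate is the Cauchy-Schwarz inequality for the degree on A.\<close>

lemma edge_mass_estimates:
  assumes A[measurable]: "A \<in> sets M" and n: "n \<ge> 1"
    and \<beta>: "AE x in M. x \<in> A \<longrightarrow> edge_mass (nbhd A x) \<le> ennreal (1 - 1 / real n) * (deg A x)\<^sup>2"
  obtains e d m where "0 \<le> e" "0 \<le> d" "0 \<le> m"
    "edge_mass A = ennreal e" "(\<integral>\<^sup>+ x. indicator A x * (deg A x)\<^sup>2 \<partial>M) = ennreal d" "defect A = ennreal m"
    "(1 + 1 / real n) * d + m \<le> measure M A * e" "e\<^sup>2 \<le> d * measure M A"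
proof -
  let ?D = "\<integral>\<^sup>+ x. indicator A x * (deg A x)\<^sup>2 \<partial>M"
  have deg1: "deg A x \<le> 1" for x by (rule deg_le_1) fact
  have "edge_mass A \<le> 1"
    unfolding edge_mass_def by (rule nn_integral_le_1) (auto simp: indicator_def deg1)
  moreover have "?D \<le> 1"
    by (rule nn_integral_le_1) (auto simp: indicator_def power2_eq_square intro: mult_left_le_one_le order_trans[OF mult_mono[OF deg1 deg1]])
  moreover have "defect A \<le> 1"
    unfolding defect_def by (intro nn_integral_le_1) (auto simp: indicator_def)
  ultimately have fin: "edge_mass A < top" "?D < top" "defect A < top"
    by (auto intro: le_less_trans[of _ 1])
  define e d m where "e = enn2real (edge_mass A)" and "d = enn2real ?D" and "m = enn2real (defect A)"
  have E: "edge_mass A = ennreal e" "?D = ennreal d" "defect A = ennreal m"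
    using fin by (simp_all add: e_def d_def m_def ennreal_enn2real)
  have nn: "0 \<le> e" "0 \<le> d" "0 \<le> m" by (simp_all add: e_def d_def m_def)
  have M: "emeasure M A = ennreal (measure M A)" by (rule emeasure_eq_measure)
  have b: "0 \<le> 1 - 1 / real n" using n by simp
  have "2 * ennreal d + ennreal m \<le> ennreal (measure M A) * ennreal e + ennreal (1 - 1 / real n) * ennreal d"
    using triple_sum_le[OF A \<beta>] by (simp only: E M)
  also have "2 * ennreal d + ennreal m = ennreal (2 * d + m)"
    using nn by (simp add: ennreal_mult flip: ennreal_numeral)
  also have "ennreal (measure M A) * ennreal e + ennreal (1 - 1 / real n) * ennreal d
      = ennreal (measure M A * e + (1 - 1 / real n) * d)"
    using nn b by (simp add: ennreal_mult)
  finally have 1: "2 * d + m \<le> measure M A * e + (1 - 1 / real n) * d"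
    using nn b by (subst (asm) ennreal_le_iff) auto
  \<comment> \<open>Integrate (deg - c)^2 \<ge> 0 over A. The best choice c = e / measure M A will
    give Cauchy-Schwarz.\<close>
  have 2: "2 * c * e \<le> d + c\<^sup>2 * measure M A" if c: "0 \<le> c" for c
  proof -
    have "ennreal (2 * c) * edge_mass A = (\<integral>\<^sup>+ x. ennreal (2 * c) * (indicator A x * deg A x) \<partial>M)"
      unfolding edge_mass_def by (rule nn_integral_cmult[symmetric]) measurable
    also have "\<dots> \<le> (\<integral>\<^sup>+ x. indicator A x * (deg A x)\<^sup>2 + ennreal (c\<^sup>2) * indicator A x \<partial>M)"
    proof (rule nn_integral_mono)
      fix x
      obtain t where t: "0 \<le> t" "deg A x = ennreal t"
        using deg1[of x] by (cases "deg A x") (auto simp: top_unique)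
      have "2 * c * t \<le> t\<^sup>2 + c\<^sup>2" using zero_le_power2[of "t - c"] by (simp add: power2_eq_square algebra_simps)
      then have "ennreal (2 * c) * ennreal t \<le> (ennreal t)\<^sup>2 + ennreal (c\<^sup>2)"
        using t c by (simp add: ennreal_power flip: ennreal_mult ennreal_plus)
      then show "ennreal (2 * c) * (indicator A x * deg A x) \<le> indicator A x * (deg A x)\<^sup>2 + ennreal (c\<^sup>2) * indicator A x"
        by (auto simp: indicator_def t)
    qed
    also have "\<dots> = ?D + ennreal (c\<^sup>2) * emeasure M A"
      by (subst nn_integral_add) (auto simp: nn_integral_cmult)
    finally have "ennreal (2 * c * e) \<le> ennreal (d + c\<^sup>2 * measure M A)"
      unfolding E M using nn c by (simp add: ennreal_mult)
    then show ?thesis using nn by (subst (asm) ennreal_le_iff) auto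
  qed
  have 3: "e\<^sup>2 \<le> d * measure M A"
  proof (cases "measure M A = 0")
    case True
    have "e = 0"
    proof (rule ccontr)
      assume "e \<noteq> 0"
      \<comment> \<open>Here A is null, so the quadratic term vanishes and c can be taken large
        enough for the left side to exceed d.\<close>
      then have "2 * (d + 1) \<le> d" using 2[of "(d + 1) / e"] nn True by simp
      then show False using nn by simp
    qed
    then show ?thesis using nn by simp
  next
    case False
    then have "0 < measure M A" by (simp add: zero_less_measure_iff)
    then show ?thesis using 2[of "e / measure M A"] nn
      by (simp add: power2_eq_square divide_simps mult_ac)
  qed
  have "(1 + 1 / real n) * d + m \<le> measure M A * e" using 1 by (simp add: algebra_simps)
  then show ?thesis using that nn E 3 by blast
qed

text \<open>The factor 1 + 1/n left by the double count is the inverse of the next Turan density.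
  This is why the induction closes with the sharp constant.\<close>

lemma turan_ratio:
  assumes "n \<ge> 1"
  shows "(1 + 1 / real n) * (1 - 1 / real (n + 1)) = 1"
proof -
  have "1 + 1 / real n = real (n + 1) / real n" "1 - 1 / real (n + 1) = real n / real (n + 1)"
    using assms by (simp_all add: field_simps)
  then show ?thesis using assms by simp
qed

text \<open>The induction hypothesis bounds the edges inside almost every neighbourhood. Let e be
  the edge mass, d the integral of the squared degree and |A| the measure of A. Then (1 + 1/n) d
  \<le> |A| e, and together with e^2 \<le> d |A| this gives (1 + 1/n) e^2 \<le> |A|^2 e; cancelling
  e leaves the next density.\<close>

theorem turan_density:
  assumes "n \<ge> 1" "A \<in> sets M" "finite I" "card I = Suc n"
    and "AE x in PiM I (\<lambda>_. M). \<not> clique_in A I x"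
  shows "edge_mass A \<le> ennreal (1 - 1 / real n) * (emeasure M A)\<^sup>2"
  using assms
proof (induction n arbitrary: A I rule: nat_induct_at_least)
  case base
  then obtain i j where I: "I = insert i {j}" "i \<noteq> j"
    by (metis One_nat_def card_2_iff numeral_2_eq_2)
  have "AE y in M. y \<in> A \<longrightarrow> (AE x in PiM {j} (\<lambda>_. M). \<not> clique_in (nbhd A y) {j} x)"
    by (rule AE_no_clique_nbhd) (use base I in auto)
  then have "AE y in M. indicator A y * deg A y = 0"
  proof (rule AE_mp[OF _ AE_I2], intro impI)
    fix y assume y: "y \<in> space M" and
      ae: "y \<in> A \<longrightarrow> (AE x in PiM {j} (\<lambda>_. M). \<not> clique_in (nbhd A y) {j} x)"
    have "deg A y = 0" if "y \<in> A"
    proof -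
      have "nbhd A y \<in> sets M" using base y by (intro nbhd_sets)
      have "AE x in PiM {} (\<lambda>_. M). AE z in M. \<not> clique_in (nbhd A y) {j} (x(j := z))"
        using ae that by (subst (asm) AE_PiM_insert) (auto intro!: pred_intros_logic pred_clique_in nbhd_sets base y)
      then have "AE z in M. z \<notin> nbhd A y"
        unfolding PiM_empty AE_count_space by (simp add: clique_in_def)
      then show ?thesis
        using \<open>nbhd A y \<in> sets M\<close> emeasure_nbhd[OF base(1) y]
        by (simp add: AE_iff_measurable[OF \<open>nbhd A y \<in> sets M\<close>] nbhd_def)
    qed
    then show "indicator A y * deg A y = 0" by (auto simp: indicator_def)
  qed
  then have "edge_mass A = (\<integral>\<^sup>+ y. 0 \<partial>M)" unfolding edge_mass_def by (rule nn_integral_cong_AE)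
  then show ?case by simp
next
  case (Suc n)
  obtain i I' where I: "I = insert i I'" "i \<notin> I'" "card I' = Suc n" "finite I'"
    using Suc.prems(2,3) by (metis card_Suc_eq finite_insert)
  have "AE y in M. y \<in> A \<longrightarrow> (AE x in PiM I' (\<lambda>_. M). \<not> clique_in (nbhd A y) I' x)"
    by (rule AE_no_clique_nbhd) (use Suc.prems I in auto)
  then have \<beta>: "AE y in M. y \<in> A \<longrightarrow> edge_mass (nbhd A y) \<le> ennreal (1 - 1 / real n) * (deg A y)\<^sup>2"
  proof (rule AE_mp[OF _ AE_I2], intro impI)
    fix y assume y: "y \<in> space M" "y \<in> A"
      and "y \<in> A \<longrightarrow> (AE x in PiM I' (\<lambda>_. M). \<not> clique_in (nbhd A y) I' x)"
    then show "edge_mass (nbhd A y) \<le> ennreal (1 - 1 / real n) * (deg A y)\<^sup>2"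
      using Suc.IH[of "nbhd A y" I'] I Suc.prems(1) by (simp add: nbhd_sets emeasure_nbhd)
  qed
  obtain e d m where *: "0 \<le> e" "0 \<le> d" "0 \<le> m" "edge_mass A = ennreal e"
      "(\<integral>\<^sup>+ x. indicator A x * (deg A x)\<^sup>2 \<partial>M) = ennreal d" "defect A = ennreal m"
      "(1 + 1 / real n) * d + m \<le> measure M A * e" "e\<^sup>2 \<le> d * measure M A"
    by (rule edge_mass_estimates[OF Suc.prems(1) Suc.hyps \<beta>])
  let ?c = "1 + 1 / real n"
  have c: "?c > 0" by (simp add: add_pos_nonneg)
  have "e \<le> (1 - 1 / real (Suc n)) * (measure M A)\<^sup>2"
  proof (cases "e = 0")
    case False
    have "?c * e\<^sup>2 \<le> ?c * (d * measure M A)" using * c by (intro mult_left_mono) auto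
    also have "\<dots> = (?c * d) * measure M A" by simp
    also have "\<dots> \<le> (measure M A * e) * measure M A" using * by (intro mult_right_mono) auto
    finally have "e * (?c * e) \<le> e * (measure M A)\<^sup>2" by (simp add: power2_eq_square mult_ac)
    then have "?c * e \<le> (measure M A)\<^sup>2" using False * by (simp add: mult_le_cancel_left)
    moreover have "?c * (1 - 1 / real (Suc n)) = 1" using turan_ratio[OF Suc.hyps] by simp
    ultimately have "?c * e \<le> ?c * ((1 - 1 / real (Suc n)) * (measure M A)\<^sup>2)"
      by (simp flip: mult.assoc)
    then show ?thesis using c by (subst (asm) mult_le_cancel_left_pos)
  qed simp
  then have "ennreal e \<le> ennreal ((1 - 1 / real (Suc n)) * (measure M A)\<^sup>2)" by (rule ennreal_leI)
  then show ?case using * by (simp add: emeasure_eq_measure ennreal_mult ennreal_power)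
qed

text \<open>If e reaches the bound, every inequality in the proof of \<open>turan_density\<close> is
  an equality. The defect was slack there and must vanish, and d = e^2 says that the degree has
  variance zero.\<close>

theorem turan_extremal:
  assumes n: "n \<ge> 1" and I: "finite I" "card I = n + 2"
    and free: "AE x in PiM I (\<lambda>_. M). \<not> clique_in (space M) I x"
    and dense: "edge_mass (space M) \<ge> ennreal (1 - 1 / real (n + 1))"
  shows "edge_mass (space M) = ennreal (1 - 1 / real (n + 1))" "defect (space M) = 0"
    "AE x in M. deg (space M) x = ennreal (1 - 1 / real (n + 1))"
proof -
  obtain i I' where I': "I = insert i I'" "i \<notin> I'" "card I' = Suc n" "finite I'"
    using I by (metis add_2_eq_Suc' card_Suc_eq finite_insert)
  have "AE y in M. y \<in> space M \<longrightarrow> (AE x in PiM I' (\<lambda>_. M). \<not> clique_in (nbhd (space M) y) I' x)"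
    by (rule AE_no_clique_nbhd) (use free I' in auto)
  then have \<beta>: "AE y in M. y \<in> space M \<longrightarrow> edge_mass (nbhd (space M) y) \<le> ennreal (1 - 1 / real n) * (deg (space M) y)\<^sup>2"
  proof (rule AE_mp[OF _ AE_I2], intro impI)
    fix y assume y: "y \<in> space M"
      and "y \<in> space M \<longrightarrow> (AE x in PiM I' (\<lambda>_. M). \<not> clique_in (nbhd (space M) y) I' x)"
    then show "edge_mass (nbhd (space M) y) \<le> ennreal (1 - 1 / real n) * (deg (space M) y)\<^sup>2"
      using turan_density[OF n, of "nbhd (space M) y" I'] I' by (simp add: nbhd_sets emeasure_nbhd)
  qed
  obtain e d m where *: "0 \<le> e" "0 \<le> d" "0 \<le> m" "edge_mass (space M) = ennreal e"
      "(\<integral>\<^sup>+ x. indicator (space M) x * (deg (space M) x)\<^sup>2 \<partial>M) = ennreal d" "defect (space M) = ennreal m"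
      "(1 + 1 / real n) * d + m \<le> e" "e\<^sup>2 \<le> d"
    by (rule edge_mass_estimates[OF sets.top n \<beta>, unfolded prob_space mult_1 mult_1_right])
  let ?c = "1 + 1 / real n" and ?t = "1 - 1 / real (n + 1)"
  have ct: "?c * ?t = 1" by (rule turan_ratio[OF n])
  have c: "?c > 0" and t: "?t > 0" using n by (simp_all add: add_pos_nonneg)
  have et: "?t \<le> e" using dense * by simp
  have "?c * ?t \<le> ?c * e" using et c by (intro mult_left_mono) auto
  then have "e * 1 \<le> e * (?c * e)" using ct *(1) by (intro mult_left_mono) auto
  moreover have "?c * e\<^sup>2 \<le> ?c * d" using * c by (intro mult_left_mono) auto
  moreover have "e * (?c * e) = ?c * e\<^sup>2" by (simp add: power2_eq_square)
  ultimately have m0: "m = 0" and cd: "?c * d = e" and ce: "?c * e\<^sup>2 = e"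
    using *(3,7) by linarith+
  have "?c * e = 1" using ce et t by (simp add: power2_eq_square)
  then have "?c * e = ?c * ?t" using ct by simp
  then have e: "e = ?t" using c by simp
  have d: "d = e\<^sup>2" using cd ce c mult_left_cancel[of ?c d "e\<^sup>2"] by simp
  show "edge_mass (space M) = ennreal ?t" "defect (space M) = 0" using * e m0 by simp_all
  let ?dg = "deg (space M)"
  \<comment> \<open>The degree as a real number. Its variance is computed below with the cross term
    kept on both sides, which avoids subtraction of extended reals.\<close>
  define q where "q x = enn2real (?dg x)" for x
  have q: "?dg x = ennreal (q x)" "0 \<le> q x" for x
    using le_less_trans[OF deg_le_1[OF sets.top] ennreal_one_less_top] by (simp_all add: q_def ennreal_enn2real)
  have [measurable]: "q \<in> borel_measurable M" unfolding q_def by measurable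
  have "(\<integral>\<^sup>+ x. ennreal ((q x - e)\<^sup>2) \<partial>M) + ennreal (2 * e * e) =
      (\<integral>\<^sup>+ x. ennreal ((q x - e)\<^sup>2) \<partial>M) + (\<integral>\<^sup>+ x. ennreal (2 * e) * ?dg x \<partial>M)"
  proof -
    have "(\<integral>\<^sup>+ x. ennreal (2 * e) * ?dg x \<partial>M) = ennreal (2 * e) * edge_mass (space M)"
      unfolding edge_mass_def by (subst nn_integral_cmult) (auto intro!: arg_cong2[where f = "(*)"] nn_integral_cong)
    then show ?thesis using * by (simp add: ennreal_mult)
  qed
  also have "\<dots> = (\<integral>\<^sup>+ x. ennreal ((q x - e)\<^sup>2) + ennreal (2 * e) * ?dg x \<partial>M)"
    by (rule nn_integral_add[symmetric]) measurable
  also have "\<dots> = (\<integral>\<^sup>+ x. indicator (space M) x * (?dg x)\<^sup>2 + ennreal (e\<^sup>2) \<partial>M)"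
  proof (rule nn_integral_cong)
    fix x assume "x \<in> space M"
    have "(q x - e)\<^sup>2 + 2 * e * q x = (q x)\<^sup>2 + e\<^sup>2" by (simp add: power2_eq_square algebra_simps)
    then have "ennreal ((q x - e)\<^sup>2) + ennreal (2 * e) * ennreal (q x) = (ennreal (q x))\<^sup>2 + ennreal (e\<^sup>2)"
      using q(2)[of x] *(1) by (simp add: ennreal_power flip: ennreal_mult ennreal_plus)
    with \<open>x \<in> space M\<close> show "ennreal ((q x - e)\<^sup>2) + ennreal (2 * e) * ?dg x = indicator (space M) x * (?dg x)\<^sup>2 + ennreal (e\<^sup>2)"
      by (simp add: q(1))
  qed
  also have "\<dots> = ennreal d + ennreal (e\<^sup>2)"
    by (subst nn_integral_add) (auto simp: * emeasure_space_1)
  also have "\<dots> = ennreal (2 * e * e)" using d by (simp add: power2_eq_square flip: ennreal_plus)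
  finally have "ennreal (2 * e * e) + (\<integral>\<^sup>+ x. ennreal ((q x - e)\<^sup>2) \<partial>M) = ennreal (2 * e * e) + 0"
    by (simp add: add.commute)
  then have "(\<integral>\<^sup>+ x. ennreal ((q x - e)\<^sup>2) \<partial>M) = 0"
    by (simp only: ennreal_add_left_cancel) simp
  then have "AE x in M. ennreal ((q x - e)\<^sup>2) = 0"
    by (subst (asm) nn_integral_0_iff_AE) auto
  then show "AE x in M. ?dg x = ennreal ?t"
    by (rule eventually_mono) (auto simp: q(1) e)
qed

end

section \<open>Hereditary classes and homomorphism densities\<close>

lemma pair_graphI:
  assumes "finite (pverts G)" "\<And>u v. (u, v) \<in> parcs G \<Longrightarrow> u \<in> pverts G \<and> u \<noteq> v \<and> (v, u) \<in> parcs G"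
  shows "pair_graph G"
proof
  have "parcs G \<subseteq> pverts G \<times> pverts G" using assms(2) by auto
  then show "finite (parcs G)" by (rule finite_subset) (use assms(1) in simp)
  show "symmetric G" unfolding symmetric_def by (auto simp: sym_def dest: assms(2))
  show "finite (pverts G)" by fact
  fix e assume "e \<in> parcs G"
  then show "fst e \<in> pverts G" "snd e \<in> pverts G" "fst e \<noteq> snd e"
    using assms(2)[of "fst e" "snd e"] assms(2)[of "snd e" "fst e"] by auto
qed

lemma pair_graph_finite: "pair_graph G \<Longrightarrow> finite (pverts G)"
  by (simp add: pair_graph_def pair_digraph_def pair_fin_digraph_def pair_fin_digraph_axioms_def)

lemma pair_graph_parcsD:
  assumes "pair_graph G" "(u, v) \<in> parcs G"
  shows "u \<in> pverts G" "v \<in> pverts G" "u \<noteq> v" "(v, u) \<in> parcs G"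
proof -
  interpret pair_graph G by fact
  show "u \<in> pverts G" "v \<in> pverts G" using assms(2) in_arcsD1 in_arcsD2 by auto
  show "u \<noteq> v" using pair_no_loops[OF assms(2)] by simp
  show "(v, u) \<in> parcs G" using assms(2) pair_sym_arcs by (auto simp: symmetric_def dest: symD)
qed

lemma hereditaryD:
  assumes "hereditary P" "G \<in> P"
  shows "pair_graph G" "graph_isomorphic G H \<Longrightarrow> H \<in> P"
    "pair_graph H \<Longrightarrow> induced_subgraph (with_proj H) (with_proj G) \<Longrightarrow> H \<in> P"
  using assms unfolding hereditary_def by blast+

lemma graph_isomorphic_image:
  assumes "pair_graph G" "inj_on f (pverts G)"
    and "pverts H = f ` pverts G" "parcs H = map_prod f f ` parcs G"
  shows "graph_isomorphic G H"
proof -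
  interpret pair_graph G by fact
  let ?hom = "\<lparr>iso_verts = f, iso_arcs = map_prod f f, iso_head = snd, iso_tail = fst\<rparr>"
  have "pre_digraph.digraph_isomorphism (with_proj G) ?hom"
    unfolding pre_digraph.digraph_isomorphism_def
  proof (intro conjI)
    show "wf_digraph (with_proj G)" by unfold_locales
    have "inj_on (map_prod f f) (pverts G \<times> pverts G)"
      using assms(2) by (intro map_prod_inj_on)
    moreover have "parcs G \<subseteq> pverts G \<times> pverts G" using in_arcsD1 in_arcsD2 by auto
    ultimately have "inj_on (map_prod f f) (parcs G)" by (rule inj_on_subset)
    then show "inj_on (iso_arcs ?hom) (arcs (with_proj G))" by simp
  qed (use assms in auto)
  moreover have "with_proj H = app_iso ?hom (with_proj G)"
    using assms by (simp add: app_iso_def with_proj_def)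
  ultimately show ?thesis unfolding graph_isomorphic_def digraph_iso_def by blast
qed

text \<open>The image of K is an induced subgraph of G, and the inverse of \<phi> carries it back to
  K. The vertices of K may be of any type, as needed for the excluded graphs, whose vertices are
  sets.\<close>

lemma hereditary_embed:
  assumes P: "hereditary P" "G \<in> P" and K: "pair_graph K"
    and \<phi>: "inj_on \<phi> (pverts K)" "\<phi> ` pverts K \<subseteq> pverts G"
    and arcs: "\<And>u v. u \<in> pverts K \<Longrightarrow> v \<in> pverts K \<Longrightarrow> (u, v) \<in> parcs K \<longleftrightarrow> (\<phi> u, \<phi> v) \<in> parcs G"
  shows "belongs_to K P"
proof -
  have G: "pair_graph G" by (rule hereditaryD[OF P])
  define H where "H = \<lparr>pverts = \<phi> ` pverts K, parcs = map_prod \<phi> \<phi> ` parcs K\<rparr>"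
  note K_arcs = pair_graph_parcsD[OF K]
  have H: "pair_graph H"
  proof (rule pair_graphI)
    show "finite (pverts H)" using pair_graph_finite[OF K] by (simp add: H_def)
    fix u v assume "(u, v) \<in> parcs H"
    then obtain a b where ab: "(a, b) \<in> parcs K" "u = \<phi> a" "v = \<phi> b" by (auto simp: H_def)
    have "\<phi> a \<noteq> \<phi> b" using \<phi>(1) K_arcs(1-3)[OF ab(1)] by (auto dest: inj_onD)
    then show "u \<in> pverts H \<and> u \<noteq> v \<and> (v, u) \<in> parcs H"
      using ab K_arcs(1,4)[OF ab(1)] by (force simp: H_def)
  qed
  have parcs_H: "parcs H = {e \<in> parcs G. fst e \<in> pverts H \<and> snd e \<in> pverts H}" (is "_ = ?S")
  proof (intro set_eqI iffI)
    fix e assume "e \<in> parcs H"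
    then obtain a b where "(a, b) \<in> parcs K" "e = (\<phi> a, \<phi> b)" by (auto simp: H_def)
    then show "e \<in> ?S" using arcs K_arcs(1-3)[of a b] by (auto simp: H_def)
  next
    fix e assume "e \<in> ?S"
    then obtain a b where "a \<in> pverts K" "b \<in> pverts K" "e = (\<phi> a, \<phi> b)" "e \<in> parcs G"
      by (cases e) (auto simp: H_def)
    moreover from this arcs have "(a, b) \<in> parcs K" by simp
    ultimately show "e \<in> parcs H" by (force simp: H_def)
  qed
  have "induced_subgraph (with_proj H) (with_proj G)"
  proof (rule induced_subgraphI)
    have "wf_digraph (with_proj H)" "wf_digraph (with_proj G)"
      by (unfold_locales; use pair_graph_parcsD(1,2)[OF H] pair_graph_parcsD(1,2)[OF G] in force)+
    then show "subgraph (with_proj H) (with_proj G)"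
      using \<phi>(2) parcs_H by (auto simp: subgraph_def compatible_def H_def)
  qed (simp add: parcs_H)
  then have "H \<in> P" by (rule hereditaryD(3)[OF P H])
  define \<psi> where "\<psi> = inv_into (pverts K) \<phi>"
  have \<psi>: "\<psi> (\<phi> u) = u" if "u \<in> pverts K" for u using that \<phi>(1) by (simp add: \<psi>_def)
  have "graph_isomorphic H K"
  proof (rule graph_isomorphic_image[OF H])
    show "inj_on \<psi> (pverts H)" using \<psi> by (auto simp: inj_on_def H_def)
    show "pverts K = \<psi> ` pverts H" using \<psi> by (force simp: H_def)
    have "map_prod \<psi> \<psi> (map_prod \<phi> \<phi> e) = e" if "e \<in> parcs K" for e
      using that \<psi> K_arcs(1,2)[of "fst e" "snd e"] by (cases e) auto
    then show "parcs K = map_prod \<psi> \<psi> ` parcs H" by (force simp: H_def image_image)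
  qed
  with \<open>H \<in> P\<close> show ?thesis by (auto simp: belongs_to_def)
qed

lemma belongs_to_iff: "hereditary P \<Longrightarrow> belongs_to K P \<longleftrightarrow> K \<in> P" for K :: ngraph
proof
  assume P: "hereditary P" and "belongs_to K P"
  then show "K \<in> P" unfolding belongs_to_def using hereditaryD(2)[OF P] by blast
next
  assume P: "hereditary P" and K: "K \<in> P"
  show "belongs_to K P"
    by (rule hereditary_embed[OF P K, of _ "\<lambda>x. x"]) (auto intro: hereditaryD(1)[OF P K])
qed

text \<open>Inclusion-exclusion over the non-edges: an induced density becomes an alternating sum of
  homomorphism densities, the quantities that convergence controls.\<close>

lemma prod_mult_prod_one_minus:
  fixes a :: "'e \<Rightarrow> real"
  assumes "finite D" "E \<subseteq> D"
  shows "(\<Prod>e\<in>E. a e) * (\<Prod>e\<in>D - E. 1 - a e) = (\<Sum>S\<in>Pow (D - E). (-1) ^ card S * (\<Prod>e\<in>E \<union> S. a e))"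
proof -
  have fE: "finite E" "finite (D - E)" using assms finite_subset by auto
  have "(\<Prod>e\<in>D - E. 1 - a e) = (\<Prod>e\<in>D - E. - a e + 1)" by (simp add: algebra_simps)
  also have "\<dots> = (\<Sum>S\<in>Pow (D - E). (\<Prod>e\<in>S. - a e))"
    by (subst prod_add[OF fE(2)]) simp
  also have "\<dots> = (\<Sum>S\<in>Pow (D - E). (-1) ^ card S * (\<Prod>e\<in>S. a e))"
    by (intro sum.cong refl) (simp add: prod_uminus)
  finally have "(\<Prod>e\<in>E. a e) * (\<Prod>e\<in>D - E. 1 - a e) =
      (\<Sum>S\<in>Pow (D - E). (\<Prod>e\<in>E. a e) * ((-1) ^ card S * (\<Prod>e\<in>S. a e)))"
    by (simp add: sum_distrib_left)
  also have "\<dots> = (\<Sum>S\<in>Pow (D - E). (-1) ^ card S * (\<Prod>e\<in>E \<union> S. a e))"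
  proof (intro sum.cong refl)
    fix S assume "S \<in> Pow (D - E)"
    then have "finite S" "E \<inter> S = {}" using fE finite_subset by auto
    then show "(\<Prod>e\<in>E. a e) * ((-1) ^ card S * (\<Prod>e\<in>S. a e)) = (-1) ^ card S * (\<Prod>e\<in>E \<union> S. a e)"
      by (simp add: prod.union_disjoint fE(1))
  qed
  finally show ?thesis .
qed

section \<open>Graphs as sets of increasing pairs, and the count of homomorphisms\<close>

definition edges :: "ngraph \<Rightarrow> (nat \<times> nat) set" where
  "edges F = {(u, v). (u, v) \<in> parcs F \<and> u < v}"

definition vertex_pairs :: "nat set \<Rightarrow> (nat \<times> nat) set" where
  "vertex_pairs V = {(u, v). u \<in> V \<and> v \<in> V \<and> u < v}"

definition graph_of :: "nat set \<Rightarrow> (nat \<times> nat) set \<Rightarrow> ngraph" where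
  "graph_of V E = \<lparr>pverts = V, parcs = E \<union> E\<inverse>\<rparr>"

lemma finite_vertex_pairs: "finite V \<Longrightarrow> finite (vertex_pairs V)"
  by (rule finite_subset[of _ "V \<times> V"]) (auto simp: vertex_pairs_def)

lemma pair_graph_graph_of: "finite V \<Longrightarrow> E \<subseteq> vertex_pairs V \<Longrightarrow> pair_graph (graph_of V E)"
  by (rule pair_graphI) (auto simp: graph_of_def vertex_pairs_def)

lemma pverts_graph_of [simp]: "pverts (graph_of V E) = V"
  by (simp add: graph_of_def)

lemma edges_graph_of: "E \<subseteq> vertex_pairs V \<Longrightarrow> edges (graph_of V E) = E"
  by (auto simp: graph_of_def vertex_pairs_def edges_def)

lemma edges_subset: "pair_graph F \<Longrightarrow> edges F \<subseteq> vertex_pairs (pverts F)"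
  by (auto simp: edges_def vertex_pairs_def dest: pair_graph_parcsD(1,2))

lemma finite_edges: "pair_graph F \<Longrightarrow> finite (edges F)"
  by (rule finite_subset[OF edges_subset finite_vertex_pairs[OF pair_graph_finite]])

lemma parcs_iff_edges:
  "pair_graph F \<Longrightarrow> (u, v) \<in> parcs F \<longleftrightarrow> (u, v) \<in> edges F \<or> (v, u) \<in> edges F"
  unfolding edges_def mem_Collect_eq prod.case
  using pair_graph_parcsD(3,4)[of F u v] pair_graph_parcsD(4)[of F v u] linorder_neqE_nat[of u v]
  by blast

lemma card_graph_homs:
  assumes F: "pair_graph F" and G: "pair_graph G"
  shows "real (card (graph_homs F G)) =
    (\<Sum>\<phi>\<in>pverts F \<rightarrow>\<^sub>E pverts G. \<Prod>(u, v)\<in>edges F. of_bool ((\<phi> u, \<phi> v) \<in> parcs G))"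
proof -
  have fin: "finite (pverts F \<rightarrow>\<^sub>E pverts G)"
    using pair_graph_finite[OF F] pair_graph_finite[OF G] by (intro finite_PiE) auto
  have hom: "graph_homs F G =
      {\<phi> \<in> pverts F \<rightarrow>\<^sub>E pverts G. \<forall>(u, v)\<in>edges F. (\<phi> u, \<phi> v) \<in> parcs G}"
  proof -
    have "(\<forall>(u, v)\<in>parcs F. (\<phi> u, \<phi> v) \<in> parcs G) \<longleftrightarrow> (\<forall>(u, v)\<in>edges F. (\<phi> u, \<phi> v) \<in> parcs G)" for \<phi>
    proof safe
      fix u v assume *: "\<forall>(u, v)\<in>edges F. (\<phi> u, \<phi> v) \<in> parcs G" "(u, v) \<in> parcs F"
      from *(2) have "(u, v) \<in> edges F \<or> (v, u) \<in> edges F" by (simp add: parcs_iff_edges[OF F])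
      with *(1) have "(\<phi> u, \<phi> v) \<in> parcs G \<or> (\<phi> v, \<phi> u) \<in> parcs G" by blast
      then show "(\<phi> u, \<phi> v) \<in> parcs G" using pair_graph_parcsD(4)[OF G] by blast
    next
      fix u v assume "\<forall>(u, v)\<in>parcs F. (\<phi> u, \<phi> v) \<in> parcs G" "(u, v) \<in> edges F"
      then show "(\<phi> u, \<phi> v) \<in> parcs G" by (auto simp: edges_def)
    qed
    then show ?thesis unfolding graph_homs_def by blast
  qed
  have "(\<Prod>(u, v)\<in>edges F. of_bool ((\<phi> u, \<phi> v) \<in> parcs G)) =
      (of_bool (\<forall>(u, v)\<in>edges F. (\<phi> u, \<phi> v) \<in> parcs G) :: real)" for \<phi>
    using finite_edges[OF F] by (auto simp: split_beta prod_zero_iff intro!: prod.neutral)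
  then show ?thesis
    using fin by (simp add: hom sum_of_bool_eq Int_def)
qed

text \<open>Such a map is determined by its values off v, because its value at v repeats the one at
  u.\<close>

lemma card_noninjective:
  assumes V: "finite V" "u \<in> V" "v \<in> V" "u \<noteq> v" and X: "finite X"
  shows "card {\<phi> \<in> V \<rightarrow>\<^sub>E X. \<phi> u = \<phi> v} \<le> card X ^ (card V - 1)"
proof -
  have "card {\<phi> \<in> V \<rightarrow>\<^sub>E X. \<phi> u = \<phi> v} \<le> card (V - {v} \<rightarrow>\<^sub>E X)"
  proof (rule card_inj_on_le[where f = "\<lambda>\<phi>. restrict \<phi> (V - {v})"])
    show "inj_on (\<lambda>\<phi>. restrict \<phi> (V - {v})) {\<phi> \<in> V \<rightarrow>\<^sub>E X. \<phi> u = \<phi> v}"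
    proof (rule inj_onI)
      fix \<phi> \<psi> assume *: "\<phi> \<in> {\<phi> \<in> V \<rightarrow>\<^sub>E X. \<phi> u = \<phi> v}" "\<psi> \<in> {\<phi> \<in> V \<rightarrow>\<^sub>E X. \<phi> u = \<phi> v}"
        "restrict \<phi> (V - {v}) = restrict \<psi> (V - {v})"
      have eq: "\<phi> z = \<psi> z" if "z \<in> V - {v}" for z
        using fun_cong[OF *(3), of z] that by auto
      from * eq[of u] V have "\<phi> v = \<psi> v" by auto
      with eq * show "\<phi> = \<psi>" by (intro PiE_ext[of _ V "\<lambda>_. X"]) auto
    qed
    show "finite (V - {v} \<rightarrow>\<^sub>E X)" using V X by (intro finite_PiE) auto
    show "(\<lambda>\<phi>. restrict \<phi> (V - {v})) ` {\<phi> \<in> V \<rightarrow>\<^sub>E X. \<phi> u = \<phi> v} \<subseteq> V - {v} \<rightarrow>\<^sub>E X"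
      by (intro image_subsetI restrict_PiE_iff[THEN iffD2]) auto
  qed
  also have "\<dots> = card X ^ (card V - 1)" using V by (simp add: card_PiE)
  finally show ?thesis .
qed

section \<open>Generic points of a limit of a hereditary class\<close>

lemma prob_space_unit_measure: "prob_space unit_measure"
  unfolding unit_measure_def by (rule prob_spaceI) (simp add: emeasure_restrict_space)

lemma space_unit_measure [simp]: "space unit_measure = {0..1}"
  by (simp add: unit_measure_def space_restrict_space)

interpretation unit: prob_space unit_measure by (rule prob_space_unit_measure)

interpretation unit_prod: product_sigma_finite "\<lambda>_. unit_measure" ..

lemma finite_measure_PiM_unit: "finite V \<Longrightarrow> finite_measure (PiM V (\<lambda>_. unit_measure))"
proof
  assume V: "finite V"
  have "space (PiM V (\<lambda>_. unit_measure)) = Pi\<^sub>E V (\<lambda>_. {0..1})" by (simp add: space_PiM)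
  then have "emeasure (PiM V (\<lambda>_. unit_measure)) (space (PiM V (\<lambda>_. unit_measure))) = (\<Prod>i\<in>V. emeasure unit_measure {0..1})"
    using V by (simp add: unit_prod.emeasure_PiM flip: space_unit_measure)
  also have "\<dots> = 1" using unit.emeasure_space_1 by simp
  finally show "emeasure (PiM V (\<lambda>_. unit_measure)) (space (PiM V (\<lambda>_. unit_measure))) \<noteq> \<infinity>" by simp
qed

lemma measurable_graphon_component:
  assumes W: "graphon W" and "u \<in> V" "v \<in> V"
  shows "(\<lambda>x. W (x u) (x v)) \<in> borel_measurable (PiM V (\<lambda>_. unit_measure))"
proof -
  have "(\<lambda>x. (x u, x v)) \<in> measurable (PiM V (\<lambda>_. unit_measure)) (unit_measure \<Otimes>\<^sub>M unit_measure)"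
    using assms by measurable
  from measurable_compose[OF this, of "\<lambda>(x, y). W x y"] W show ?thesis by (simp add: graphon_def)
qed

lemma graphon_bounds:
  assumes "graphon W" "x \<in> space (PiM V (\<lambda>_. unit_measure))" "u \<in> V" "v \<in> V"
  shows "0 \<le> W (x u) (x v)" "W (x u) (x v) \<le> 1"
proof -
  have "x u \<in> {0..1}" "x v \<in> {0..1}" using assms(2-4) by (auto simp: space_PiM)
  then show "0 \<le> W (x u) (x v)" "W (x u) (x v) \<le> 1" using assms(1) by (auto simp: graphon_def)
qed

lemma integrable_graphon_prod:
  assumes W: "graphon W" and V: "finite V" "E \<subseteq> vertex_pairs V"
  shows "integrable (PiM V (\<lambda>_. unit_measure)) (\<lambda>x. \<Prod>(u, v)\<in>E. W (x u) (x v))"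
proof -
  interpret finite_measure "PiM V (\<lambda>_. unit_measure)" using V by (intro finite_measure_PiM_unit)
  show ?thesis
  proof (rule integrable_const_bound[of _ 1])
    show "AE x in PiM V (\<lambda>_. unit_measure). norm (\<Prod>(u, v)\<in>E. W (x u) (x v)) \<le> 1"
    proof (rule AE_I2)
      fix x assume x: "x \<in> space (PiM V (\<lambda>_. unit_measure))"
      have "(\<Prod>(u, v)\<in>E. W (x u) (x v)) \<in> {0..1}"
        using V(2) graphon_bounds[OF W x] by (auto simp: vertex_pairs_def subset_iff intro!: prod_nonneg prod_le_1)
      then show "norm (\<Prod>(u, v)\<in>E. W (x u) (x v)) \<le> 1" by simp
    qed
    show "(\<lambda>x. \<Prod>(u, v)\<in>E. W (x u) (x v)) \<in> borel_measurable (PiM V (\<lambda>_. unit_measure))"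
      using V(2) by (auto simp: split_beta vertex_pairs_def intro!: borel_measurable_prod measurable_graphon_component[OF W])
  qed
qed

text \<open>The product of W over the edges and of 1 - W over the non-edges is positive: K has a
  chance to arise as the random graph drawn from W at the points \<phi>.\<close>

definition compat :: "('b \<Rightarrow> 'b \<Rightarrow> real) \<Rightarrow> 'a pair_pre_digraph \<Rightarrow> ('a \<Rightarrow> 'b) \<Rightarrow> bool" where
  "compat W K \<phi> \<longleftrightarrow> (\<forall>u\<in>pverts K. \<forall>v\<in>pverts K. u \<noteq> v \<longrightarrow>
     (if (u, v) \<in> parcs K then 0 < W (\<phi> u) (\<phi> v) else W (\<phi> u) (\<phi> v) < 1))"

text \<open>The right side is the proportion of maps that respect edges and non-edges alike. The
  left side passes to the limit term by term.\<close>

lemma sum_hom_density_eq: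
  assumes F: "pair_graph F" and G: "pair_graph G"
  shows "(\<Sum>S\<in>Pow (vertex_pairs (pverts F) - edges F).
            (-1) ^ card S * graph_hom_density (graph_of (pverts F) (edges F \<union> S)) G) =
    (\<Sum>\<phi>\<in>pverts F \<rightarrow>\<^sub>E pverts G. (\<Prod>(u, v)\<in>edges F. of_bool ((\<phi> u, \<phi> v) \<in> parcs G)) *
        (\<Prod>(u, v)\<in>vertex_pairs (pverts F) - edges F. 1 - of_bool ((\<phi> u, \<phi> v) \<in> parcs G)))
      / real (card (pverts G)) ^ card (pverts F)" (is "?l = ?r")
proof -
  let ?V = "pverts F" and ?E = "edges F" and ?D = "vertex_pairs (pverts F)" and ?N = "real (card (pverts G)) ^ card (pverts F)"
  let ?a = "\<lambda>\<phi> (u, v). of_bool ((\<phi> u, \<phi> v) \<in> parcs G) :: real"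
  have D: "finite ?D" "?E \<subseteq> ?D" using F by (simp_all add: finite_vertex_pairs pair_graph_finite edges_subset)
  have "?l = (\<Sum>S\<in>Pow (?D - ?E). (-1) ^ card S * ((\<Sum>\<phi>\<in>?V \<rightarrow>\<^sub>E pverts G. \<Prod>e\<in>?E \<union> S. ?a \<phi> e) / ?N))"
  proof (intro sum.cong refl)
    fix S assume "S \<in> Pow (?D - ?E)"
    then have S: "?E \<union> S \<subseteq> ?D" using D by auto
    have "pair_graph (graph_of ?V (?E \<union> S))"
      using S F by (intro pair_graph_graph_of pair_graph_finite)
    then show "(-1) ^ card S * graph_hom_density (graph_of ?V (?E \<union> S)) G =
        (-1) ^ card S * ((\<Sum>\<phi>\<in>?V \<rightarrow>\<^sub>E pverts G. \<Prod>e\<in>?E \<union> S. ?a \<phi> e) / ?N)"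
      unfolding graph_hom_density_def by (subst card_graph_homs[OF _ G]) (simp_all add: edges_graph_of[OF S] split_beta')
  qed
  also have "\<dots> = (\<Sum>S\<in>Pow (?D - ?E). \<Sum>\<phi>\<in>?V \<rightarrow>\<^sub>E pverts G. (-1) ^ card S * (\<Prod>e\<in>?E \<union> S. ?a \<phi> e)) / ?N"
    by (simp add: sum_divide_distrib sum_distrib_left)
  also have "\<dots> = (\<Sum>\<phi>\<in>?V \<rightarrow>\<^sub>E pverts G. \<Sum>S\<in>Pow (?D - ?E). (-1) ^ card S * (\<Prod>e\<in>?E \<union> S. ?a \<phi> e)) / ?N"
    by (subst sum.swap) simp
  also have "\<dots> = (\<Sum>\<phi>\<in>?V \<rightarrow>\<^sub>E pverts G. (\<Prod>e\<in>?E. ?a \<phi> e) * (\<Prod>e\<in>?D - ?E. 1 - ?a \<phi> e)) / ?N"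
    by (subst prod_mult_prod_one_minus[OF D]) simp
  also have "\<dots> = ?r" by (simp add: split_beta')
  finally show ?thesis .
qed

text \<open>An injective map that counts on the left would place F as an induced subgraph into a
  member of P. So only maps that identify two vertices count. Since G has no loops they may still
  respect all non-edges, but a given pair is identified by at most a fraction 1 / card (pverts G) of
  all maps.\<close>

lemma sum_hom_density_le:
  assumes P: "hereditary P" "G \<in> P" and F: "pair_graph F" "F \<notin> P" and N: "card (pverts G) > 0"
  shows "(\<Sum>S\<in>Pow (vertex_pairs (pverts F) - edges F).
            (-1) ^ card S * graph_hom_density (graph_of (pverts F) (edges F \<union> S)) G)
      \<le> real (card (vertex_pairs (pverts F))) / real (card (pverts G))"
proof -
  let ?V = "pverts F" and ?E = "edges F" and ?D = "vertex_pairs (pverts F)"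
  let ?X = "pverts G" and ?N = "real (card (pverts G))" and ?k = "card (pverts F)"
  let ?p = "\<lambda>\<phi>. (\<Prod>(u, v)\<in>?E. of_bool ((\<phi> u, \<phi> v) \<in> parcs G)) *
        (\<Prod>(u, v)\<in>?D - ?E. 1 - of_bool ((\<phi> u, \<phi> v) \<in> parcs G)) :: real"
  have G: "pair_graph G" by (rule hereditaryD[OF P])
  have V: "finite ?V" and X: "finite ?X" using F G by (simp_all add: pair_graph_finite)
  have D: "finite ?D" "?E \<subseteq> ?D" "finite ?E" using F V finite_edges by (simp_all add: finite_vertex_pairs edges_subset)
  have "?p \<phi> \<le> (\<Sum>(u, v)\<in>?D. of_bool (\<phi> u = \<phi> v))" if \<phi>: "\<phi> \<in> ?V \<rightarrow>\<^sub>E ?X" for \<phi>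
  proof (cases "inj_on \<phi> ?V")
    case False
    then obtain u v where "u \<in> ?V" "v \<in> ?V" "u < v" "\<phi> u = \<phi> v"
      unfolding inj_on_def by (metis linorder_neqE_nat)
    then have "(u, v) \<in> ?D" "of_bool (\<phi> u = \<phi> v) = (1::real)" by (auto simp: vertex_pairs_def)
    then have "1 \<le> (\<Sum>(u, v)\<in>?D. of_bool (\<phi> u = \<phi> v) :: real)"
      using member_le_sum[of "(u, v)" ?D "\<lambda>(u, v). of_bool (\<phi> u = \<phi> v) :: real"] D by auto
    moreover have "?p \<phi> \<le> 1"
      by (intro mult_le_one prod_le_1 prod_nonneg) auto
    ultimately show ?thesis by linarith
  next
    case True
    have "?p \<phi> = 0"
    proof (rule ccontr)
      assume "?p \<phi> \<noteq> 0"
      then have nz: "\<forall>e\<in>?E. (case e of (u, v) \<Rightarrow> of_bool ((\<phi> u, \<phi> v) \<in> parcs G)) \<noteq> (0 :: real)"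
        "\<forall>e\<in>?D - ?E. (case e of (u, v) \<Rightarrow> 1 - of_bool ((\<phi> u, \<phi> v) \<in> parcs G)) \<noteq> (0 :: real)"
        using D by (simp_all only: mult_eq_0_iff de_Morgan_disj prod_zero_iff finite_Diff) blast+
      have E1: "(\<phi> u, \<phi> v) \<in> parcs G" if "(u, v) \<in> ?E" for u v
        using bspec[OF nz(1) that] by simp
      have E0: "(\<phi> u, \<phi> v) \<notin> parcs G" if "(u, v) \<in> ?D" "(u, v) \<notin> ?E" for u v
        using bspec[OF nz(2), of "(u, v)"] that by auto
      have lt: "(u, v) \<in> parcs F \<longleftrightarrow> (\<phi> u, \<phi> v) \<in> parcs G" if "u \<in> ?V" "v \<in> ?V" "u < v" for u v
        using that E1[of u v] E0[of u v] by (auto simp: edges_def vertex_pairs_def)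
      have symF: "(u, v) \<in> parcs F \<longleftrightarrow> (v, u) \<in> parcs F" and symG: "(a, b) \<in> parcs G \<longleftrightarrow> (b, a) \<in> parcs G" for u v a b
        using pair_graph_parcsD(4)[OF F(1)] pair_graph_parcsD(4)[OF G] by blast+
      have "belongs_to F P"
      proof (rule hereditary_embed[OF P F(1) True])
        fix u v assume uv: "u \<in> ?V" "v \<in> ?V"
        consider "u < v" | "v < u" | "u = v" by linarith
        then show "(u, v) \<in> parcs F \<longleftrightarrow> (\<phi> u, \<phi> v) \<in> parcs G"
        proof cases
          case 2
          then show ?thesis using lt[OF uv(2,1)] symF[of u v] symG[of "\<phi> u" "\<phi> v"] by blast
        next
          case 3
          then show ?thesis using pair_graph_parcsD(3)[OF F(1)] pair_graph_parcsD(3)[OF G] by blast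
        qed (use lt uv in blast)
      qed (use \<phi> in auto)
      then show False using F(2) belongs_to_iff[OF P(1)] by blast
    qed
    then show ?thesis by (auto intro!: sum_nonneg)
  qed
  then have "(\<Sum>\<phi>\<in>?V \<rightarrow>\<^sub>E ?X. ?p \<phi>) \<le> (\<Sum>\<phi>\<in>?V \<rightarrow>\<^sub>E ?X. \<Sum>(u, v)\<in>?D. of_bool (\<phi> u = \<phi> v))"
    by (rule sum_mono)
  also have "\<dots> = (\<Sum>(u, v)\<in>?D. \<Sum>\<phi>\<in>?V \<rightarrow>\<^sub>E ?X. of_bool (\<phi> u = \<phi> v))"
    by (subst sum.swap) (simp add: split_beta')
  also have "\<dots> = (\<Sum>(u, v)\<in>?D. real (card {\<phi> \<in> ?V \<rightarrow>\<^sub>E ?X. \<phi> u = \<phi> v}))"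
    using V X by (intro sum.cong refl) (auto simp: sum_of_bool_eq Int_def finite_PiE)
  also have "\<dots> \<le> (\<Sum>(u, v)\<in>?D. ?N ^ (?k - 1))"
  proof (intro sum_mono, clarify)
    fix u v assume "(u, v) \<in> ?D"
    then have "u \<in> ?V" "v \<in> ?V" "u \<noteq> v" by (auto simp: vertex_pairs_def)
    from card_noninjective[OF V this X]
    show "real (card {\<phi> \<in> ?V \<rightarrow>\<^sub>E ?X. \<phi> u = \<phi> v}) \<le> ?N ^ (?k - 1)"
      by (simp only: of_nat_power[symmetric] of_nat_le_iff)
  qed
  also have "\<dots> = card ?D * ?N ^ (?k - 1)" by (simp add: split_beta')
  finally have "(\<Sum>\<phi>\<in>?V \<rightarrow>\<^sub>E ?X. ?p \<phi>) / ?N ^ ?k \<le> card ?D * ?N ^ (?k - 1) / ?N ^ ?k"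
    by (rule divide_right_mono) simp
  also have "\<dots> = card ?D / ?N"
  proof (cases "?k = 0")
    case True
    then have "?D = {}" using V by (auto simp: vertex_pairs_def)
    then show ?thesis by simp
  next
    case False
    then have "?N ^ ?k = ?N * ?N ^ (?k - 1)" by (cases ?k) auto
    then show ?thesis using N by (auto simp: divide_simps)
  qed
  finally show ?thesis by (subst sum_hom_density_eq[OF F(1) G]) simp
qed

text \<open>The probability that W produces F, averaged over the sample, is the limit of induced
  densities bounded by a constant over the number of vertices, hence at most 0. Being nonnegative it
  vanishes almost everywhere, whereas at compatible points it is positive.\<close>

lemma AE_not_compat:
  assumes P: "hereditary P" and G: "\<And>n. G n \<in> P" "graphs_converge G \<Gamma>" and W: "represents W \<Gamma>"
    and F: "pair_graph F" "F \<notin> P"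
  shows "AE x in PiM (pverts F) (\<lambda>_. unit_measure). \<not> compat W F x"
proof -
  let ?V = "pverts F" and ?E = "edges F" and ?D = "vertex_pairs (pverts F)"
  let ?M = "PiM ?V (\<lambda>_. unit_measure)"
  let ?FS = "\<lambda>S. graph_of ?V (?E \<union> S)"
  let ?ind = "\<lambda>x. (\<Prod>(u, v)\<in>?E. W (x u) (x v)) * (\<Prod>(u, v)\<in>?D - ?E. 1 - W (x u) (x v))"
  have W': "graphon W" and tW: "\<And>F. pair_graph F \<Longrightarrow> graphon_hom_density F W = \<Gamma> F"
    using W by (auto simp: represents_def)
  have V: "finite ?V" using F by (simp add: pair_graph_finite)
  have D: "finite ?D" "?E \<subseteq> ?D" "finite ?E" using F V finite_edges by (simp_all add: finite_vertex_pairs edges_subset)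
  have FS: "pair_graph (?FS S)" if "S \<in> Pow (?D - ?E)" for S
    using that D by (intro pair_graph_graph_of V) auto
  have ind: "?ind x = (\<Sum>S\<in>Pow (?D - ?E). (-1) ^ card S * (\<Prod>(u, v)\<in>?E \<union> S. W (x u) (x v)))" for x
    using prod_mult_prod_one_minus[OF D(1,2), of "\<lambda>(u, v). W (x u) (x v)"] by (simp add: split_beta')
  have int: "integrable ?M (\<lambda>x. (-1) ^ card S * (\<Prod>(u, v)\<in>?E \<union> S. W (x u) (x v)))" if "S \<in> Pow (?D - ?E)" for S
    using that D by (intro integrable_mult_right integrable_graphon_prod[OF W' V]) auto
  have int_ind: "integrable ?M ?ind"
    unfolding ind using int by (rule Bochner_Integration.integrable_sum)
  have "(LINT x|?M. ?ind x) = (\<Sum>S\<in>Pow (?D - ?E). (-1) ^ card S * (LINT x|?M. (\<Prod>(u, v)\<in>?E \<union> S. W (x u) (x v))))"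
    unfolding ind by (subst Bochner_Integration.integral_sum[OF int]) auto
  also have "\<dots> = (\<Sum>S\<in>Pow (?D - ?E). (-1) ^ card S * \<Gamma> (?FS S))"
  proof (intro sum.cong refl)
    fix S assume S: "S \<in> Pow (?D - ?E)"
    then have "edges (?FS S) = ?E \<union> S" using D by (intro edges_graph_of) auto
    then have "graphon_hom_density (?FS S) W = (LINT x|?M. (\<Prod>(u, v)\<in>?E \<union> S. W (x u) (x v)))"
      unfolding graphon_hom_density_def edges_def[symmetric] by (simp add: graph_of_def)
    then show "(-1) ^ card S * (LINT x|?M. (\<Prod>(u, v)\<in>?E \<union> S. W (x u) (x v))) = (-1) ^ card S * \<Gamma> (?FS S)"
      using tW[OF FS[OF S]] by simp
  qed
  finally have eq: "(LINT x|?M. ?ind x) = (\<Sum>S\<in>Pow (?D - ?E). (-1) ^ card S * \<Gamma> (?FS S))" .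
  have N: "filterlim (\<lambda>n. card (pverts (G n))) at_top sequentially"
    and conv: "\<And>F. pair_graph F \<Longrightarrow> (\<lambda>n. graph_hom_density F (G n)) \<longlonglongrightarrow> \<Gamma> F"
    using G(2) by (auto simp: graphs_converge_def)
  have "(\<lambda>n. \<Sum>S\<in>Pow (?D - ?E). (-1) ^ card S * graph_hom_density (?FS S) (G n))
      \<longlonglongrightarrow> (LINT x|?M. ?ind x)"
    unfolding eq by (intro tendsto_intros conv FS)
  moreover have "filterlim (\<lambda>n. real (card (pverts (G n)))) at_top sequentially"
    using N by (rule filterlim_compose[OF filterlim_real_sequentially])
  then have "(\<lambda>n. real (card ?D) / real (card (pverts (G n)))) \<longlonglongrightarrow> 0"
    by (intro tendsto_divide_0[OF tendsto_const] filterlim_at_top_imp_at_infinity)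
  moreover have "\<forall>\<^sub>F n in sequentially. 0 < card (pverts (G n))"
    using N unfolding filterlim_at_top by (auto elim!: eventually_mono dest!: spec[of _ 1])
  then have "\<forall>\<^sub>F n in sequentially. (\<Sum>S\<in>Pow (?D - ?E). (-1) ^ card S * graph_hom_density (?FS S) (G n))
      \<le> real (card ?D) / real (card (pverts (G n)))"
    by eventually_elim (rule sum_hom_density_le[OF P G(1) F])
  ultimately have "(LINT x|?M. ?ind x) \<le> 0"
    by (intro tendsto_le[OF sequentially_bot])
  moreover have nonneg: "0 \<le> ?ind x" if x: "x \<in> space ?M" for x
    using graphon_bounds[OF W' x] D by (auto simp: vertex_pairs_def subset_iff intro!: mult_nonneg_nonneg prod_nonneg)
  moreover have AE_nonneg: "AE x in ?M. 0 \<le> ?ind x" by (rule AE_I2) (rule nonneg)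
  moreover have "0 \<le> (LINT x|?M. ?ind x)" using AE_nonneg by (rule integral_nonneg_AE)
  ultimately have "(LINT x|?M. ?ind x) = 0" by linarith
  then have "AE x in ?M. ?ind x = 0"
    using integral_nonneg_eq_0_iff_AE[OF int_ind AE_nonneg] by simp
  then show ?thesis
  proof (rule AE_mp[OF _ AE_I2], intro impI notI)
    fix x assume 0: "?ind x = 0" and c: "compat W F x"
    have "0 < W (x u) (x v)" if "(u, v) \<in> ?E" for u v
      using c that pair_graph_parcsD(1-3)[OF F(1), of u v] by (auto simp: compat_def edges_def)
    moreover have "0 < 1 - W (x u) (x v)" if "(u, v) \<in> ?D - ?E" for u v
      using c that by (auto simp: compat_def edges_def vertex_pairs_def)
    ultimately have "0 < ?ind x" by (intro mult_pos_pos prod_pos) auto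
    with 0 show False by linarith
  qed
qed

text \<open>
  Every graph sampled from \<open>W\<close> at the points \<open>x\<close> with positive probability lies in \<open>P\<close>.
\<close>

definition generic :: "ngraph set \<Rightarrow> (real \<Rightarrow> real \<Rightarrow> real) \<Rightarrow> nat set \<Rightarrow> (nat \<Rightarrow> real) \<Rightarrow> bool" where
  "generic P W V x \<longleftrightarrow> (\<forall>F. pair_graph F \<and> pverts F = V \<and> compat W F x \<longrightarrow> F \<in> P)"

text \<open>There are only finitely many graphs with vertex set V, so their exceptional null sets
  can be united.\<close>

lemma AE_generic:
  assumes "hereditary P" "\<And>n. G n \<in> P" "graphs_converge G \<Gamma>" "represents W \<Gamma>" and V: "finite V"
  shows "AE x in PiM V (\<lambda>_. unit_measure). generic P W V x"
proof -
  let ?A = "{F :: ngraph. pair_graph F \<and> pverts F = V \<and> F \<notin> P}"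
  have "?A \<subseteq> graph_of V ` Pow (vertex_pairs V)"
  proof clarify
    fix F :: ngraph assume F: "pair_graph F" "V = pverts F"
    have "parcs F = edges F \<union> (edges F)\<inverse>"
      using parcs_iff_edges[OF F(1)] by auto
    then have "F = graph_of (pverts F) (edges F)" by (simp add: graph_of_def)
    then show "F \<in> graph_of (pverts F) ` Pow (vertex_pairs (pverts F))"
      using edges_subset[OF F(1)] by blast
  qed
  then have "finite ?A" by (rule finite_subset) (simp add: finite_vertex_pairs V)
  moreover have "AE x in PiM V (\<lambda>_. unit_measure). \<not> compat W F x" if "F \<in> ?A" for F
    using AE_not_compat[OF assms(1-4), of F] that by auto
  ultimately have "AE x in PiM V (\<lambda>_. unit_measure). \<forall>F\<in>?A. \<not> compat W F x"
    by (rule AE_finite_allI)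
  then show ?thesis by (rule eventually_mono) (auto simp: generic_def)
qed

text \<open>Genericity speaks of graphs on all of V, while K prescribes only the pairs in the image
  of \<phi>. On the remaining pairs an edge is put exactly where W is positive, which is always
  compatible since elsewhere W \<le> 0 < 1. The resulting graph is in P and contains K as an induced
  subgraph.\<close>

lemma generic_embed:
  assumes P: "hereditary P" and gen: "generic P W V x" and W: "graphon W"
    and x: "x \<in> space (PiM V (\<lambda>_. unit_measure))" and V: "finite V"
    and K: "pair_graph K" and \<phi>: "inj_on \<phi> (pverts K)" "\<phi> ` pverts K \<subseteq> V"
    and compat: "compat W K (x \<circ> \<phi>)"
  shows "belongs_to K P"
proof -
  define \<psi> where "\<psi> = inv_into (pverts K) \<phi>"
  have \<psi>: "\<psi> (\<phi> u) = u" if "u \<in> pverts K" for u using that \<phi>(1) by (simp add: \<psi>_def)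
  define E where "E u v \<longleftrightarrow> (if u \<in> \<phi> ` pverts K \<and> v \<in> \<phi> ` pverts K
    then (\<psi> u, \<psi> v) \<in> parcs K else 0 < W (x u) (x v))" for u v
  define F :: ngraph where "F = \<lparr>pverts = V, parcs = {(u, v). u \<in> V \<and> v \<in> V \<and> u \<noteq> v \<and> E u v}\<rparr>"
  have symK: "(u, v) \<in> parcs K \<longleftrightarrow> (v, u) \<in> parcs K" for u v
    using pair_graph_parcsD(4)[OF K] by blast
  have Wsym: "W (x u) (x v) = W (x v) (x u)" if "u \<in> V" "v \<in> V" for u v
    using that x W by (auto simp: space_PiM graphon_def PiE_iff)
  have symE: "E u v \<longleftrightarrow> E v u" if "u \<in> V" "v \<in> V" for u v
    unfolding E_def using that symK[of "\<psi> u" "\<psi> v"] Wsym[OF that] by auto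
  have "pair_graph F"
    by (rule pair_graphI) (use V symE in \<open>auto simp: F_def\<close>)
  moreover have "compat W F x"
    unfolding compat_def
  proof (intro ballI impI)
    fix u v assume "u \<in> pverts F" "v \<in> pverts F" and ne: "u \<noteq> v"
    then have uv: "u \<in> V" "v \<in> V" by (auto simp: F_def)
    have arc: "(u, v) \<in> parcs F \<longleftrightarrow> E u v" using uv ne by (simp add: F_def)
    show "if (u, v) \<in> parcs F then 0 < W (x u) (x v) else W (x u) (x v) < 1"
    proof (cases "u \<in> \<phi> ` pverts K \<and> v \<in> \<phi> ` pverts K")
      case False
      then show ?thesis unfolding arc E_def by auto
    next
      case True
      then obtain a b where ab: "a \<in> pverts K" "b \<in> pverts K" "u = \<phi> a" "v = \<phi> b" by auto
      then have "E u v \<longleftrightarrow> (a, b) \<in> parcs K" using \<psi> by (auto simp: E_def)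
      moreover have "a \<noteq> b" using ne ab by auto
      ultimately show ?thesis
        unfolding arc using compat[unfolded compat_def, rule_format, OF ab(1,2)] ab(3,4) by auto
    qed
  qed
  ultimately have "F \<in> P" using gen by (simp add: generic_def F_def)
  then show ?thesis
  proof (rule hereditary_embed[OF P _ K \<phi>(1)])
    fix u v assume uv: "u \<in> pverts K" "v \<in> pverts K"
    then have "\<phi> u \<in> V" "\<phi> v \<in> V" using \<phi> by auto
    moreover have "\<phi> u = \<phi> v \<longleftrightarrow> u = v" using \<phi>(1) uv by (auto dest: inj_onD)
    moreover have "E (\<phi> u) (\<phi> v) \<longleftrightarrow> (u, v) \<in> parcs K" using uv \<psi> by (auto simp: E_def)
    ultimately show "(u, v) \<in> parcs K \<longleftrightarrow> (\<phi> u, \<phi> v) \<in> parcs F"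
      using pair_graph_parcsD(3)[OF K] by (auto simp: F_def)
  qed (use \<phi>(2) in \<open>auto simp: F_def\<close>)
qed

section \<open>Step graphons\<close>

lemma measurable_count_space_pair:
  fixes p :: "'a \<Rightarrow> nat" and w :: "nat \<Rightarrow> nat \<Rightarrow> 'b"
  assumes p: "p \<in> measurable M (count_space UNIV)" and N: "space N = UNIV"
  shows "(\<lambda>q. w (p (fst q)) (p (snd q))) \<in> measurable (M \<Otimes>\<^sub>M M) N"
proof -
  have "(\<lambda>q. (p (fst q), p (snd q))) \<in> measurable (M \<Otimes>\<^sub>M M) (count_space UNIV \<Otimes>\<^sub>M count_space UNIV)"
    using p by measurable
  then have "(\<lambda>q. (p (fst q), p (snd q))) \<in> measurable (M \<Otimes>\<^sub>M M) (count_space UNIV)"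
    by (simp add: pair_measure_countable)
  from measurable_compose[OF this, of "\<lambda>(i, j). w i j" N] N show ?thesis by simp
qed

lemma graphon_measurable:
  assumes "graphon W"
  shows "(\<lambda>q. W (fst q) (snd q)) \<in> borel_measurable (unit_measure \<Otimes>\<^sub>M unit_measure)"
  using assms by (simp add: graphon_def split_beta')

text \<open>Sort the samples by the cell of each coordinate. Only the masses of the cells and the
  weights between them enter, so graphons that agree in these data represent the same limit.\<close>

lemma graphon_hom_density_step:
  fixes p :: "real \<Rightarrow> nat"
  assumes W: "graphon W" and F: "pair_graph F"
    and p[measurable]: "p \<in> measurable unit_measure (count_space UNIV)"
    and I: "finite I" "AE x in unit_measure. p x \<in> I"
    and step: "AE x in unit_measure. AE y in unit_measure. W x y = w (p x) (p y)"
  shows "graphon_hom_density F W = (\<Sum>c\<in>pverts F \<rightarrow>\<^sub>E I.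
    (\<Prod>v\<in>pverts F. measure unit_measure {x \<in> space unit_measure. p x = c v}) * (\<Prod>(u, v)\<in>edges F. w (c u) (c v)))"
proof -
  let ?V = "pverts F" and ?E = "edges F"
  let ?M = "PiM ?V (\<lambda>_. unit_measure)"
  have V: "finite ?V" and E: "?E \<subseteq> vertex_pairs ?V" "finite ?E"
    using F by (simp_all add: pair_graph_finite edges_subset finite_edges)
  interpret PV: finite_measure ?M using V by (rule finite_measure_PiM_unit)
  have [measurable]: "(\<lambda>q. W (fst q) (snd q)) \<in> borel_measurable (unit_measure \<Otimes>\<^sub>M unit_measure)"
    by (rule graphon_measurable[OF W])
  have [measurable]: "(\<lambda>q. w (p (fst q)) (p (snd q))) \<in> borel_measurable (unit_measure \<Otimes>\<^sub>M unit_measure)"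
    by (rule measurable_count_space_pair[OF p]) simp
  have "AE x in ?M. W (x (fst e)) (x (snd e)) = w (p (x (fst e))) (p (x (snd e)))" if "e \<in> ?E" for e
  proof (rule unit.AE_PiM_pair[OF V])
    show "fst e \<in> ?V" "snd e \<in> ?V" "fst e \<noteq> snd e" using that E by (auto simp: vertex_pairs_def)
  qed (use step in measurable)
  then have ae1: "AE x in ?M. \<forall>e\<in>?E. W (x (fst e)) (x (snd e)) = w (p (x (fst e))) (p (x (snd e)))"
    by (intro AE_finite_allI E)
  have "AE x in ?M. p (x v) \<in> I" if "v \<in> ?V" for v
    by (rule unit.AE_PiM_point[OF V that]) (use I in measurable)
  then have ae2: "AE x in ?M. \<forall>v\<in>?V. p (x v) \<in> I"
    by (intro AE_finite_allI V)
  have meas: "(\<lambda>x. \<Prod>v\<in>?V. indicator {i. i = c v} (p (x v)) :: real) \<in> borel_measurable ?M" for c :: "nat \<Rightarrow> nat"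
    by (intro borel_measurable_prod) measurable
  have int: "integrable ?M (\<lambda>x. (\<Prod>v\<in>?V. indicator {i. i = c v} (p (x v)) :: real) * (\<Prod>e\<in>?E. w (c (fst e)) (c (snd e))))" for c
  proof (rule integrable_mult_left, rule PV.integrable_const_bound[of _ 1])
    show "AE x in ?M. norm (\<Prod>v\<in>?V. indicator {i. i = c v} (p (x v)) :: real) \<le> 1"
      by (rule AE_I2) (auto simp: abs_prod indicator_def intro!: prod_le_1)
  qed (rule meas)
  have "graphon_hom_density F W = (LINT x|?M. (\<Prod>e\<in>?E. W (x (fst e)) (x (snd e))))"
    unfolding graphon_hom_density_def edges_def[symmetric] by (simp add: split_beta')
  also have "\<dots> = (LINT x|?M. (\<Sum>c\<in>?V \<rightarrow>\<^sub>E I. (\<Prod>v\<in>?V. indicator {i. i = c v} (p (x v))) * (\<Prod>e\<in>?E. w (c (fst e)) (c (snd e)))))"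
  proof (rule integral_cong_AE)
    show "(\<lambda>x. \<Prod>e\<in>?E. W (x (fst e)) (x (snd e))) \<in> borel_measurable ?M"
      using E by (intro borel_measurable_prod measurable_graphon_component[OF W]) (auto simp: vertex_pairs_def)
    show "(\<lambda>x. \<Sum>c\<in>?V \<rightarrow>\<^sub>E I. (\<Prod>v\<in>?V. indicator {i. i = c v} (p (x v))) * (\<Prod>e\<in>?E. w (c (fst e)) (c (snd e)))) \<in> borel_measurable ?M"
      by (intro borel_measurable_sum borel_measurable_times meas borel_measurable_const)
    show "AE x in ?M. (\<Prod>e\<in>?E. W (x (fst e)) (x (snd e))) =
        (\<Sum>c\<in>?V \<rightarrow>\<^sub>E I. (\<Prod>v\<in>?V. indicator {i. i = c v} (p (x v))) * (\<Prod>e\<in>?E. w (c (fst e)) (c (snd e))))"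
      using ae1 ae2
    proof eventually_elim
      fix x assume 1: "\<forall>e\<in>?E. W (x (fst e)) (x (snd e)) = w (p (x (fst e))) (p (x (snd e)))"
        and 2: "\<forall>v\<in>?V. p (x v) \<in> I"
      \<comment> \<open>The only coloring whose indicator is nonzero at this sample.\<close>
      define c0 where "c0 = (\<lambda>v\<in>?V. p (x v))"
      have c0: "c0 \<in> ?V \<rightarrow>\<^sub>E I" using 2 by (simp add: c0_def)
      have "(\<Prod>v\<in>?V. indicator {i. i = c v} (p (x v)) :: real) = (if c = c0 then 1 else 0)" if c: "c \<in> ?V \<rightarrow>\<^sub>E I" for c
      proof (cases "c = c0")
        case False
        then obtain v where "v \<in> ?V" "c v \<noteq> p (x v)"
          using c c0 by (metis PiE_ext c0_def restrict_apply')
        then show ?thesis using False V by (auto intro!: prod_zero bexI[of _ v])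
      qed (simp add: c0_def)
      then have "(\<Sum>c\<in>?V \<rightarrow>\<^sub>E I. (\<Prod>v\<in>?V. indicator {i. i = c v} (p (x v))) * (\<Prod>e\<in>?E. w (c (fst e)) (c (snd e)))) =
          (\<Sum>c\<in>?V \<rightarrow>\<^sub>E I. if c = c0 then \<Prod>e\<in>?E. w (c (fst e)) (c (snd e)) else 0)"
        by (intro sum.cong) auto
      also have "\<dots> = (\<Prod>e\<in>?E. w (c0 (fst e)) (c0 (snd e)))"
        using c0 V I by (simp add: finite_PiE)
      also have "\<dots> = (\<Prod>e\<in>?E. W (x (fst e)) (x (snd e)))"
        using 1 E by (intro prod.cong) (auto simp: c0_def vertex_pairs_def)
      finally show "(\<Prod>e\<in>?E. W (x (fst e)) (x (snd e))) =
        (\<Sum>c\<in>?V \<rightarrow>\<^sub>E I. (\<Prod>v\<in>?V. indicator {i. i = c v} (p (x v))) * (\<Prod>e\<in>?E. w (c (fst e)) (c (snd e))))" by simp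
    qed
  qed
  also have "\<dots> = (\<Sum>c\<in>?V \<rightarrow>\<^sub>E I. (LINT x|?M. (\<Prod>v\<in>?V. indicator {i. i = c v} (p (x v)))) * (\<Prod>e\<in>?E. w (c (fst e)) (c (snd e))))"
    by (subst Bochner_Integration.integral_sum[OF int]) simp
  also have "\<dots> = (\<Sum>c\<in>?V \<rightarrow>\<^sub>E I. (\<Prod>v\<in>?V. measure unit_measure {x \<in> space unit_measure. p x = c v}) * (\<Prod>e\<in>?E. w (c (fst e)) (c (snd e))))"
  proof (intro sum.cong refl arg_cong2[where f = "(*)"])
    fix c :: "nat \<Rightarrow> nat"
    have eq: "(\<lambda>x. indicator {i. i = c v} (p x) :: real) = indicator {x. p x = c v}" for v
      by (auto simp: indicator_def)
    have "(LINT x|?M. (\<Prod>v\<in>?V. indicator {i. i = c v} (p (x v)) :: real)) = (\<Prod>v\<in>?V. LINT x|unit_measure. indicator {i. i = c v} (p x))"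
      by (rule unit_prod.product_integral_prod[OF V]) (rule unit.integrable_const_bound[of _ 1], simp_all add: indicator_def)
    also have "\<dots> = (\<Prod>v\<in>?V. measure unit_measure {x \<in> space unit_measure. p x = c v})"
      unfolding eq by (intro prod.cong refl) (simp add: Int_def conj_commute del: space_unit_measure)
    finally show "(LINT x|?M. (\<Prod>v\<in>?V. indicator {i. i = c v} (p (x v)) :: real)) =
        (\<Prod>v\<in>?V. measure unit_measure {x \<in> space unit_measure. p x = c v})" .
  qed
  finally show ?thesis by (simp add: split_beta')
qed

lemma sets_unit_measure_borel: "A \<in> sets borel \<Longrightarrow> A \<subseteq> {0..1} \<Longrightarrow> A \<in> sets unit_measure"
  by (auto simp: unit_measure_def sets_restrict_space)

lemma measure_unit_interval:
  assumes "0 \<le> a" "a \<le> b" "b \<le> 1"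
  shows "measure unit_measure {a..<b} = b - a"
proof -
  have "{a..<b} \<subseteq> {0..1}" using assms by auto
  then show ?thesis using assms by (simp add: unit_measure_def measure_restrict_space)
qed

lemma AE_unit_neq_1: "AE x in unit_measure. x \<noteq> 1"
proof -
  have "{1} \<in> null_sets unit_measure"
    by (auto simp: null_sets_def unit_measure_def emeasure_restrict_space sets_restrict_space)
  then show ?thesis by (intro AE_I') auto
qed

lemma measurable_unit_measureI:
  "f \<in> measurable borel N \<Longrightarrow> f \<in> measurable unit_measure N"
  unfolding unit_measure_def by (intro measurable_restrict_space1) simp

section \<open>Limits of entropy $1 - 1/r$\<close>

text \<open>The m-fold Kronecker power of the 2 by 2 matrix k, with rows and columns indexed by
  binary expansions.\<close>

primrec tensor :: "(nat \<Rightarrow> nat \<Rightarrow> real) \<Rightarrow> nat \<Rightarrow> nat \<Rightarrow> nat \<Rightarrow> real" where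
  "tensor k 0 x y = 1"
| "tensor k (Suc m) x y = k (x mod 2) (y mod 2) * tensor k m (x div 2) (y div 2)"

text \<open>
  The tensor power of \<open>walsh_bit\<close> is the Walsh matrix $(-1)^{\langle x, y\rangle}$ over
  $\mathbf{F}_2^m$, an explicit quasirandom graph: averages of products of its entries factor over
  the \<open>m\<close> bits, with a factor of modulus below 1. \<open>equal_bit\<close> accounts for the missing loops.
\<close>

definition walsh_bit :: "nat \<Rightarrow> nat \<Rightarrow> real" where
  "walsh_bit a b = (if a = 1 \<and> b = 1 then -1 else 1)"

definition equal_bit :: "nat \<Rightarrow> nat \<Rightarrow> real" where
  "equal_bit a b = of_bool (a = b)"

lemma tensor_equal_bit: "x < 2 ^ m \<Longrightarrow> y < 2 ^ m \<Longrightarrow> tensor equal_bit m x y = of_bool (x = y)"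
proof (induction m arbitrary: x y)
  case (Suc m)
  have "x = y \<longleftrightarrow> x mod 2 = y mod 2 \<and> x div 2 = y div 2"
    by (metis div_mult_mod_eq)
  then show ?case using Suc.IH[of "x div 2" "y div 2"] Suc.prems by (simp add: equal_bit_def)
qed simp

lemma tensor_walsh_bit_cases: "tensor walsh_bit m x y = 1 \<or> tensor walsh_bit m x y = -1"
  by (induction m arbitrary: x y) (auto simp: walsh_bit_def)

lemma tensor_walsh_bit_sym: "tensor walsh_bit m x y = tensor walsh_bit m y x"
  by (induction m arbitrary: x y) (auto simp: walsh_bit_def)

text \<open>Each value is split into remainder and quotient by a. With a = 2 this peels one bit off
  every coordinate; with a = r it separates the part of a vertex from its position in the
  part.\<close>

lemma sum_PiE_mult:
  fixes f :: "('v \<Rightarrow> nat) \<Rightarrow> real"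
  assumes V: "finite V" and a: "a > 0"
  shows "(\<Sum>\<phi>\<in>V \<rightarrow>\<^sub>E {..<a * b}. f \<phi>) =
    (\<Sum>c\<in>V \<rightarrow>\<^sub>E {..<a}. \<Sum>x\<in>V \<rightarrow>\<^sub>E {..<b}. f (\<lambda>v\<in>V. c v + a * x v))"
proof -
  have lt: "i + a * j < a * b" if "i < a" "j < b" for i j
  proof -
    have "i + a * j < a * Suc j" using that by simp
    also have "\<dots> \<le> a * b" using that by (intro mult_le_mono2) simp
    finally show ?thesis .
  qed
  have "(\<Sum>\<phi>\<in>V \<rightarrow>\<^sub>E {..<a * b}. f \<phi>) =
    (\<Sum>(c, x)\<in>(V \<rightarrow>\<^sub>E {..<a}) \<times> (V \<rightarrow>\<^sub>E {..<b}). f (\<lambda>v\<in>V. c v + a * x v))"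
  proof (rule sum.reindex_bij_witness[where
      j = "\<lambda>\<phi>. (\<lambda>v\<in>V. \<phi> v mod a, \<lambda>v\<in>V. \<phi> v div a)" and
      i = "\<lambda>(c, x). \<lambda>v\<in>V. c v + a * x v"], goal_cases)
    case (1 \<phi>)
    then show ?case by (auto simp: fun_eq_iff PiE_def extensional_def)
  next
    case (2 \<phi>)
    have "\<phi> v div a < b" if "v \<in> V" for v
      using 2 that less_mult_imp_div_less[of "\<phi> v" b a] by (auto simp: PiE_def Pi_def mult.commute)
    then show ?case using a by auto
  next
    case (3 p)
    then obtain c x where p: "p = (c, x)" "c \<in> V \<rightarrow>\<^sub>E {..<a}" "x \<in> V \<rightarrow>\<^sub>E {..<b}" by auto
    have "(c v + a * x v) mod a = c v" "(c v + a * x v) div a = x v" if "v \<in> V" for v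
      using p that by (auto simp: PiE_def Pi_def)
    moreover have "c v = undefined" "x v = undefined" if "v \<notin> V" for v
      using p that by (auto simp: PiE_def extensional_def)
    ultimately show ?case unfolding p(1) by (auto simp: fun_eq_iff)
  next
    case (4 p)
    then show ?case using lt by (fastforce simp: PiE_def Pi_def)
  next
    case (5 \<phi>)
    then show ?case by (auto intro!: arg_cong[where f = f] simp: fun_eq_iff PiE_def extensional_def)
  qed
  also have "\<dots> = (\<Sum>c\<in>V \<rightarrow>\<^sub>E {..<a}. \<Sum>x\<in>V \<rightarrow>\<^sub>E {..<b}. f (\<lambda>v\<in>V. c v + a * x v))"
    by (rule sum.cartesian_product[symmetric])
  finally show ?thesis .
qed

text \<open>The bits range independently, and an entry of a tensor power is a product over the bits.
  Hence the sum over all assignments is the m-th power of the sum for a single bit.\<close>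

lemma sum_tensor_prod:
  assumes V: "finite V" and S: "S \<subseteq> vertex_pairs V"
  shows "(\<Sum>x\<in>V \<rightarrow>\<^sub>E {..<2 ^ m}. \<Prod>e\<in>S. tensor (K e) m (x (fst e)) (x (snd e))) =
    (\<Sum>b\<in>V \<rightarrow>\<^sub>E {..<2}. \<Prod>e\<in>S. K e (b (fst e)) (b (snd e))) ^ m"
proof (induction m)
  case 0
  have "V \<rightarrow>\<^sub>E {..<1::nat} = {\<lambda>v\<in>V. 0}" by (auto simp: fun_eq_iff PiE_def extensional_def)
  then show ?case by simp
next
  case (Suc m)
  let ?T = "\<lambda>m x. \<Prod>e\<in>S. tensor (K e) m (x (fst e)) (x (snd e))"
  let ?B = "\<lambda>b. \<Prod>e\<in>S. K e (b (fst e)) (b (snd e))"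
  have "(\<Sum>x\<in>V \<rightarrow>\<^sub>E {..<2 ^ Suc m}. ?T (Suc m) x) =
      (\<Sum>b\<in>V \<rightarrow>\<^sub>E {..<2}. \<Sum>x\<in>V \<rightarrow>\<^sub>E {..<2 ^ m}. ?T (Suc m) (\<lambda>v\<in>V. b v + 2 * x v))"
    using sum_PiE_mult[OF V, of 2 "?T (Suc m)" "2 ^ m"] by simp
  also have "\<dots> = (\<Sum>b\<in>V \<rightarrow>\<^sub>E {..<2}. \<Sum>x\<in>V \<rightarrow>\<^sub>E {..<2 ^ m}. ?B b * ?T m x)"
  proof (intro sum.cong refl)
    fix b x assume b: "b \<in> V \<rightarrow>\<^sub>E {..<2 :: nat}" and "x \<in> V \<rightarrow>\<^sub>E {..<2 ^ m :: nat}"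
    have "(b v + 2 * x v) mod 2 = b v" "(b v + 2 * x v) div 2 = x v" if "v \<in> V" for v
      using b that by (auto simp: PiE_def Pi_def)
    moreover have "fst e \<in> V" "snd e \<in> V" if "e \<in> S" for e
      using that S by (auto simp: vertex_pairs_def)
    ultimately show "?T (Suc m) (\<lambda>v\<in>V. b v + 2 * x v) = ?B b * ?T m x"
      by (simp flip: prod.distrib)
  qed
  also have "\<dots> = (\<Sum>b\<in>V \<rightarrow>\<^sub>E {..<2}. ?B b) * (\<Sum>x\<in>V \<rightarrow>\<^sub>E {..<2 ^ m}. ?T m x)"
    by (rule sum_product[symmetric])
  finally show ?case by (simp add: Suc.IH)
qed

text \<open>All products have modulus at most 1 and the zero assignment gives 1, so strictness only
  requires one assignment with value at most 0. An edge of S with \<open>equal_bit\<close> gives 0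
  once its ends differ. If S has none, setting exactly the two ends of one edge to 1 flips the sign
  of that edge and of no other.\<close>

lemma sum_bits_lt:
  assumes V: "finite V" and S: "S \<subseteq> vertex_pairs V" "S \<noteq> {}"
    and K: "\<And>e. K e = walsh_bit \<or> K e = equal_bit"
  shows "\<bar>\<Sum>b\<in>V \<rightarrow>\<^sub>E {..<2}. \<Prod>e\<in>S. K e (b (fst e)) (b (snd e))\<bar> < 2 ^ card V"
proof -
  let ?B = "V \<rightarrow>\<^sub>E {..<2 :: nat}"
  let ?t = "\<lambda>b. \<Prod>e\<in>S. K e (b (fst e)) (b (snd e))"
  have fS: "finite S" using S V finite_vertex_pairs finite_subset by blast
  have fB: "finite ?B" and cB: "card ?B = 2 ^ card V" using V by (simp_all add: finite_PiE card_PiE)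
  have S': "fst e \<in> V" "snd e \<in> V" "fst e < snd e" if "e \<in> S" for e
    using that S(1) by (auto simp: vertex_pairs_def)
  have abs: "\<bar>?t b\<bar> \<le> 1" for b
  proof -
    have "\<bar>K e x y\<bar> \<le> 1" for e x y using K[of e] by (auto simp: walsh_bit_def equal_bit_def)
    then show ?thesis unfolding abs_prod by (intro prod_le_1) auto
  qed
  define z where "z = (\<lambda>v\<in>V. 0 :: nat)"
  have "K e 0 0 = 1" for e using K[of e] by (auto simp: walsh_bit_def equal_bit_def)
  then have z: "z \<in> ?B" "?t z = 1" using S' by (auto simp: z_def intro!: prod.neutral)
  obtain b where b: "b \<in> ?B" "?t b \<le> 0"
  proof (cases "\<exists>e\<in>S. K e = equal_bit")
    case True
    then obtain e where e: "e \<in> S" "K e = equal_bit" by blast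
    let ?b = "\<lambda>v\<in>V. if v = fst e then 1 else 0 :: nat"
    have "?t ?b = 0"
      by (rule prod_zero[OF fS]) (use e S'[OF e(1)] in \<open>auto simp: equal_bit_def intro!: bexI[of _ e]\<close>)
    then show ?thesis using that[of ?b] by auto
  next
    case False
    obtain e where e: "e \<in> S" using S by blast
    let ?b = "\<lambda>v\<in>V. if v = fst e \<or> v = snd e then 1 else 0 :: nat"
    have "K e' (?b (fst e')) (?b (snd e')) = (if e' = e then -1 else 1)" if e': "e' \<in> S" for e'
    proof -
      have "K e' = walsh_bit" using False K e' by blast
      then show ?thesis using S'[OF e'] S'[OF e] by (auto simp: walsh_bit_def prod_eq_iff)
    qed
    then have "?t ?b = (\<Prod>e'\<in>S. if e' = e then -1 else 1)" by (intro prod.cong) auto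
    also have "\<dots> = -1" using fS e by (simp add: prod.delta')
    finally show ?thesis using that[of ?b] by auto
  qed
  have "(\<Sum>b\<in>?B. ?t b) = ?t b + (\<Sum>b\<in>?B - {b}. ?t b)" by (rule sum.remove[OF fB b(1)])
  also have "\<dots> \<le> 0 + (\<Sum>b\<in>?B - {b}. 1)"
    using abs by (intro add_mono b sum_mono) (meson abs_le_D1)
  also have "\<dots> < 2 ^ card V" using fB b(1) cB by (simp add: card_Diff_singleton of_nat_diff card_gt_0_iff)
  finally have u: "(\<Sum>b\<in>?B. ?t b) < 2 ^ card V" .
  have "- (2 ^ card V) < - (\<Sum>b\<in>?B - {z}. 1 :: real)"
    using fB z(1) cB by (simp add: card_Diff_singleton of_nat_diff card_gt_0_iff)
  also have "\<dots> \<le> (\<Sum>b\<in>?B - {z}. ?t b)"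
    unfolding sum_negf[symmetric] using abs by (intro sum_mono) (meson abs_le_D2 minus_le_iff)
  also have "\<dots> < (\<Sum>b\<in>?B. ?t b)" using z by (simp add: sum.remove[OF fB z(1)])
  finally show ?thesis using u by (simp add: abs_less_iff)
qed

text \<open>Expand the product over the subsets X of E. The tensor entries on X average to
  \<open>\<rho> X ^ m\<close>, which tends to 0 unless X is empty, so only the product of the
  constants w survives.\<close>

lemma tensor_average_tendsto:
  assumes V: "finite V" and E: "E \<subseteq> vertex_pairs V"
    and K: "\<And>e. K e = walsh_bit \<or> K e = equal_bit"
  shows "(\<lambda>m. (\<Sum>x\<in>V \<rightarrow>\<^sub>E {..<2 ^ m}. \<Prod>e\<in>E. w e + w' e * tensor (K e) m (x (fst e)) (x (snd e))) / (2 ^ m) ^ card V)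
    \<longlonglongrightarrow> (\<Prod>e\<in>E. w e)"
proof -
  have fE: "finite E" using E V finite_vertex_pairs finite_subset by blast
  define \<rho> where "\<rho> X = (\<Sum>b\<in>V \<rightarrow>\<^sub>E {..<2}. \<Prod>e\<in>X. K e (b (fst e)) (b (snd e))) / 2 ^ card V" for X
  have eq: "(\<Sum>x\<in>V \<rightarrow>\<^sub>E {..<2 ^ m}. \<Prod>e\<in>E. w e + w' e * tensor (K e) m (x (fst e)) (x (snd e))) / (2 ^ m) ^ card V =
      (\<Sum>X\<in>Pow E. (\<Prod>e\<in>X. w' e) * (\<Prod>e\<in>E - X. w e) * \<rho> X ^ m)" (is "?l m = _") for m
  proof -
    have "(\<Prod>e\<in>E. w e + w' e * tensor (K e) m (x (fst e)) (x (snd e))) =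
        (\<Sum>X\<in>Pow E. (\<Prod>e\<in>X. w' e) * (\<Prod>e\<in>E - X. w e) * (\<Prod>e\<in>X. tensor (K e) m (x (fst e)) (x (snd e))))" for x
      by (subst add.commute, subst prod_add[OF fE]) (simp add: prod.distrib mult_ac)
    then have "?l m = (\<Sum>X\<in>Pow E. \<Sum>x\<in>V \<rightarrow>\<^sub>E {..<2 ^ m}. (\<Prod>e\<in>X. w' e) * (\<Prod>e\<in>E - X. w e) *
        (\<Prod>e\<in>X. tensor (K e) m (x (fst e)) (x (snd e)))) / (2 ^ m) ^ card V"
      by (subst sum.swap) simp
    also have "\<dots> = (\<Sum>X\<in>Pow E. (\<Prod>e\<in>X. w' e) * (\<Prod>e\<in>E - X. w e) * \<rho> X ^ m)"
    proof (subst sum_divide_distrib, intro sum.cong refl)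
      fix X assume "X \<in> Pow E"
      then have X: "X \<subseteq> vertex_pairs V" using E by auto
      show "(\<Sum>x\<in>V \<rightarrow>\<^sub>E {..<2 ^ m}. (\<Prod>e\<in>X. w' e) * (\<Prod>e\<in>E - X. w e) *
          (\<Prod>e\<in>X. tensor (K e) m (x (fst e)) (x (snd e)))) / (2 ^ m) ^ card V = (\<Prod>e\<in>X. w' e) * (\<Prod>e\<in>E - X. w e) * \<rho> X ^ m"
        by (simp add: sum_tensor_prod[OF V X] \<rho>_def power_divide flip: sum_distrib_left power_mult)
    qed
    finally show ?thesis .
  qed
  have "(\<lambda>m. (\<Prod>e\<in>X. w' e) * (\<Prod>e\<in>E - X. w e) * \<rho> X ^ m) \<longlonglongrightarrow> (if X = {} then \<Prod>e\<in>E. w e else 0)"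
    if X: "X \<in> Pow E" for X
  proof (cases "X = {}")
    case True
    have "\<rho> {} = 1" using V by (simp add: \<rho>_def card_PiE)
    then show ?thesis using True by simp
  next
    case False
    have "\<bar>\<rho> X\<bar> < 1"
      using sum_bits_lt[OF V _ False K] X E by (simp add: \<rho>_def abs_divide)
    then have "(\<lambda>m. \<rho> X ^ m) \<longlonglongrightarrow> 0" by (intro LIMSEQ_power_zero) simp
    then show ?thesis using False tendsto_mult_right_zero by auto
  qed
  then have "(\<lambda>m. \<Sum>X\<in>Pow E. (\<Prod>e\<in>X. w' e) * (\<Prod>e\<in>E - X. w e) * \<rho> X ^ m) \<longlonglongrightarrow>
      (\<Sum>X\<in>Pow E. if X = {} then \<Prod>e\<in>E. w e else 0)"
    by (rule tendsto_sum)
  then show ?thesis unfolding eq using fE by (simp add: sum.delta)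
qed

definition block_weight :: "nat \<Rightarrow> nat \<Rightarrow> nat \<Rightarrow> real" where
  "block_weight s i j = (if i \<noteq> j then 1 / 2 else if i < s then 1 else 0)"

text \<open>The residue modulo r is the part of a vertex and the quotient its position, matching the
  digits of \<open>sum_PiE_mult\<close>. All pairs of parts share the same Walsh matrix, in which -1
  stands for an edge.\<close>

definition walsh_graph :: "nat \<Rightarrow> nat \<Rightarrow> nat \<Rightarrow> ngraph" where
  "walsh_graph r s m = \<lparr>pverts = {..<r * 2 ^ m},
     parcs = {(i, j). i < r * 2 ^ m \<and> j < r * 2 ^ m \<and> i \<noteq> j \<and>
       (if i mod r = j mod r then i mod r < s else tensor walsh_bit m (i div r) (j div r) = -1)}\<rparr>"

lemma pair_graph_walsh_graph: "pair_graph (walsh_graph r s m)"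
  by (rule pair_graphI) (auto simp: walsh_graph_def tensor_walsh_bit_sym split: if_splits)

lemma walsh_graph_colorable:
  assumes "s \<le> r" "r > 0"
  shows "walsh_graph r s m \<in> colorable_class r s"
proof -
  let ?A = "\<lambda>i. {j. j < r * 2 ^ m \<and> Suc (j mod r) = i}"
  have "disjoint_family_on ?A {1..r}" by (auto simp: disjoint_family_on_def)
  moreover have "(\<Union>i\<in>{1..r}. ?A i) = pverts (walsh_graph r s m)"
    using assms(2) by (auto simp: walsh_graph_def Suc_le_eq)
  moreover have "\<forall>i\<in>{1..s}. Defs.clique (walsh_graph r s m) (?A i)"
    by (auto simp: Defs.clique_def walsh_graph_def)
  moreover have "\<forall>i\<in>{s<..r}. independent (walsh_graph r s m) (?A i)"
    by (auto simp: independent_def walsh_graph_def)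
  ultimately show ?thesis
    unfolding colorable_class_def mem_Collect_eq
    by (intro conjI exI[of _ ?A] pair_graph_walsh_graph)
qed

text \<open>Every adjacency indicator is affine in one tensor entry: 1/2 minus half a Walsh entry
  between parts, 1 minus the equality matrix inside a clique, and constantly 0 inside an independent
  part. So \<open>tensor_average_tendsto\<close> applies once the parts of the vertices are
  fixed.\<close>

lemma walsh_graph_density_tendsto:
  assumes r: "r > 0" and F: "pair_graph F"
  shows "(\<lambda>m. graph_hom_density F (walsh_graph r s m)) \<longlonglongrightarrow>
    (\<Sum>c\<in>pverts F \<rightarrow>\<^sub>E {..<r}. (1 / real r) ^ card (pverts F) * (\<Prod>(u, v)\<in>edges F. block_weight s (c u) (c v)))"
proof -
  let ?V = "pverts F" and ?E = "edges F"
  have V: "finite ?V" and E: "?E \<subseteq> vertex_pairs ?V" using F by (simp_all add: pair_graph_finite edges_subset)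
  define w where "w c e = block_weight s (c (fst e)) (c (snd e))" for c :: "nat \<Rightarrow> nat" and e :: "nat \<times> nat"
  define w' where "w' c e = (if c (fst e) \<noteq> c (snd e) then - 1 / 2 else if c (fst e) < s then -1 else 0 :: real)"
    for c :: "nat \<Rightarrow> nat" and e :: "nat \<times> nat"
  define K where "K c e = (if c (fst e) \<noteq> c (snd e) then walsh_bit else equal_bit)"
    for c :: "nat \<Rightarrow> nat" and e :: "nat \<times> nat"
  have arc: "of_bool ((c u + r * x u, c v + r * x v) \<in> parcs (walsh_graph r s m)) =
      w c (u, v) + w' c (u, v) * tensor (K c (u, v)) m (x u) (x v)"
    if "c u < r" "c v < r" "x u < 2 ^ m" "x v < 2 ^ m" for c x u v m
  proof -
    have lt: "i + r * j < r * 2 ^ m" if "i < r" "j < 2 ^ m" for i j :: nat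
    proof -
      have "i + r * j < r * Suc j" using that by simp
      also have "\<dots> \<le> r * 2 ^ m" using that by (intro mult_le_mono2) simp
      finally show ?thesis .
    qed
    have "c u + r * x u = c v + r * x v \<longleftrightarrow> c u = c v \<and> x u = x v"
    proof
      assume *: "c u + r * x u = c v + r * x v"
      have "c u = (c u + r * x u) mod r" "c v = (c v + r * x v) mod r"
        "x u = (c u + r * x u) div r" "x v = (c v + r * x v) div r" using that by simp_all
      then show "c u = c v \<and> x u = x v" using * by metis
    qed simp
    then show ?thesis
      using that lt tensor_walsh_bit_cases[of m "x u" "x v"] tensor_equal_bit[of "x u" m "x v"]
      by (auto simp: walsh_graph_def w_def w'_def K_def block_weight_def)
  qed
  have eq: "graph_hom_density F (walsh_graph r s m) = (\<Sum>c\<in>?V \<rightarrow>\<^sub>E {..<r}. (1 / real r) ^ card ?V *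
      ((\<Sum>x\<in>?V \<rightarrow>\<^sub>E {..<2 ^ m}. \<Prod>e\<in>?E. w c e + w' c e * tensor (K c e) m (x (fst e)) (x (snd e))) / (2 ^ m) ^ card ?V))" for m
  proof -
    have "real (card (graph_homs F (walsh_graph r s m))) =
        (\<Sum>\<phi>\<in>?V \<rightarrow>\<^sub>E {..<r * 2 ^ m}. \<Prod>(u, v)\<in>?E. of_bool ((\<phi> u, \<phi> v) \<in> parcs (walsh_graph r s m)))"
      by (subst card_graph_homs[OF F pair_graph_walsh_graph]) (simp add: walsh_graph_def)
    also have "\<dots> = (\<Sum>c\<in>?V \<rightarrow>\<^sub>E {..<r}. \<Sum>x\<in>?V \<rightarrow>\<^sub>E {..<2 ^ m}.
        \<Prod>e\<in>?E. w c e + w' c e * tensor (K c e) m (x (fst e)) (x (snd e)))"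
      unfolding sum_PiE_mult[OF V r]
    proof (intro sum.cong prod.cong refl)
      fix c x e assume *: "c \<in> ?V \<rightarrow>\<^sub>E {..<r}" "x \<in> ?V \<rightarrow>\<^sub>E {..<2 ^ m :: nat}" "e \<in> ?E"
      obtain u v where e: "e = (u, v)" by (cases e)
      have uv: "u \<in> ?V" "v \<in> ?V" using * e E by (auto simp: vertex_pairs_def)
      then have "c u < r" "c v < r" "x u < 2 ^ m" "x v < 2 ^ m" using * by (auto simp: PiE_def Pi_def)
      from arc[of c u v x m, OF this] uv
      show "(case e of (u, v) \<Rightarrow> of_bool (((\<lambda>v\<in>?V. c v + r * x v) u, (\<lambda>v\<in>?V. c v + r * x v) v) \<in> parcs (walsh_graph r s m))) =
          w c e + w' c e * tensor (K c e) m (x (fst e)) (x (snd e))"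
        by (simp add: e)
    qed
    moreover have "real (card (pverts (walsh_graph r s m))) = real r * 2 ^ m"
      by (simp add: walsh_graph_def)
    ultimately show ?thesis
      unfolding graph_hom_density_def
      by (simp add: sum_divide_distrib power_mult_distrib power_one_over divide_simps mult.commute)
  qed
  show ?thesis
    unfolding eq
    by (intro tendsto_sum tendsto_mult tendsto_const)
      (use tensor_average_tendsto[OF V E, of "K _" "w _" "w' _"] in
        \<open>simp add: K_def w_def split_beta' cong: prod.cong\<close>)
qed

section \<open>The limit of the Walsh graphs and its entropy\<close>

definition block_index :: "nat \<Rightarrow> real \<Rightarrow> nat" where
  "block_index r x = nat \<lfloor>real r * x\<rfloor>"

definition block_graphon :: "nat \<Rightarrow> nat \<Rightarrow> real \<Rightarrow> real \<Rightarrow> real" where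
  "block_graphon r s x y = block_weight s (block_index r x) (block_index r y)"

lemma block_index_measurable [measurable]: "block_index r \<in> measurable unit_measure (count_space UNIV)"
proof -
  have "block_index r \<in> measurable borel (count_space UNIV)"
    unfolding block_index_def by measurable
  then show ?thesis by (rule measurable_unit_measureI)
qed

lemma graphon_of_step:
  fixes p :: "real \<Rightarrow> nat"
  assumes p: "p \<in> measurable unit_measure (count_space UNIV)"
    and w: "\<And>i j. w i j = w j i" "\<And>i j. 0 \<le> w i j" "\<And>i j. w i j \<le> 1"
  shows "graphon (\<lambda>x y. w (p x) (p y))"
  unfolding graphon_def
proof (intro conjI ballI)
  show "(\<lambda>(x, y). w (p x) (p y)) \<in> borel_measurable (unit_measure \<Otimes>\<^sub>M unit_measure)"
    using measurable_count_space_pair[OF p, of borel w] by (simp add: split_beta')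
qed (rule w)+

lemma block_graphon_graphon: "graphon (block_graphon r s)"
  unfolding block_graphon_def by (rule graphon_of_step) (auto simp: block_weight_def)

text \<open>The point 1 has index r, which is not a block; it is only a null set.\<close>

lemma block_index_less:
  assumes "r > 0" "x \<in> {0..1}" "x \<noteq> 1"
  shows "block_index r x < r"
proof -
  have "real r * x < real r" using assms by simp
  then have "\<lfloor>real r * x\<rfloor> < int r" by (simp add: floor_less_iff)
  then show ?thesis using assms by (simp add: block_index_def nat_less_iff)
qed

lemma block_index_eq:
  assumes "r > 0" "i < r"
  shows "{x \<in> space unit_measure. block_index r x = i} = {real i / real r..<real (Suc i) / real r}"
proof -
  have le1: "real (Suc i) / real r \<le> 1" and ge0: "0 \<le> real i / real r" using assms by simp_all
  have "x \<in> {0..1} \<and> block_index r x = i \<longleftrightarrow> real i / real r \<le> x \<and> x < real (Suc i) / real r" for x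
  proof -
    have 1: "real i / real r \<le> x \<longleftrightarrow> real i \<le> real r * x" "x < real (Suc i) / real r \<longleftrightarrow> real r * x < real (Suc i)"
      using assms by (simp_all add: pos_divide_le_eq pos_less_divide_eq mult.commute)
    show ?thesis
    proof
      assume *: "x \<in> {0..1} \<and> block_index r x = i"
      then have "\<lfloor>real r * x\<rfloor> = int i" by (auto simp: block_index_def)
      then show "real i / real r \<le> x \<and> x < real (Suc i) / real r" unfolding 1 by (simp add: floor_eq_iff)
    next
      assume *: "real i / real r \<le> x \<and> x < real (Suc i) / real r"
      then have "x \<in> {0..1}" using le1 ge0 unfolding atLeastAtMost_iff by linarith
      moreover have "\<lfloor>real r * x\<rfloor> = int i" using * unfolding 1 by (simp add: floor_eq_iff)
      ultimately show "x \<in> {0..1} \<and> block_index r x = i" by (simp add: block_index_def)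
    qed
  qed
  then show ?thesis by (intro set_eqI) (simp only: space_unit_measure mem_Collect_eq atLeastLessThan_iff)
qed

lemma measure_block_index:
  assumes "r > 0" "i < r"
  shows "measure unit_measure {x \<in> space unit_measure. block_index r x = i} = 1 / real r"
proof -
  have "real (Suc i) / real r \<le> 1" using assms by simp
  then have "measure unit_measure {real i / real r..<real (Suc i) / real r} = real (Suc i) / real r - real i / real r"
    by (intro measure_unit_interval) (auto simp: divide_right_mono)
  also have "\<dots> = 1 / real r" by (simp add: diff_divide_distrib[symmetric])
  finally show ?thesis unfolding block_index_eq[OF assms] .
qed

lemma AE_block_index_less: "r > 0 \<Longrightarrow> AE x in unit_measure. block_index r x < r"
  using AE_unit_neq_1 AE_space by eventually_elim (rule block_index_less, simp_all)

lemma block_graphon_density: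
  assumes "r > 0" "pair_graph F"
  shows "graphon_hom_density F (block_graphon r s) =
    (\<Sum>c\<in>pverts F \<rightarrow>\<^sub>E {..<r}. (1 / real r) ^ card (pverts F) * (\<Prod>(u, v)\<in>edges F. block_weight s (c u) (c v)))"
proof -
  have "graphon_hom_density F (block_graphon r s) = (\<Sum>c\<in>pverts F \<rightarrow>\<^sub>E {..<r}.
    (\<Prod>v\<in>pverts F. measure unit_measure {x \<in> space unit_measure. block_index r x = c v}) * (\<Prod>(u, v)\<in>edges F. block_weight s (c u) (c v)))"
    by (rule graphon_hom_density_step[OF block_graphon_graphon assms(2) block_index_measurable])
      (use AE_block_index_less[OF assms(1)] in \<open>auto simp: block_graphon_def\<close>)
  also have "\<dots> = (\<Sum>c\<in>pverts F \<rightarrow>\<^sub>E {..<r}. (1 / real r) ^ card (pverts F) * (\<Prod>(u, v)\<in>edges F. block_weight s (c u) (c v)))"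
  proof (intro sum.cong refl arg_cong2[where f = "(*)"])
    fix c assume "c \<in> pverts F \<rightarrow>\<^sub>E {..<r}"
    then have "(\<Prod>v\<in>pverts F. measure unit_measure {x \<in> space unit_measure. block_index r x = c v}) = (\<Prod>v\<in>pverts F. 1 / real r)"
      using assms(1) by (intro prod.cong refl measure_block_index) auto
    then show "(\<Prod>v\<in>pverts F. measure unit_measure {x \<in> space unit_measure. block_index r x = c v}) = (1 / real r) ^ card (pverts F)"
      by simp
  qed
  finally show ?thesis .
qed

lemma binary_entropy_half: "binary_entropy (1 / 2) = 1"
  by (simp add: binary_entropy_def log_divide)

text \<open>A pair of points in different blocks contributes 1 and a pair within one block
  contributes 0, so each row misses exactly the measure 1/r of its own block.\<close>

lemma block_graphon_entropy:
  assumes r: "r > 0"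
  shows "graphon_entropy (block_graphon r s) = 1 - 1 / real r"
proof -
  have "(LINT y|unit_measure. binary_entropy (block_graphon r s x y)) = 1 - 1 / real r"
    if x: "block_index r x < r" for x
  proof -
    let ?S = "{y \<in> space unit_measure. block_index r y = block_index r x}"
    have [measurable]: "?S \<in> sets unit_measure" by measurable
    have "(LINT y|unit_measure. binary_entropy (block_graphon r s x y)) = (LINT y|unit_measure. 1 - indicator ?S y)"
      by (rule Bochner_Integration.integral_cong)
        (auto simp: block_graphon_def block_weight_def binary_entropy_half, auto simp: binary_entropy_def)
    also have "\<dots> = 1 - measure unit_measure ?S"
      by (subst Bochner_Integration.integral_diff) (auto intro!: integrable_real_indicator simp: unit.prob_space unit.emeasure_eq_measure simp del: space_unit_measure)
    also have "\<dots> = 1 - 1 / real r" using measure_block_index[OF r x] by simp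
    finally show ?thesis .
  qed
  then have "AE x in unit_measure. (LINT y|unit_measure. binary_entropy (block_graphon r s x y)) = 1 - 1 / real r"
    using AE_block_index_less[OF r] by (auto elim!: eventually_mono)
  moreover have "(\<lambda>x. LINT y|unit_measure. binary_entropy (block_graphon r s x y)) \<in> borel_measurable unit_measure"
  proof -
    have "(\<lambda>q. binary_entropy (block_weight s (block_index r (fst q)) (block_index r (snd q)))) \<in> borel_measurable (unit_measure \<Otimes>\<^sub>M unit_measure)"
      by (rule measurable_count_space_pair[OF block_index_measurable, of borel "\<lambda>i j. binary_entropy (block_weight s i j)"]) simp
    then show ?thesis unfolding block_graphon_def
      by (intro unit.borel_measurable_lebesgue_integral) (simp add: split_beta')
  qed
  ultimately have "graphon_entropy (block_graphon r s) = (LINT x|unit_measure. 1 - 1 / real r)"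
    unfolding graphon_entropy_def by (intro integral_cong_AE) auto
  then show ?thesis using unit.prob_space by simp
qed

theorem colorable_class_limit:
  assumes P: "colorable_class r s \<subseteq> P" and s: "s \<le> r" and r: "r > 0"
  shows "\<exists>\<Gamma>\<in>class_limits P. has_entropy \<Gamma> (1 - 1 / real r)"
proof
  let ?\<Gamma> = "restrict (\<lambda>F. graphon_hom_density F (block_graphon r s)) {F. pair_graph F}"
  show "has_entropy ?\<Gamma> (1 - 1 / real r)"
    unfolding has_entropy_def represents_def
    by (intro exI[of _ "block_graphon r s"]) (simp add: block_graphon_graphon block_graphon_entropy[OF r])
  have "filterlim (\<lambda>m. card (pverts (walsh_graph r s m))) at_top sequentially"
  proof (rule filterlim_at_top_mono[OF filterlim_ident])
    have "m \<le> r * 2 ^ m" for m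
    proof -
      have "m \<le> 2 ^ m" by (rule less_imp_le[OF less_exp])
      also have "\<dots> \<le> r * 2 ^ m" using r by simp
      finally show ?thesis .
    qed
    then show "\<forall>\<^sub>F m in sequentially. m \<le> card (pverts (walsh_graph r s m))"
      by (simp add: walsh_graph_def)
  qed
  then have "graphs_converge (walsh_graph r s) ?\<Gamma>"
    unfolding graphs_converge_def
  proof (intro conjI allI impI)
    fix F :: ngraph assume F: "pair_graph F"
    show "(\<lambda>n. graph_hom_density F (walsh_graph r s n)) \<longlonglongrightarrow> ?\<Gamma> F"
      using walsh_graph_density_tendsto[OF r F, of s] F by (simp add: block_graphon_density[OF r F])
  qed (auto intro: pair_graph_walsh_graph)
  moreover have "walsh_graph r s m \<in> P" for m
    using P walsh_graph_colorable[OF s r] by (rule subsetD)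
  ultimately show "?\<Gamma> \<in> class_limits P"
    unfolding class_limits_def mem_Collect_eq by (intro exI[of _ "walsh_graph r s"] conjI allI)
qed

section \<open>The extremal partition\<close>

context measurable_graph
begin

lemma AE_nonadjacent_transitive:
  assumes "defect (space M) = 0"
  shows "AE x in M. AE y in M. AE z in M. \<not> (R x y \<and> \<not> R x z \<and> \<not> R y z)"
proof -
  let ?m = "\<lambda>x y z. if R x y \<and> \<not> R x z \<and> \<not> R y z then 1 else 0 :: ennreal"
  have "defect (space M) = (\<integral>\<^sup>+ x. \<integral>\<^sup>+ y. \<integral>\<^sup>+ z. ?m x y z \<partial>M \<partial>M \<partial>M)"
    unfolding defect_def by (intro nn_integral_cong) auto
  then have 0: "(\<integral>\<^sup>+ x. \<integral>\<^sup>+ y. \<integral>\<^sup>+ z. ?m x y z \<partial>M \<partial>M \<partial>M) = 0" using assms by simp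
  have "AE x in M. (\<integral>\<^sup>+ y. \<integral>\<^sup>+ z. ?m x y z \<partial>M \<partial>M) = 0"
    using 0 by (subst (asm) nn_integral_0_iff_AE) measurable
  then show ?thesis
  proof (rule AE_mp[OF _ AE_I2], intro impI)
    fix x assume [simp]: "x \<in> space M" and "(\<integral>\<^sup>+ y. \<integral>\<^sup>+ z. ?m x y z \<partial>M \<partial>M) = 0"
    then have "AE y in M. (\<integral>\<^sup>+ z. ?m x y z \<partial>M) = 0"
      by (subst (asm) nn_integral_0_iff_AE) measurable
    then show "AE y in M. AE z in M. \<not> (R x y \<and> \<not> R x z \<and> \<not> R y z)"
    proof (rule AE_mp[OF _ AE_I2], intro impI)
      fix y assume [simp]: "y \<in> space M" and "(\<integral>\<^sup>+ z. ?m x y z \<partial>M) = 0"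
      then have "AE z in M. ?m x y z = 0"
        by (subst (asm) nn_integral_0_iff_AE) measurable
      then show "AE z in M. \<not> (R x y \<and> \<not> R x z \<and> \<not> R y z)"
        by (rule eventually_mono) (simp split: if_splits)
    qed
  qed
qed

text \<open>Greedy construction: almost every point outside the parts found so far is a suitable
  seed, and its non-neighbourhood is the next part. It has measure 1/r because the degree is
  constant, and the vanishing defect makes it independent and completely joined to its complement.
  For j < r the old parts do not fill the space, so a seed exists.\<close>

lemma multipartite_partial:
  assumes r: "r \<ge> 1" and j: "j \<le> r"
    and defect: "defect (space M) = 0" and deg: "AE x in M. deg (space M) x = ennreal (1 - 1 / real r)"
  shows "\<exists>A. (\<forall>i<j. A i \<in> sets M \<and> measure M (A i) = 1 / real r) \<and> disjoint_family_on A {..<j} \<and>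
    (\<forall>i<j. AE x in M. AE y in M. x \<in> A i \<longrightarrow> (R x y \<longleftrightarrow> y \<notin> A i))"
  using j
proof (induction j)
  case 0
  show ?case by (auto simp: disjoint_family_on_def)
next
  case (Suc j)
  interpret pair_sigma_finite M M ..
  obtain A where A: "\<And>i. i < j \<Longrightarrow> A i \<in> sets M" "\<And>i. i < j \<Longrightarrow> measure M (A i) = 1 / real r"
    "disjoint_family_on A {..<j}" "\<And>i. i < j \<Longrightarrow> AE x in M. AE y in M. x \<in> A i \<longrightarrow> (R x y \<longleftrightarrow> y \<notin> A i)"
    using Suc by auto
  note [measurable] = A(1)
  define B where "B = (\<Union>i<j. A i)"
  have B: "B \<in> sets M" unfolding B_def using A(1) by auto
  have "measure M B = (\<Sum>i<j. measure M (A i))"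
    unfolding B_def by (rule finite_measure_finite_Union) (use A in auto)
  also have "\<dots> = real j / real r" using A(2) by simp
  also have "\<dots> < 1" using Suc.prems by simp
  finally have mB: "measure M B < 1" .
  let ?T = "\<lambda>x y z. \<not> (R x y \<and> \<not> R x z \<and> \<not> R y z)"
  have T: "AE x in M. AE y in M. AE z in M. ?T x y z" by (rule AE_nonadjacent_transitive[OF defect])
  have predT: "Measurable.pred (M \<Otimes>\<^sub>M M \<Otimes>\<^sub>M M) (\<lambda>q. ?T (fst q) (fst (snd q)) (snd (snd q)))" by measurable
  have T1: "AE x in M. AE z in M. AE y in M. ?T x y z" by (rule AE_triple_swap[OF predT T])
  have predT': "Measurable.pred (M \<Otimes>\<^sub>M M \<Otimes>\<^sub>M M) (\<lambda>q. ?T (fst q) (snd (snd q)) (fst (snd q)))" by measurable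
  have T2: "AE z in M. AE x in M. AE y in M. ?T x y z" by (rule AE_triple_rotate[OF predT' T1])
  have "AE y in M. AE x in M. x \<in> A i \<longrightarrow> (R x y \<longleftrightarrow> y \<notin> A i)" if "i < j" for i
  proof -
    note [measurable] = A(1)[OF that]
    have "{p \<in> space (M \<Otimes>\<^sub>M M). fst p \<in> A i \<longrightarrow> (R (fst p) (snd p) \<longleftrightarrow> snd p \<notin> A i)} \<in> sets (M \<Otimes>\<^sub>M M)"
      by measurable
    from iffD1[OF AE_commute[OF this] A(4)[OF that]] show ?thesis .
  qed
  then have A': "AE y in M. \<forall>i\<in>{..<j}. AE x in M. x \<in> A i \<longrightarrow> (R x y \<longleftrightarrow> y \<notin> A i)"
    by (intro AE_finite_allI) auto
  \<comment> \<open>With the seed in the third place of \<open>?T\<close>, two of its non-neighbours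
    are non-adjacent; with the seed in the first place, a neighbour and a non-neighbour are
    adjacent. One and the same x must serve in both places, hence the reordered quantifiers
    above.\<close>
  have "\<exists>x\<in>space M. x \<notin> B \<and> deg (space M) x = ennreal (1 - 1 / real r) \<and>
    (AE z in M. AE y in M. ?T x y z) \<and> (AE y in M. AE z in M. ?T y z x) \<and>
    (\<forall>i\<in>{..<j}. AE z in M. z \<in> A i \<longrightarrow> (R z x \<longleftrightarrow> x \<notin> A i))"
  proof (rule ccontr)
    assume *: "\<not> ?thesis"
    have "AE x in M. x \<in> B"
      using deg T1 T2 A' AE_space by eventually_elim (use * in blast)
    then have "measure M B = 1" using B by (simp add: prob_eq_1)
    with mB show False by simp
  qed
  then obtain x where x[simp]: "x \<in> space M" and xB: "x \<notin> B" and dx: "deg (space M) x = ennreal (1 - 1 / real r)"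
    and x1: "AE z in M. AE y in M. ?T x y z" and x2: "AE y in M. AE z in M. ?T y z x"
    and x3: "\<And>i. i < j \<Longrightarrow> AE z in M. z \<in> A i \<longrightarrow> R z x"
    unfolding B_def by force
  define C where "C = {y \<in> space M. \<not> R x y}"
  have C[measurable]: "C \<in> sets M" unfolding C_def by measurable
  have "C = space M - nbhd (space M) x" by (auto simp: C_def nbhd_def)
  moreover have "measure M (nbhd (space M) x) = 1 - 1 / real r"
    using emeasure_nbhd[OF sets.top x] dx r by (simp add: emeasure_eq_measure)
  ultimately have mC: "measure M C = 1 / real r" using prob_compl[OF nbhd_sets[OF sets.top x]] by simp
  have CB: "AE z in M. z \<in> C \<longrightarrow> z \<notin> B"
  proof -
    have "AE z in M. \<forall>i\<in>{..<j}. z \<in> A i \<longrightarrow> R z x"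
      using x3 by (intro AE_finite_allI) auto
    then show ?thesis using AE_space
      by eventually_elim (use R_sym[of x] in \<open>auto simp: C_def B_def\<close>)
  qed
  \<comment> \<open>C meets the old parts in a null set only. Removing it makes the parts disjoint
    everywhere and changes no measure.\<close>
  define A' where "A' = A(j := C - B)"
  have A'j: "A' j = C - B" and A'i: "\<And>i. i < j \<Longrightarrow> A' i = A i" by (auto simp: A'_def)
  have "measure M (C - B) = measure M C"
    by (rule finite_measure_eq_AE) (use CB B in \<open>auto elim!: eventually_mono\<close>)
  then have mA': "measure M (A' j) = 1 / real r" by (simp add: A'j mC)
  have "AE y in M. AE z in M. y \<in> C - B \<longrightarrow> (R y z \<longleftrightarrow> z \<notin> C - B)"
    using x1 x2 AE_space
  proof eventually_elim
    case (elim y)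
    show ?case using elim(1,2) CB AE_space
    proof eventually_elim
      case (elim z)
      then show ?case using \<open>y \<in> space M\<close> R_sym[of x y] R_sym[of x z] R_sym[of y z] by (auto simp: C_def)
    qed
  qed
  then have new: "AE y in M. AE z in M. y \<in> A' j \<longrightarrow> (R y z \<longleftrightarrow> z \<notin> A' j)" by (simp only: A'j)
  show ?case
  proof (intro exI[of _ A'] conjI allI impI)
    fix i assume i: "i < Suc j"
    then consider "i < j" | "i = j" by linarith
    note cs = this
    show "A' i \<in> sets M" using cs A(1) B C by cases (auto simp: A'i A'j)
    show "measure M (A' i) = 1 / real r" using cs A(2) mA' by cases (auto simp: A'i)
    show "AE x in M. AE y in M. x \<in> A' i \<longrightarrow> (R x y \<longleftrightarrow> y \<notin> A' i)"
      using cs by cases (use A(4) new in \<open>auto simp: A'i\<close>)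
  next
    show "disjoint_family_on A' {..<Suc j}"
      unfolding disjoint_family_on_def
    proof (intro ballI impI)
      fix a b assume ab: "a \<in> {..<Suc j}" "b \<in> {..<Suc j}" "a \<noteq> b"
      have old: "A' i \<subseteq> B" if "i < j" for i using that by (auto simp: A'i B_def)
      consider "a < j" "b < j" | "a = j" "b < j" | "a < j" "b = j" using ab by fastforce
      then show "A' a \<inter> A' b = {}"
      proof cases
        case 1
        then show ?thesis using A(3) ab(3) by (auto simp: A'i disjoint_family_on_def)
      next
        case 2
        then show ?thesis using old[of b] by (auto simp: A'j)
      next
        case 3
        then show ?thesis using old[of a] by (auto simp: A'j)
      qed
    qed
  qed
qed

text \<open>After n + 1 rounds of the greedy construction the parts have total measure 1, so nothing
  but a null set is left over.\<close>

theorem turan_partition: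
  assumes n: "n \<ge> 1" and I: "finite I" "card I = n + 2"
    and free: "AE x in PiM I (\<lambda>_. M). \<not> clique_in (space M) I x"
    and dense: "edge_mass (space M) \<ge> ennreal (1 - 1 / real (n + 1))"
  obtains A where "\<And>i. i < n + 1 \<Longrightarrow> A i \<in> sets M" "\<And>i. i < n + 1 \<Longrightarrow> measure M (A i) = 1 / real (n + 1)"
    "disjoint_family_on A {..<n + 1}" "\<And>i. i < n + 1 \<Longrightarrow> AE x in M. AE y in M. x \<in> A i \<longrightarrow> (R x y \<longleftrightarrow> y \<notin> A i)"
    "AE x in M. x \<in> (\<Union>i<n + 1. A i)"
proof -
  note ex = turan_extremal[OF n I free dense]
  obtain A where A: "\<And>i. i < n + 1 \<Longrightarrow> A i \<in> sets M" "\<And>i. i < n + 1 \<Longrightarrow> measure M (A i) = 1 / real (n + 1)"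
    "disjoint_family_on A {..<n + 1}" "\<And>i. i < n + 1 \<Longrightarrow> AE x in M. AE y in M. x \<in> A i \<longrightarrow> (R x y \<longleftrightarrow> y \<notin> A i)"
    using multipartite_partial[OF _ order_refl ex(2,3)] by auto
  have "measure M (\<Union>i<n + 1. A i) = (\<Sum>i<n + 1. measure M (A i))"
    by (rule finite_measure_finite_Union) (use A in auto)
  also have "\<dots> = 1" using A(2) by simp
  finally have "AE x in M. x \<in> (\<Union>i<n + 1. A i)"
    using A(1) by (subst (asm) prob_eq_1) auto
  then show ?thesis using that A by blast
qed

end

section \<open>Fractional cliques and colorable classes\<close>

context measurable_graph
begin

text \<open>Copies are added one at a time by \<open>positive_duplicate\<close>. The new point x w
  could replace x (c w) in the old configuration, so it is joined to every point of another
  color.\<close>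

lemma clique_blowup:
  assumes I: "finite I" and J: "finite J" "I \<inter> J = {}" and c: "\<And>i. i \<in> I \<Longrightarrow> c i = i" "\<And>j. j \<in> J \<Longrightarrow> c j \<in> I"
    and pos: "\<not> (AE x in PiM I (\<lambda>_. M). \<not> clique_in (space M) I x)"
  shows "\<not> (AE x in PiM (I \<union> J) (\<lambda>_. M). \<not> (\<forall>u\<in>I \<union> J. \<forall>v\<in>I \<union> J. c u \<noteq> c v \<longrightarrow> R (x u) (x v)))"
  using J c(2)
proof (induction J rule: finite_induct)
  case empty
  show ?case
  proof
    assume "AE x in PiM (I \<union> {}) (\<lambda>_. M). \<not> (\<forall>u\<in>I \<union> {}. \<forall>v\<in>I \<union> {}. c u \<noteq> c v \<longrightarrow> R (x u) (x v))"
    then have "AE x in PiM I (\<lambda>_. M). \<not> clique_in (space M) I x"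
      unfolding Un_empty_right by (rule eventually_mono) (auto simp: clique_in_def c(1))
    with pos show False ..
  qed
next
  case (insert w J)
  let ?V = "I \<union> J"
  let ?Q = "\<lambda>V x. \<forall>u\<in>V. \<forall>v\<in>V. c u \<noteq> c v \<longrightarrow> R (x u) (x v)"
  have V: "finite ?V" "c w \<in> ?V" "w \<notin> ?V" "insert w ?V = I \<union> insert w J" "c w \<in> I"
    using I insert by auto
  have "Measurable.pred (PiM ?V (\<lambda>_. M)) (\<lambda>x. c u \<noteq> c v \<longrightarrow> R (x u) (x v))" if "u \<in> ?V" "v \<in> ?V" for u v
    using pred_component_pair[OF R_pred that] by measurable
  then have Q: "Measurable.pred (PiM ?V (\<lambda>_. M)) (?Q ?V)"
    by (intro pred_intros_finite V(1))
  have "\<not> (AE x in PiM ?V (\<lambda>_. M). \<not> ?Q ?V x)"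
    using insert by (intro insert.IH) auto
  from positive_duplicate[OF V(1-3) Q this]
  have pos': "\<not> (AE x in PiM (I \<union> insert w J) (\<lambda>_. M). \<not> (?Q ?V (restrict x ?V) \<and> ?Q ?V ((restrict x ?V)(c w := x w))))"
    unfolding V(4) .
  show ?case
  proof
    assume "AE x in PiM (I \<union> insert w J) (\<lambda>_. M). \<not> ?Q (I \<union> insert w J) x"
    then have "AE x in PiM (I \<union> insert w J) (\<lambda>_. M). \<not> (?Q ?V (restrict x ?V) \<and> ?Q ?V ((restrict x ?V)(c w := x w)))"
    proof (rule AE_mp[OF _ AE_I2], intro impI notI)
      fix x assume x: "x \<in> space (PiM (I \<union> insert w J) (\<lambda>_. M))" and n: "\<not> ?Q (I \<union> insert w J) x"
        and "?Q ?V (restrict x ?V) \<and> ?Q ?V ((restrict x ?V)(c w := x w))"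
      then have q1: "?Q ?V (restrict x ?V)" and q2: "?Q ?V ((restrict x ?V)(c w := x w))" by auto
      have sp: "x u \<in> space M" if "u \<in> I \<union> insert w J" for u
        using x that by (auto simp: space_PiM)
      have new: "R (x w) (x v)" if "v \<in> ?V" "c v \<noteq> c w" for v
      proof -
        have "c (c w) = c w" "v \<noteq> c w" using V(5) c(1) that by auto
        then show ?thesis using bspec[OF bspec[OF q2 V(2)] that(1)] that by simp
      qed
      have "?Q (I \<union> insert w J) x"
      proof (intro ballI impI)
        fix u v assume uv: "u \<in> I \<union> insert w J" "v \<in> I \<union> insert w J" and ne: "c u \<noteq> c v"
        show "R (x u) (x v)"
        proof (cases "u = w")
          case True
          then show ?thesis using new[of v] uv ne by auto
        next
          case u: False
          show ?thesis
          proof (cases "v = w")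
            case True
            then show ?thesis using new[of u] uv ne u R_sym[OF sp[OF uv(1)] sp[OF uv(2)]] by auto
          next
            case False
            then show ?thesis using bspec[OF bspec[OF q1, of u], of v] uv ne u by auto
          qed
        qed
      qed
      with n show False ..
    qed
    with pos' show False ..
  qed
qed

end

section \<open>Embedding a graph into a sample, one color class at a time\<close>

definition embeds :: "('b \<Rightarrow> 'b \<Rightarrow> real) \<Rightarrow> ('i \<Rightarrow> 'b) \<Rightarrow> 'a pair_pre_digraph \<Rightarrow> 'a set \<Rightarrow> 'i set \<Rightarrow> bool" where
  "embeds W x K S T \<longleftrightarrow> (\<exists>\<phi>. inj_on \<phi> S \<and> \<phi> ` S \<subseteq> T \<and> (\<forall>u\<in>S. \<forall>v\<in>S. u \<noteq> v \<longrightarrow>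
     (if (u, v) \<in> parcs K then 0 < W (x (\<phi> u)) (x (\<phi> v)) else W (x (\<phi> u)) (x (\<phi> v)) < 1)))"

lemma embeds_mono:
  assumes "embeds W x K S T" "T \<subseteq> T'"
  shows "embeds W x K S T'"
proof -
  obtain \<phi> where \<phi>: "inj_on \<phi> S" "\<phi> ` S \<subseteq> T" "\<forall>u\<in>S. \<forall>v\<in>S. u \<noteq> v \<longrightarrow>
     (if (u, v) \<in> parcs K then 0 < W (x (\<phi> u)) (x (\<phi> v)) else W (x (\<phi> u)) (x (\<phi> v)) < 1)"
    using assms(1) unfolding embeds_def by (elim exE conjE)
  show ?thesis
    unfolding embeds_def by (intro exI[of _ \<phi>] conjI \<phi>(1,3) subset_trans[OF \<phi>(2) assms(2)])
qed

lemma embeds_clique: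
  assumes "finite T" "card S \<le> card T" "finite S" "Defs.clique K S"
    and "\<And>u v. u \<in> T \<Longrightarrow> v \<in> T \<Longrightarrow> u \<noteq> v \<Longrightarrow> 0 < W (x u) (x v)"
  shows "embeds W x K S T"
proof -
  obtain \<phi> where \<phi>: "\<phi> ` S \<subseteq> T" "inj_on \<phi> S" using card_le_inj[OF assms(3,1,2)] by blast
  then have "0 < W (x (\<phi> u)) (x (\<phi> v))" if "u \<in> S" "v \<in> S" "u \<noteq> v" for u v
    using that assms(5)[of "\<phi> u" "\<phi> v"] by (auto dest: inj_onD)
  then show ?thesis unfolding embeds_def using \<phi> assms(4) by (intro exI[of _ \<phi>]) (auto simp: Defs.clique_def)
qed

lemma embeds_independent:
  assumes "finite T" "card S \<le> card T" "finite S" "independent K S"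
    and "\<And>u v. u \<in> T \<Longrightarrow> v \<in> T \<Longrightarrow> u \<noteq> v \<Longrightarrow> W (x u) (x v) < 1"
  shows "embeds W x K S T"
proof -
  obtain \<phi> where \<phi>: "\<phi> ` S \<subseteq> T" "inj_on \<phi> S" using card_le_inj[OF assms(3,1,2)] by blast
  then have "W (x (\<phi> u)) (x (\<phi> v)) < 1" if "u \<in> S" "v \<in> S" "u \<noteq> v" for u v
    using that assms(5)[of "\<phi> u" "\<phi> v"] by (auto dest: inj_onD)
  then show ?thesis unfolding embeds_def using \<phi> assms(4) by (intro exI[of _ \<phi>]) (auto simp: independent_def)
qed

lemma generic_embed_parts:
  assumes P: "hereditary P" and gen: "generic P W V x" and W: "graphon W"
    and x: "x \<in> space (PiM V (\<lambda>_. unit_measure))" and V: "finite V" and K: "pair_graph K"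
    and cross: "\<And>u v. u \<in> V \<Longrightarrow> v \<in> V \<Longrightarrow> b u \<noteq> b v \<Longrightarrow> 0 < W (x u) (x v) \<and> W (x u) (x v) < 1"
    and parts: "\<And>i. i \<in> col ` pverts K \<Longrightarrow> embeds W x K {u \<in> pverts K. col u = i} {v \<in> V. b v = i}"
  shows "belongs_to K P"
proof -
  have "\<forall>i\<in>col ` pverts K. \<exists>\<phi>. inj_on \<phi> {u \<in> pverts K. col u = i} \<and>
      \<phi> ` {u \<in> pverts K. col u = i} \<subseteq> {v \<in> V. b v = i} \<and>
      (\<forall>u\<in>{u \<in> pverts K. col u = i}. \<forall>v\<in>{u \<in> pverts K. col u = i}. u \<noteq> v \<longrightarrow>
       (if (u, v) \<in> parcs K then 0 < W (x (\<phi> u)) (x (\<phi> v)) else W (x (\<phi> u)) (x (\<phi> v)) < 1))"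
    by (intro ballI parts[unfolded embeds_def])
  from bchoice[OF this] obtain \<phi> where "\<forall>i\<in>col ` pverts K. inj_on (\<phi> i) {u \<in> pverts K. col u = i} \<and>
      \<phi> i ` {u \<in> pverts K. col u = i} \<subseteq> {v \<in> V. b v = i} \<and>
      (\<forall>u\<in>{u \<in> pverts K. col u = i}. \<forall>v\<in>{u \<in> pverts K. col u = i}. u \<noteq> v \<longrightarrow>
       (if (u, v) \<in> parcs K then 0 < W (x (\<phi> i u)) (x (\<phi> i v)) else W (x (\<phi> i u)) (x (\<phi> i v)) < 1))"
    by (elim exE)
  then have \<phi>: "\<And>i. i \<in> col ` pverts K \<Longrightarrow> inj_on (\<phi> i) {u \<in> pverts K. col u = i} \<and>
      \<phi> i ` {u \<in> pverts K. col u = i} \<subseteq> {v \<in> V. b v = i} \<and>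
      (\<forall>u\<in>{u \<in> pverts K. col u = i}. \<forall>v\<in>{u \<in> pverts K. col u = i}. u \<noteq> v \<longrightarrow>
       (if (u, v) \<in> parcs K then 0 < W (x (\<phi> i u)) (x (\<phi> i v)) else W (x (\<phi> i u)) (x (\<phi> i v)) < 1))"
    by (rule bspec)
  define \<psi> where "\<psi> u = \<phi> (col u) u" for u
  have \<psi>: "\<psi> u \<in> V" "b (\<psi> u) = col u" if "u \<in> pverts K" for u
    using \<phi>[of "col u"] that by (auto simp: \<psi>_def)
  have same: "\<psi> u \<noteq> \<psi> v \<and> (if (u, v) \<in> parcs K then 0 < W (x (\<psi> u)) (x (\<psi> v)) else W (x (\<psi> u)) (x (\<psi> v)) < 1)"
    if "u \<in> pverts K" "v \<in> pverts K" "u \<noteq> v" "col u = col v" for u v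
  proof -
    have i: "inj_on (\<phi> (col u)) {w \<in> pverts K. col w = col u}"
      and e: "\<forall>w\<in>{w \<in> pverts K. col w = col u}. \<forall>v\<in>{w \<in> pverts K. col w = col u}. w \<noteq> v \<longrightarrow>
       (if (w, v) \<in> parcs K then 0 < W (x (\<phi> (col u) w)) (x (\<phi> (col u) v)) else W (x (\<phi> (col u) w)) (x (\<phi> (col u) v)) < 1)"
      using \<phi>[of "col u"] that(1) by auto
    have "\<psi> u \<noteq> \<psi> v" using inj_onD[OF i, of u v] that by (auto simp: \<psi>_def)
    moreover have "if (u, v) \<in> parcs K then 0 < W (x (\<psi> u)) (x (\<psi> v)) else W (x (\<psi> u)) (x (\<psi> v)) < 1"
      using e[rule_format, of u v] that(1-3) that(4)[symmetric] by (simp add: \<psi>_def)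
    ultimately show ?thesis ..
  qed
  have diff: "\<psi> u \<noteq> \<psi> v \<and> 0 < W (x (\<psi> u)) (x (\<psi> v)) \<and> W (x (\<psi> u)) (x (\<psi> v)) < 1"
    if "u \<in> pverts K" "v \<in> pverts K" "col u \<noteq> col v" for u v
    using cross[of "\<psi> u" "\<psi> v"] \<psi>[OF that(1)] \<psi>[OF that(2)] that(3) by metis
  show ?thesis
  proof (rule generic_embed[OF P gen W x V K])
    show "inj_on \<psi> (pverts K)" using same diff by (intro inj_onI) blast
    show "\<psi> ` pverts K \<subseteq> V" using \<psi> by auto
    show "compat W K (x \<circ> \<psi>)"
      unfolding compat_def comp_apply
    proof (intro ballI impI)
      fix u v assume uv: "u \<in> pverts K" "v \<in> pverts K" "u \<noteq> v"
      show "if (u, v) \<in> parcs K then 0 < W (x (\<psi> u)) (x (\<psi> v)) else W (x (\<psi> u)) (x (\<psi> v)) < 1"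
        using same[OF uv] diff[OF uv(1,2)] by (cases "col u = col v") auto
    qed
  qed
qed

text \<open>Ramsey's theorem for the graph of the pairs with w > 0, whose non-edges satisfy w \<le>
  0 < 1. Weights strictly between 0 and 1 suit both alternatives, so these do not exclude each
  other.\<close>

lemma ramsey_weights:
  "\<exists>N\<ge>1. \<forall>(w :: nat \<Rightarrow> nat \<Rightarrow> real) V. finite V \<and> card V \<ge> N \<and> (\<forall>u\<in>V. \<forall>v\<in>V. w u v = w v u) \<longrightarrow>
    (\<exists>T\<subseteq>V. card T = n \<and> ((\<forall>u\<in>T. \<forall>v\<in>T. u \<noteq> v \<longrightarrow> 0 < w u v) \<or> (\<forall>u\<in>T. \<forall>v\<in>T. u \<noteq> v \<longrightarrow> w u v < 1)))"
proof -
  obtain N where N: "N \<ge> 1" "\<And>(V :: nat set) E. finite V \<and> N \<le> card V \<Longrightarrow>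
      \<exists>T\<subseteq>V. card T = n \<and> Ramsey.clique T E \<or> card T = n \<and> indep T E"
    using ramsey2[of n n] by metis
  show ?thesis
  proof (intro exI[of _ N] conjI N(1) allI impI)
    fix w :: "nat \<Rightarrow> nat \<Rightarrow> real" and V :: "nat set"
    assume *: "finite V \<and> card V \<ge> N \<and> (\<forall>u\<in>V. \<forall>v\<in>V. w u v = w v u)"
    let ?E = "{{u, v} | u v. u \<in> V \<and> v \<in> V \<and> 0 < w u v}"
    have E: "{u, v} \<in> ?E \<longleftrightarrow> 0 < w u v" if "u \<in> V" "v \<in> V" for u v
    proof
      assume "{u, v} \<in> ?E"
      then obtain a b where "{u, v} = {a, b}" "0 < w a b" by blast
      then have "u = a \<and> v = b \<or> u = b \<and> v = a" by (simp add: doubleton_eq_iff)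
      then show "0 < w u v" using \<open>0 < w a b\<close> * that by metis
    qed (use that in blast)
    obtain T where T: "T \<subseteq> V" "card T = n" "Ramsey.clique T ?E \<or> indep T ?E"
      using N(2)[of V ?E] * by blast
    have TV: "u \<in> V" if "u \<in> T" for u using T that by auto
    show "\<exists>T\<subseteq>V. card T = n \<and> ((\<forall>u\<in>T. \<forall>v\<in>T. u \<noteq> v \<longrightarrow> 0 < w u v) \<or> (\<forall>u\<in>T. \<forall>v\<in>T. u \<noteq> v \<longrightarrow> w u v < 1))"
    proof (intro exI[of _ T] conjI T(1,2))
      show "(\<forall>u\<in>T. \<forall>v\<in>T. u \<noteq> v \<longrightarrow> 0 < w u v) \<or> (\<forall>u\<in>T. \<forall>v\<in>T. u \<noteq> v \<longrightarrow> w u v < 1)"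
        using T(3)
      proof
        assume "Ramsey.clique T ?E"
        then have "{u, v} \<in> ?E" if "u \<in> T" "v \<in> T" "u \<noteq> v" for u v using that unfolding Ramsey.clique_def by blast
        then have "0 < w u v" if "u \<in> T" "v \<in> T" "u \<noteq> v" for u v using that E TV by blast
        then show ?thesis by blast
      next
        assume "indep T ?E"
        then have "{u, v} \<notin> ?E" if "u \<in> T" "v \<in> T" "u \<noteq> v" for u v using that unfolding indep_def by blast
        then have "\<not> 0 < w u v" if "u \<in> T" "v \<in> T" "u \<noteq> v" for u v using that E TV by blast
        then have "w u v < 1" if "u \<in> T" "v \<in> T" "u \<noteq> v" for u v using that by fastforce
        then show ?thesis by blast
      qed
    qed
  qed
qed

section \<open>A positive density of fractional cliques forces some C(r, s) into P\<close>

abbreviation fractional :: "(real \<Rightarrow> real \<Rightarrow> real) \<Rightarrow> real \<Rightarrow> real \<Rightarrow> bool" where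
  "fractional W x y \<equiv> 0 < W x y \<and> W x y < 1"

lemma pred_graphon:
  assumes "graphon W" "Measurable.pred borel Q"
  shows "Measurable.pred (unit_measure \<Otimes>\<^sub>M unit_measure) (\<lambda>p. Q (W (fst p) (snd p)))"
proof -
  have "(\<lambda>p. W (fst p) (snd p)) \<in> borel_measurable (unit_measure \<Otimes>\<^sub>M unit_measure)"
    using assms(1) by (simp add: graphon_def split_beta')
  from measurable_compose[OF this assms(2)] show ?thesis .
qed

lemma measurable_graph_fractional:
  assumes W: "graphon W"
  shows "measurable_graph unit_measure (fractional W)"
proof
  fix x y assume "x \<in> space unit_measure" "y \<in> space unit_measure"
  then show "fractional W x y = fractional W y x" using W by (simp add: graphon_def)
next
  show "Measurable.pred (unit_measure \<Otimes>\<^sub>M unit_measure) (\<lambda>p. fractional W (fst p) (snd p))"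
    by (rule pred_graphon[OF W, of "\<lambda>a. 0 < a \<and> a < 1"]) measurable
qed

lemma residue_class_card:
  assumes "j < r"
  shows "N \<le> card {v \<in> {..<r * N}. v mod r = (j :: nat)}"
proof -
  have "card ((\<lambda>i. j + r * i) ` {..<N}) \<le> card {v \<in> {..<r * N}. v mod r = j}"
  proof (rule card_mono)
    show "(\<lambda>i. j + r * i) ` {..<N} \<subseteq> {v \<in> {..<r * N}. v mod r = j}"
    proof clarsimp
      fix i assume "i < N"
      have "j + r * i < r * Suc i" using assms by simp
      also have "\<dots> \<le> r * N" using \<open>i < N\<close> by (intro mult_le_mono2) simp
      finally show "j + r * i < r * N \<and> j mod r = j" using assms by simp
    qed
  qed simp
  moreover have "inj_on (\<lambda>i. j + r * i) {..<N}" using assms by (auto simp: inj_on_def)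
  ultimately show ?thesis by (simp add: card_image)
qed

text \<open>The clique is blown up to N points of each color. Within a color, Ramsey's theorem
  selects n points that can pairwise be made adjacent or can pairwise be made non-adjacent. The
  number of colors of the first kind is s, and a graph of the class with at most n vertices fits
  into the selected points.\<close>

lemma bounded_colorable_subset:
  assumes P: "hereditary P" and gen: "\<And>V. finite V \<Longrightarrow> AE x in PiM V (\<lambda>_. unit_measure). generic P W V x" and W: "graphon W"
    and pos: "\<not> (AE x in PiM {..<r} (\<lambda>_. unit_measure). \<not> measurable_graph.clique_in (fractional W) {0..1} {..<r} x)"
    and r: "r > 0"
  shows "\<exists>s\<le>r. \<forall>G\<in>colorable_class r s. card (pverts G) \<le> n \<longrightarrow> G \<in> P"
proof -
  interpret measurable_graph unit_measure "fractional W" by (rule measurable_graph_fractional[OF W])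
  obtain N where N: "N \<ge> 1" and ramsey: "\<forall>(w :: nat \<Rightarrow> nat \<Rightarrow> real) V. finite V \<and> card V \<ge> N \<and>
      (\<forall>u\<in>V. \<forall>v\<in>V. w u v = w v u) \<longrightarrow>
      (\<exists>T\<subseteq>V. card T = n \<and> ((\<forall>u\<in>T. \<forall>v\<in>T. u \<noteq> v \<longrightarrow> 0 < w u v) \<or> (\<forall>u\<in>T. \<forall>v\<in>T. u \<noteq> v \<longrightarrow> w u v < 1)))"
    using ramsey_weights[of n] by (elim exE conjE)
  let ?V = "{..<r * N}"
  have "r \<le> r * N" using mult_le_mono2[OF N, of r] by simp
  then have "{..<r} \<subseteq> ?V" by (simp only: lessThan_subset_iff)
  then have V: "{..<r} \<union> (?V - {..<r}) = ?V" by (simp only: Un_Diff_cancel Un_absorb1)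
  have "\<not> (AE x in PiM ?V (\<lambda>_. unit_measure). \<not> (\<forall>u\<in>?V. \<forall>v\<in>?V. u mod r \<noteq> v mod r \<longrightarrow> fractional W (x u) (x v)))"
  proof (rule clique_blowup[of "{..<r}" "?V - {..<r}" "\<lambda>v. v mod r", unfolded V])
    show "\<not> (AE x in PiM {..<r} (\<lambda>_. unit_measure). \<not> clique_in (space unit_measure) {..<r} x)"
      using pos by (simp only: space_unit_measure not_False_eq_True)
  qed (use r in auto)
  then have "\<exists>x\<in>space (PiM ?V (\<lambda>_. unit_measure)). generic P W ?V x \<and>
      (\<forall>u\<in>?V. \<forall>v\<in>?V. u mod r \<noteq> v mod r \<longrightarrow> fractional W (x u) (x v))"
  proof (rule contrapos_np)
    assume *: "\<not> (\<exists>x\<in>space (PiM ?V (\<lambda>_. unit_measure)). generic P W ?V x \<and>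
      (\<forall>u\<in>?V. \<forall>v\<in>?V. u mod r \<noteq> v mod r \<longrightarrow> fractional W (x u) (x v)))"
    show "AE x in PiM ?V (\<lambda>_. unit_measure). \<not> (\<forall>u\<in>?V. \<forall>v\<in>?V. u mod r \<noteq> v mod r \<longrightarrow> fractional W (x u) (x v))"
      by (rule AE_mp[OF gen[of ?V] AE_I2]) (use * in auto)
  qed
  then obtain x where x: "x \<in> space (PiM ?V (\<lambda>_. unit_measure))" "generic P W ?V x"
    and cross: "\<And>u v. u \<in> ?V \<Longrightarrow> v \<in> ?V \<Longrightarrow> u mod r \<noteq> v mod r \<Longrightarrow> fractional W (x u) (x v)"
    by blast
  have sym: "W (x u) (x v) = W (x v) (x u)" if "u \<in> ?V" "v \<in> ?V" for u v
    using that x(1) W by (auto simp: space_PiM graphon_def PiE_iff)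
  let ?homog = "\<lambda>T. (\<forall>u\<in>T. \<forall>v\<in>T. u \<noteq> v \<longrightarrow> 0 < W (x u) (x v)) \<or> (\<forall>u\<in>T. \<forall>v\<in>T. u \<noteq> v \<longrightarrow> W (x u) (x v) < 1)"
  have "\<forall>j\<in>{..<r}. \<exists>T. T \<subseteq> {v \<in> ?V. v mod r = j} \<and> card T = n \<and> ?homog T"
  proof
    fix j assume "j \<in> {..<r}"
    then have "N \<le> card {v \<in> ?V. v mod r = j}" by (intro residue_class_card) simp
    then show "\<exists>T. T \<subseteq> {v \<in> ?V. v mod r = j} \<and> card T = n \<and> ?homog T"
      using sym by (intro ramsey[rule_format, of _ "\<lambda>u v. W (x u) (x v)"]) auto
  qed
  from bchoice[OF this] obtain T where "\<forall>j\<in>{..<r}. T j \<subseteq> {v \<in> ?V. v mod r = j} \<and> card (T j) = n \<and> ?homog (T j)"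
    by (elim exE)
  then have T: "T j \<subseteq> {v \<in> ?V. v mod r = j}" "card (T j) = n" "?homog (T j)" if "j < r" for j
    using that by simp_all
  have fT: "finite (T j)" if "j < r" for j using T(1)[OF that] by (rule finite_subset) simp
  define C where "C = {j\<in>{..<r}. \<forall>u\<in>T j. \<forall>v\<in>T j. u \<noteq> v \<longrightarrow> 0 < W (x u) (x v)}"
  define s where "s = card C"
  have C: "finite C" "C \<subseteq> {..<r}" by (auto simp: C_def)
  have s: "s \<le> r" using card_mono[OF _ C(2)] by (simp add: s_def)
  \<comment> \<open>The colors are renumbered so that those of clique type come first, as
    \<open>colorable_class\<close> requires.\<close>
  obtain \<sigma>1 where \<sigma>1: "bij_betw \<sigma>1 {1..s} C"
    using finite_same_card_bij[of "{1..s}" C] C by (auto simp: s_def)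
  obtain \<sigma>2 where \<sigma>2: "bij_betw \<sigma>2 {s<..r} ({..<r} - C)"
    using finite_same_card_bij[of "{s<..r}" "{..<r} - C"] C by (auto simp: s_def card_Diff_subset)
  define \<sigma> where "\<sigma> i = (if i \<in> {1..s} then \<sigma>1 i else \<sigma>2 i)" for i
  have \<sigma>C: "\<sigma> i \<in> C" if "i \<in> {1..s}" for i using that \<sigma>1 by (auto simp: \<sigma>_def bij_betw_def)
  have \<sigma>D: "\<sigma> i \<in> {..<r} - C" if "i \<in> {s<..r}" for i using that \<sigma>2 by (auto simp: \<sigma>_def bij_betw_def)
  have split: "k \<in> {1..s} \<or> k \<in> {s<..r}" if "k \<in> {1..r}" for k using that by auto
  have \<sigma>_inj: "i = j" if ij: "i \<in> {1..r}" "j \<in> {1..r}" "\<sigma> i = \<sigma> j" for i j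
  proof -
    consider "i \<in> {1..s}" "j \<in> {1..s}" | "i \<in> {s<..r}" "j \<in> {s<..r}" | "i \<in> {1..s}" "j \<in> {s<..r}" | "i \<in> {s<..r}" "j \<in> {1..s}"
      using split[OF ij(1)] split[OF ij(2)] by blast
    then show ?thesis
    proof cases
      case 1
      then show ?thesis using ij(3) \<sigma>1 by (auto simp: \<sigma>_def bij_betw_def dest: inj_onD)
    next
      case 2
      then show ?thesis using ij(3) \<sigma>2 by (auto simp: \<sigma>_def bij_betw_def dest: inj_onD)
    next
      case 3
      then show ?thesis using ij(3) \<sigma>C[of i] \<sigma>D[of j] by auto
    next
      case 4
      then show ?thesis using ij(3) \<sigma>C[of j] \<sigma>D[of i] by auto
    qed
  qed
  show ?thesis
  proof (intro exI[of _ s] conjI s ballI impI)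
    fix G assume "G \<in> colorable_class r s" and n: "card (pverts G) \<le> n"
    then obtain A :: "nat \<Rightarrow> nat set" where G: "pair_graph G" and A: "disjoint_family_on A {1..r}" "(\<Union>i\<in>{1..r}. A i) = pverts G"
        "\<forall>i\<in>{1..s}. Defs.clique G (A i)" "\<forall>i\<in>{s<..r}. independent G (A i)"
      unfolding colorable_class_def mem_Collect_eq by (elim exE conjE)
    have fG: "finite (pverts G)" by (rule pair_graph_finite[OF G])
    define idx where "idx u = (SOME i. i \<in> {1..r} \<and> u \<in> A i)" for u
    have idx: "idx u \<in> {1..r}" "u \<in> A (idx u)" if "u \<in> pverts G" for u
    proof -
      have "\<exists>i. i \<in> {1..r} \<and> u \<in> A i" using that A(2) by blast
      from someI_ex[OF this] show "idx u \<in> {1..r}" "u \<in> A (idx u)" unfolding idx_def by auto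
    qed
    have "belongs_to G P"
    proof (rule generic_embed_parts[OF P x(2) W x(1) _ G, of "\<lambda>v. v mod r" "\<lambda>u. \<sigma> (idx u)"])
      fix k assume "k \<in> (\<lambda>u. \<sigma> (idx u)) ` pverts G"
      then obtain u0 where u0: "u0 \<in> pverts G" "k = \<sigma> (idx u0)" by auto
      let ?i = "idx u0" and ?S = "{u \<in> pverts G. \<sigma> (idx u) = k}"
      have i: "?i \<in> {1..r}" by (rule idx[OF u0(1)])
      have SA: "?S \<subseteq> A ?i"
      proof
        fix u assume u: "u \<in> ?S"
        then have "idx u = ?i" using \<sigma>_inj idx(1) i u0 by blast
        then show "u \<in> A ?i" using idx(2)[of u] u by auto
      qed
      have cS: "card ?S \<le> n" using card_mono[OF fG, of ?S] n by auto
      have fS: "finite ?S" using fG by auto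
      show "embeds W x G ?S {v \<in> ?V. v mod r = k}"
      proof (cases "?i \<in> {1..s}")
        case True
        then have k: "k \<in> C" using \<sigma>C u0 by simp
        then have kr: "k < r" using C by auto
        have "Defs.clique G ?S" using bspec[OF A(3) True] SA unfolding Defs.clique_def by blast
        then have "embeds W x G ?S (T k)"
          using k fT[OF kr] T(2)[OF kr] cS fS by (intro embeds_clique) (auto simp: C_def)
        then show ?thesis using T(1)[OF kr] by (rule embeds_mono)
      next
        case False
        then have i': "?i \<in> {s<..r}" using split[OF i] by blast
        then have k: "k \<in> {..<r} - C" using \<sigma>D u0 by simp
        then have kr: "k < r" by auto
        have ind: "\<forall>u\<in>T k. \<forall>v\<in>T k. u \<noteq> v \<longrightarrow> W (x u) (x v) < 1" using T(3)[OF kr] k by (auto simp: C_def)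
        have "independent G ?S" using bspec[OF A(4) i'] SA unfolding independent_def by blast
        then have "embeds W x G ?S (T k)"
          using ind fT[OF kr] T(2)[OF kr] cS fS by (intro embeds_independent) auto
        then show ?thesis using T(1)[OF kr] by (rule embeds_mono)
      qed
    qed (use cross in auto)
    then show "G \<in> P" using belongs_to_iff[OF P] by blast
  qed
qed

text \<open>The s found for graphs of bounded size may depend on the bound. If no s worked for all
  sizes, each would have a counterexample, and a bound above the sizes of these finitely many graphs
  contradicts \<open>bounded_colorable_subset\<close>.\<close>

theorem colorable_subset:
  assumes P: "hereditary P" and gen: "\<And>V. finite V \<Longrightarrow> AE x in PiM V (\<lambda>_. unit_measure). generic P W V x" and W: "graphon W"
    and pos: "\<not> (AE x in PiM {..<r} (\<lambda>_. unit_measure). \<not> measurable_graph.clique_in (fractional W) {0..1} {..<r} x)"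
    and r: "r > 0"
  shows "\<exists>s\<le>r. colorable_class r s \<subseteq> P"
proof (rule ccontr)
  assume "\<not> ?thesis"
  then have "\<forall>s\<in>{..r}. \<exists>G. G \<in> colorable_class r s \<and> G \<notin> P" by auto
  from bchoice[OF this] obtain G where "\<forall>s\<in>{..r}. G s \<in> colorable_class r s \<and> G s \<notin> P"
    by (elim exE)
  then have G: "G s \<in> colorable_class r s" "G s \<notin> P" if "s \<le> r" for s using that by simp_all
  define n where "n = Max ((\<lambda>s. card (pverts (G s))) ` {..r})"
  have n: "card (pverts (G s)) \<le> n" if "s \<le> r" for s
    unfolding n_def by (rule Max_ge) (use that in auto)
  have "\<exists>s\<le>r. \<forall>G\<in>colorable_class r s. card (pverts G) \<le> n \<longrightarrow> G \<in> P"
    by (rule bounded_colorable_subset[OF P _ W pos r]) (rule gen)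
  then obtain s where s: "s \<le> r" "\<forall>G\<in>colorable_class r s. card (pverts G) \<le> n \<longrightarrow> G \<in> P"
    by (elim exE conjE)
  then show False using G[OF s(1)] n[OF s(1)] by simp
qed

text \<open>One application of \<open>positive_extend\<close> for each of the free points: a special
  configuration on V0 can be accompanied by any number of points in prescribed non-null
  sets.\<close>

lemma (in prob_space) positive_points:
  assumes V: "finite V0" "finite V1" "V0 \<inter> V1 = {}"
    and Q: "Measurable.pred (PiM V0 (\<lambda>_. M)) Q" and pos: "\<not> (AE x in PiM V0 (\<lambda>_. M). \<not> Q x)"
    and D: "\<And>v. v \<in> V1 \<Longrightarrow> D v \<in> sets M" "\<And>v. v \<in> V1 \<Longrightarrow> emeasure M (D v) \<noteq> 0"
  shows "\<not> (AE x in PiM (V0 \<union> V1) (\<lambda>_. M). \<not> (Q (restrict x V0) \<and> (\<forall>v\<in>V1. x v \<in> D v)))"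
  using V(2,3) D
proof (induction V1 rule: finite_induct)
  case empty
  show ?case
  proof
    assume "AE x in PiM (V0 \<union> {}) (\<lambda>_. M). \<not> (Q (restrict x V0) \<and> (\<forall>v\<in>{}. x v \<in> D v))"
    then have "AE x in PiM V0 (\<lambda>_. M). \<not> (Q (restrict x V0) \<and> (\<forall>v\<in>{}. x v \<in> D v))"
      unfolding Un_empty_right .
    then have "AE x in PiM V0 (\<lambda>_. M). \<not> Q x"
    proof (rule AE_mp[OF _ AE_I2], intro impI)
      fix x assume x: "x \<in> space (PiM V0 (\<lambda>_. M))" and n: "\<not> (Q (restrict x V0) \<and> (\<forall>v\<in>{}. x v \<in> D v))"
      have "restrict x V0 = x" using x by (auto simp: space_PiM fun_eq_iff PiE_def extensional_def)
      with n show "\<not> Q x" by simp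
    qed
    with pos show False ..
  qed
next
  case (insert w V1)
  let ?V = "V0 \<union> V1"
  let ?Q = "\<lambda>V1 x. Q (restrict x V0) \<and> (\<forall>v\<in>V1. x v \<in> D v)"
  have w: "finite ?V" "w \<notin> ?V" using insert V by auto
  have "Measurable.pred (PiM ?V (\<lambda>_. M)) (\<lambda>x. x v \<in> D v)" if "v \<in> V1" for v
  proof -
    have [measurable]: "D v \<in> sets M" using insert.prems(2) that by simp
    show ?thesis using that by (intro pred_component[of "\<lambda>a. a \<in> D v"]) auto
  qed
  then have Q': "Measurable.pred (PiM ?V (\<lambda>_. M)) (?Q V1)"
    by (intro pred_intros_logic pred_intros_finite insert.hyps pred_restrict[OF Q]) auto
  have "\<not> (AE x in PiM ?V (\<lambda>_. M). \<not> ?Q V1 x)"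
    by (rule insert.IH) (use insert.prems in auto)
  from positive_extend[OF w Q' this, of "D w"] insert.prems
  have pos': "\<not> (AE x in PiM (insert w ?V) (\<lambda>_. M). \<not> (?Q V1 (restrict x ?V) \<and> x w \<in> D w))" by simp
  show ?case
  proof
    assume "AE x in PiM (V0 \<union> insert w V1) (\<lambda>_. M). \<not> ?Q (insert w V1) x"
    then have "AE x in PiM (insert w ?V) (\<lambda>_. M). \<not> ?Q (insert w V1) x"
      unfolding Un_insert_right .
    then have "AE x in PiM (insert w ?V) (\<lambda>_. M). \<not> (?Q V1 (restrict x ?V) \<and> x w \<in> D w)"
      by (rule eventually_mono) (auto simp: restrict_restrict Int_absorb1 Int_absorb2 Un_Int_distrib2)
    with pos' show False ..
  qed
qed

lemma (in prob_space) AE_PiM_tripleD: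
  assumes T: "Measurable.pred (M \<Otimes>\<^sub>M M \<Otimes>\<^sub>M M) (\<lambda>q. T (fst q) (fst (snd q)) (snd (snd q)))"
    and ae: "AE x in PiM {0, 1, 2 :: nat} (\<lambda>_. M). T (x 0) (x 1) (x 2)"
  shows "AE a in M. AE b in M. AE c in M. T a b c"
proof -
  have 3: "Measurable.pred (PiM {0, 1, 2 :: nat} (\<lambda>_. M)) (\<lambda>x. T (x 0) (x 1) (x 2))"
  proof -
    have "(\<lambda>x. (x 0, x 1, x 2)) \<in> measurable (PiM {0, 1, 2 :: nat} (\<lambda>_. M)) (M \<Otimes>\<^sub>M M \<Otimes>\<^sub>M M)"
      by measurable
    from measurable_compose[OF this T] show ?thesis by simp
  qed
  have "AE a in M. AE x in PiM {1, 2 :: nat} (\<lambda>_. M). T a (x 1) (x 2)"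
    using ae by (subst (asm) AE_PiM_insert_rev) (use 3 in auto)
  then show ?thesis
  proof (rule AE_mp[OF _ AE_I2], intro impI)
    fix a assume a: "a \<in> space M" and ae2: "AE x in PiM {1, 2 :: nat} (\<lambda>_. M). T a (x 1) (x 2)"
    have 2: "Measurable.pred (PiM {1, 2 :: nat} (\<lambda>_. M)) (\<lambda>x. T a (x 1) (x 2))"
    proof -
      have "(\<lambda>x. (a, x 1, x 2)) \<in> measurable (PiM {1, 2 :: nat} (\<lambda>_. M)) (M \<Otimes>\<^sub>M M \<Otimes>\<^sub>M M)"
        using a by measurable
      from measurable_compose[OF this T] show ?thesis by simp
    qed
    have "AE b in M. AE x in PiM {2 :: nat} (\<lambda>_. M). T a b (x 2)"
      using ae2 by (subst (asm) AE_PiM_insert_rev) (use 2 in auto)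
    then show "AE b in M. AE c in M. T a b c"
    proof (rule AE_mp[OF _ AE_I2], intro impI)
      fix b assume b: "b \<in> space M" and ae1: "AE x in PiM {2 :: nat} (\<lambda>_. M). T a b (x 2)"
      have 1: "Measurable.pred (PiM {2 :: nat} (\<lambda>_. M)) (\<lambda>x. T a b (x 2))"
      proof -
        have "(\<lambda>x. (a, b, x 2)) \<in> measurable (PiM {2 :: nat} (\<lambda>_. M)) (M \<Otimes>\<^sub>M M \<Otimes>\<^sub>M M)"
          using a b by measurable
        from measurable_compose[OF this T] show ?thesis by simp
      qed
      have "AE x in PiM ({} :: nat set) (\<lambda>_. M). AE c in M. T a b c"
        using ae1 by (subst (asm) AE_PiM_insert) (use 1 in auto)
      then show "AE c in M. T a b c" unfolding PiM_empty AE_count_space by simp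
    qed
  qed
qed

section \<open>Colorings of the excluded graphs\<close>

lemma finite_small_subsets: "finite (small_subsets k)"
  by (rule finite_subset[of _ "Pow {1..k}"]) (auto simp: small_subsets_def)

lemma small_subsets_cases:
  assumes S: "S \<in> small_subsets k" and lt: "\<forall>x\<in>S. x < 4"
  shows "S = {1} \<or> S = {2} \<or> S = {3} \<or> S = {1, 2} \<or> S = {1, 3} \<or> S = {2, 3}"
proof -
  have "S \<subseteq> {1, 2, 3}"
  proof
    fix x assume "x \<in> S"
    then have "1 \<le> x" "x < 4" using S lt by (auto simp: small_subsets_def)
    then show "x \<in> {1, 2, 3}" by auto
  qed
  then have "S \<in> Pow {1, 2, 3}" by simp
  moreover have "card S = 1 \<or> card S = 2" using S by (auto simp: small_subsets_def)
  ultimately show ?thesis by (auto simp: Pow_insert)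
qed

lemma small_subsets_Max:
  assumes S: "S \<in> small_subsets k" and x: "x \<in> S" "4 \<le> x"
  shows "Max S \<in> S" "4 \<le> Max S" "Max S \<le> k"
proof -
  have "finite S" "S \<noteq> {}" using S x by (auto simp: small_subsets_def intro: finite_subset)
  then show "Max S \<in> S" "4 \<le> Max S" using x Max_ge[of S x] by (auto intro: order_trans)
  then show "Max S \<le> k" using S by (auto simp: small_subsets_def)
qed

lemma pair_graph_G_graph: "pair_graph (G_graph k)"
  by (rule pair_graphI) (auto simp: G_graph_def finite_small_subsets)

lemma pair_graph_B_graph: "pair_graph (B_graph k)"
  by (rule pair_graphI) (auto simp: B_graph_def G_graph_def finite_small_subsets)

lemma parcs_G_graph_iff:
  "(S, T) \<in> parcs (G_graph k) \<longleftrightarrow> S \<in> small_subsets k \<and> T \<in> small_subsets k \<and> S \<noteq> T \<and> S \<inter> T \<noteq> {}"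
  by (simp only: G_graph_def pair_pre_digraph.select_convs mem_Collect_eq prod.case)

lemma parcs_H_graph_iff:
  "(S, T) \<in> parcs (H_graph k) \<longleftrightarrow> (S, T) \<in> parcs (G_graph k) \<and>
    \<not> (S \<in> {{1, 2}, {1, 3}, {2, 3}} \<and> T \<in> {{1, 2}, {1, 3}, {2, 3}})"
  by (simp only: H_graph_def pair_pre_digraph.select_convs Diff_iff mem_Sigma_iff)

lemma pair_graph_H_graph: "pair_graph (H_graph k)"
proof (rule pair_graphI)
  fix S T assume "(S, T) \<in> parcs (H_graph k)"
  moreover define X :: "nat set set" where "X = {{1, 2}, {1, 3}, {2, 3}}"
  moreover have "pverts (H_graph k) = small_subsets k" by (simp add: H_graph_def)
  ultimately show "S \<in> pverts (H_graph k) \<and> S \<noteq> T \<and> (T, S) \<in> parcs (H_graph k)"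
    unfolding parcs_H_graph_iff parcs_G_graph_iff X_def[symmetric] Int_commute[of T S] by metis
qed (simp add: H_graph_def finite_small_subsets)

text \<open>
  The sets with an element above 3 are colored by their maximum, so that each of the colors
  \<open>2, \<dots>, r - 1\<close> is a clique; the six sets within $\{1, 2, 3\}$ share the colors 0 and 1.
\<close>

definition top_color :: "(nat set \<Rightarrow> bool) \<Rightarrow> nat set \<Rightarrow> nat" where
  "top_color p S = (if \<exists>x\<in>S. 4 \<le> x then Max S - 2 else if p S then 1 else 0)"

lemma top_color_big:
  assumes S: "S \<in> small_subsets k" and big: "\<exists>x\<in>S. 4 \<le> x"
  shows "2 \<le> top_color p S" "top_color p S + 2 \<in> S" "top_color p S + 2 \<le> k"
proof -
  obtain x where "x \<in> S" "4 \<le> x" using big by (elim bexE)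
  note M = small_subsets_Max[OF S this]
  have "top_color p S = Max S - 2" unfolding top_color_def by (rule if_P[OF big])
  then have e: "top_color p S + 2 = Max S" using M(2) by linarith
  show "2 \<le> top_color p S" using e M(2) by linarith
  show "top_color p S + 2 \<in> S" "top_color p S + 2 \<le> k" unfolding e by (rule M)+
qed

lemma top_color_small:
  assumes S: "S \<in> small_subsets k" and lt: "top_color p S < 2"
  shows "S = {1} \<or> S = {2} \<or> S = {3} \<or> S = {1, 2} \<or> S = {1, 3} \<or> S = {2, 3}"
    "top_color p S = (if p S then 1 else 0)"
proof -
  have n: "\<not> (\<exists>x\<in>S. 4 \<le> x)"
  proof
    assume "\<exists>x\<in>S. 4 \<le> x"
    from top_color_big(1)[OF S this, of p] lt show False by linarith
  qed
  then have "\<forall>x\<in>S. x < 4" by (simp add: not_le)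
  then show "S = {1} \<or> S = {2} \<or> S = {3} \<or> S = {1, 2} \<or> S = {1, 3} \<or> S = {2, 3}"
    by (rule small_subsets_cases[OF S])
  show "top_color p S = (if p S then 1 else 0)"
    unfolding top_color_def by (rule if_not_P[OF n])
qed

lemma top_color_large:
  assumes S: "S \<in> small_subsets k" and ge: "2 \<le> top_color p S"
  shows "top_color p S + 2 \<in> S"
proof (rule top_color_big(2)[OF S], rule ccontr)
  assume "\<not> (\<exists>x\<in>S. 4 \<le> x)"
  then have "top_color p S = (if p S then 1 else 0)" unfolding top_color_def by (rule if_not_P)
  with ge show False by (simp split: if_splits)
qed

lemma top_color_less:
  assumes "2 \<le> r" "S \<in> small_subsets (r + 1)"
  shows "top_color p S < r"
proof (cases "\<exists>x\<in>S. 4 \<le> x")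
  case True
  from top_color_big(3)[OF assms(2) True, of p] show ?thesis by linarith
next
  case False
  then have "top_color p S = (if p S then 1 else 0)" unfolding top_color_def by (rule if_not_P)
  with assms(1) show ?thesis by (simp split: if_splits)
qed

lemma common_element: "x \<in> S \<Longrightarrow> x \<in> T \<Longrightarrow> S \<inter> T \<noteq> {}"
  by auto

lemma top_color_clique:
  assumes c: "1 \<le> c"
    and p: "\<And>S T. S \<in> small_subsets k \<Longrightarrow> T \<in> small_subsets k \<Longrightarrow> top_color p S = 1 \<Longrightarrow> top_color p T = 1 \<Longrightarrow> S \<inter> T \<noteq> {}"
  shows "Defs.clique (G_graph k) {S \<in> small_subsets k. top_color p S = c}"
  unfolding Defs.clique_def
proof (intro ballI impI)
  fix S T assume S: "S \<in> {S \<in> small_subsets k. top_color p S = c}" and T: "T \<in> {S \<in> small_subsets k. top_color p S = c}" and "S \<noteq> T"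
  have S': "S \<in> small_subsets k" "top_color p S = c" and T': "T \<in> small_subsets k" "top_color p T = c" using S T by simp_all
  have "S \<inter> T \<noteq> {}"
  proof (cases "c = 1")
    case True
    show ?thesis by (rule p) (simp_all only: S' T' True)
  next
    case False
    then have "2 \<le> c" using c by linarith
    then have "c + 2 \<in> S" "c + 2 \<in> T" using top_color_large[OF S'(1), of p] top_color_large[OF T'(1), of p] S'(2) T'(2) by simp_all
    then show ?thesis by (rule common_element)
  qed
  then show "(S, T) \<in> parcs (G_graph k)" using S' T' \<open>S \<noteq> T\<close> by (simp only: parcs_G_graph_iff simp_thms)
qed

text \<open>
  Color 0 consists of $\{2\}, \{3\}, \{2, 3\}$, an induced path, for \<open>path_color\<close>, and of three
  independent singletons for \<open>triple_color\<close>, while color 1 is a clique of $G_k$ for both. In $H_k$ the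
  six sets form a hexagon, which \<open>hexagon_color\<close> cuts into two halves, each an edge plus an isolated
  vertex; \<open>hexagon_side\<close> then separates each half into two disjoint cliques.
\<close>

abbreviation path_color :: "nat set \<Rightarrow> nat" where
  "path_color \<equiv> top_color (\<lambda>S. 1 \<in> S)"

abbreviation triple_color :: "nat set \<Rightarrow> nat" where
  "triple_color \<equiv> top_color (\<lambda>S. card S = 2)"

abbreviation hexagon_color :: "nat set \<Rightarrow> nat" where
  "hexagon_color \<equiv> top_color (\<lambda>S. S \<notin> {{1}, {1, 2}, {2, 3}})"

lemma top_color_eq_1:
  assumes "S \<in> small_subsets k" "top_color p S = 1"
  shows "p S"
proof (rule ccontr)
  assume n: "\<not> p S"
  have "top_color p S < 2" unfolding assms(2) by simp
  from top_color_small(2)[OF assms(1) this] have "top_color p S = 0" unfolding if_not_P[OF n] .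
  then show False unfolding assms(2) by simp
qed

lemma top_color_eq_0:
  assumes "S \<in> small_subsets k" "top_color p S = 0"
  shows "\<not> p S"
proof
  assume p: "p S"
  have "top_color p S < 2" unfolding assms(2) by (rule zero_less_numeral)
  from top_color_small(2)[OF assms(1) this] have "top_color p S = 1" unfolding if_P[OF p] .
  then show False unfolding assms(2) by simp
qed

lemma path_color_clique:
  assumes "1 \<le> c"
  shows "Defs.clique (G_graph k) {S \<in> small_subsets k. path_color S = c}"
proof (rule top_color_clique[OF assms])
  fix S T assume *: "S \<in> small_subsets k" "T \<in> small_subsets k" "path_color S = 1" "path_color T = 1"
  show "S \<inter> T \<noteq> {}"
    by (rule common_element[OF top_color_eq_1[OF *(1,3)] top_color_eq_1[OF *(2,4)]])
qed

lemma triple_color_clique: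
  assumes "1 \<le> c"
  shows "Defs.clique (G_graph k) {S \<in> small_subsets k. triple_color S = c}"
proof (rule top_color_clique[OF assms])
  fix S T assume *: "S \<in> small_subsets k" "T \<in> small_subsets k" "triple_color S = 1" "triple_color T = 1"
  have "U = {1, 2} \<or> U = {1, 3} \<or> U = {2, 3}" if U: "U \<in> small_subsets k" "triple_color U = 1" for U
  proof -
    have c: "card U = 2" by (rule top_color_eq_1[OF U])
    have lt: "triple_color U < 2" unfolding U(2) by simp
    show ?thesis using top_color_small(1)[OF U(1) lt] c by (elim disjE) simp_all
  qed
  from this[OF *(1,3)] this[OF *(2,4)] show "S \<inter> T \<noteq> {}" by (elim disjE) simp_all
qed

lemma path_color_0:
  assumes "S \<in> small_subsets k" "path_color S = 0"
  shows "S = {2} \<or> S = {3} \<or> S = {2, 3}"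
proof -
  have lt: "path_color S < 2" unfolding assms(2) by simp
  have "1 \<notin> S" by (rule top_color_eq_0[OF assms])
  then show ?thesis using top_color_small(1)[OF assms(1) lt] by (elim disjE) simp_all
qed

lemma triple_color_0:
  assumes "S \<in> small_subsets k" "triple_color S = 0"
  shows "S = {1} \<or> S = {2} \<or> S = {3}"
proof -
  have lt: "triple_color S < 2" unfolding assms(2) by simp
  have "card S \<noteq> 2" by (rule top_color_eq_0[OF assms])
  then show ?thesis using top_color_small(1)[OF assms(1) lt] by (elim disjE) simp_all
qed

definition hexagon_side :: "nat set \<Rightarrow> bool" where
  "hexagon_side S \<longleftrightarrow> S \<in> {{1}, {1, 2}, {3}, {1, 3}}"

lemma of_bool_not_inject: "(if \<not> p then 1 else 0 :: nat) = (if \<not> q then 1 else 0) \<Longrightarrow> p = q"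
  by (cases p; cases q) simp_all

text \<open>Two sets of a color c \<ge> 2 share the element c + 2 > 3, so no removed edge lies
  between them; below 2 the sides of a half hexagon decide. The right side has the shape of W in a
  block that splits into two cliques.\<close>

lemma hexagon_arc:
  assumes S: "S \<in> small_subsets k" and T: "T \<in> small_subsets k" and ne: "S \<noteq> T"
    and same: "hexagon_color S = hexagon_color T"
  shows "(S, T) \<in> parcs (H_graph k) \<longleftrightarrow> 2 \<le> hexagon_color S \<or> hexagon_side S = hexagon_side T"
proof -
  have arc: "(S, T) \<in> parcs (H_graph k) \<longleftrightarrow> S \<inter> T \<noteq> {} \<and> \<not> (S \<in> {{1, 2}, {1, 3}, {2, 3}} \<and> T \<in> {{1, 2}, {1, 3}, {2, 3}})"
    unfolding parcs_H_graph_iff parcs_G_graph_iff using S T ne by (simp only: simp_thms)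
  show ?thesis
  proof (cases "2 \<le> hexagon_color S")
    case True
    let ?c = "hexagon_color S + 2"
    have c: "?c \<in> S" "?c \<in> T"
      by (rule top_color_large[OF S True], rule top_color_large[OF T, of "\<lambda>S. S \<notin> {{1}, {1, 2}, {2, 3}}", folded same, OF True])
    then have "S \<inter> T \<noteq> {}" by (rule common_element)
    moreover have "S \<notin> {{1, 2}, {1, 3}, {2, 3}}"
    proof
      assume S3: "S \<in> {{1, 2}, {1, 3}, {2, 3}}"
      obtain d where "d \<in> S" "4 \<le> d" using c(1) True by (intro that[of ?c]) simp_all
      with S3 show False by (elim insertE emptyE) simp_all
    qed
    ultimately show ?thesis unfolding arc using True by simp
  next
    case False
    then have lt: "hexagon_color S < 2" "hexagon_color T < 2" using same by simp_all
    have "(if S \<notin> {{1}, {1, 2}, {2, 3}} then 1 else 0 :: nat) = (if T \<notin> {{1}, {1, 2}, {2, 3}} then 1 else 0)"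
      by (rule trans[OF top_color_small(2)[OF S lt(1), symmetric] trans[OF same top_color_small(2)[OF T lt(2)]]])
    then have iff: "S \<in> {{1}, {1, 2}, {2, 3}} \<longleftrightarrow> T \<in> {{1}, {1, 2}, {2, 3}}" by (rule of_bool_not_inject)
    have goal: "S \<inter> T \<noteq> {} \<and> \<not> (S \<in> {{1, 2}, {1, 3}, {2, 3}} \<and> T \<in> {{1, 2}, {1, 3}, {2, 3}}) \<longleftrightarrow>
        S \<in> {{1}, {1, 2}, {3}, {1, 3}} = (T \<in> {{1}, {1, 2}, {3}, {1, 3}})"
    proof (cases "S \<in> {{1}, {1, 2}, {2, 3}}")
      case True
      have "T \<in> {{1}, {1, 2}, {2, 3}}" using True unfolding iff .
      with True have "S = {1} \<or> S = {1, 2} \<or> S = {2, 3}" "T = {1} \<or> T = {1, 2} \<or> T = {2, 3}"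
        by (simp_all only: insert_iff empty_iff simp_thms)
      then show ?thesis using ne by (elim disjE; hypsubst) (simp_all add: doubleton_eq_iff)
    next
      case False
      have "T \<notin> {{1}, {1, 2}, {2, 3}}" using False unfolding iff .
      with False have F: "\<not> (S = {1} \<or> S = {1, 2} \<or> S = {2, 3})" "\<not> (T = {1} \<or> T = {1, 2} \<or> T = {2, 3})"
        by (simp_all only: insert_iff empty_iff simp_thms)
      have "S = {2} \<or> S = {3} \<or> S = {1, 3}" "T = {2} \<or> T = {3} \<or> T = {1, 3}"
        using top_color_small(1)[OF S lt(1)] top_color_small(1)[OF T lt(2)] F by argo+
      then show ?thesis using ne by (elim disjE; hypsubst) (simp_all add: doubleton_eq_iff)
    qed
    show ?thesis
      unfolding arc hexagon_side_def goal eq_False[THEN iffD2, OF False] simp_thms ..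
  qed
qed

text \<open>The set {1, 2, 3} has just three two-element subsets, and these span the triangle that H
  removes.\<close>

lemma B_graph_3: "B_graph 3 = H_graph 3"
proof -
  have "card S = 2 \<longleftrightarrow> S \<in> {{1, 2}, {1, 3}, {2, 3}}" if S: "S \<in> small_subsets 3" for S
  proof -
    have "\<forall>x\<in>S. x < 4" using S by (auto simp: small_subsets_def)
    from small_subsets_cases[OF S this] show ?thesis by (elim disjE) (simp_all add: doubleton_eq_iff)
  qed
  note card_2 = this
  have "(S, T) \<in> parcs (B_graph 3) \<longleftrightarrow> (S, T) \<in> parcs (H_graph 3)" for S T
  proof (cases "(S, T) \<in> parcs (G_graph 3)")
    case True
    then have "S \<in> small_subsets 3" "T \<in> small_subsets 3" by (simp_all add: G_graph_def)
    note c = this[THEN card_2]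
    have "(S, T) \<in> parcs (B_graph 3) \<longleftrightarrow> (S, T) \<in> parcs (G_graph 3) \<and> \<not> (card S = 2 \<and> card T = 2)"
      by (simp only: B_graph_def pair_pre_digraph.select_convs mem_Collect_eq prod.case)
    then show ?thesis unfolding parcs_H_graph_iff c .
  qed (simp add: B_graph_def H_graph_def)
  then have "parcs (B_graph 3) = parcs (H_graph 3)" by auto
  then show ?thesis by (simp add: B_graph_def H_graph_def)
qed

section \<open>The blocks of the extremal partition\<close>

locale block_limit =
  fixes P :: "ngraph set" and W :: "real \<Rightarrow> real \<Rightarrow> real" and A :: "nat \<Rightarrow> real set" and r :: nat
  assumes P: "hereditary P" and W: "graphon W" and r: "2 \<le> r"
    and gen: "\<And>V. finite V \<Longrightarrow> AE x in PiM V (\<lambda>_. unit_measure). generic P W V x"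
    and A: "\<And>i. i < r \<Longrightarrow> A i \<in> sets unit_measure" and A_pos: "\<And>i. i < r \<Longrightarrow> emeasure unit_measure (A i) \<noteq> 0"
    and A_disj: "\<And>i k x. i < r \<Longrightarrow> k < r \<Longrightarrow> x \<in> A i \<Longrightarrow> x \<in> A k \<Longrightarrow> i = k"
    and W_blocks: "\<And>i k. i < r \<Longrightarrow> k < r \<Longrightarrow> AE x in unit_measure. AE y in unit_measure.
      x \<in> A i \<longrightarrow> y \<in> A k \<longrightarrow> (if i = k then W x y = 0 \<or> W x y = 1 else W x y = 1 / 2)"
begin

lemma W_meas [measurable (raw)]:
  assumes "f \<in> measurable N unit_measure" "g \<in> measurable N unit_measure"
  shows "(\<lambda>w. W (f w) (g w)) \<in> borel_measurable N"
proof -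
  have "(\<lambda>p. W (fst p) (snd p)) \<in> borel_measurable (unit_measure \<Otimes>\<^sub>M unit_measure)"
    using W by (simp add: graphon_def split_beta')
  from measurable_compose[OF measurable_Pair[OF assms] this] show ?thesis by simp
qed

lemma W_sym: "x \<in> {0..1} \<Longrightarrow> y \<in> {0..1} \<Longrightarrow> W x y = W y x"
  using W by (simp add: graphon_def)

text \<open>Only distinct coordinates are compared, because the almost everywhere information on W
  says nothing about the diagonal.\<close>

definition blockwise :: "nat set \<Rightarrow> (nat \<Rightarrow> real) \<Rightarrow> bool" where
  "blockwise V x \<longleftrightarrow> (\<forall>u\<in>V. \<forall>v\<in>V. u \<noteq> v \<longrightarrow> (\<forall>i\<in>{..<r}. \<forall>k\<in>{..<r}. x u \<in> A i \<longrightarrow> x v \<in> A k \<longrightarrow>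
     (if i = k then W (x u) (x v) = 0 \<or> W (x u) (x v) = 1 else W (x u) (x v) = 1 / 2)))"

lemma AE_blockwise:
  assumes V: "finite V"
  shows "AE x in PiM V (\<lambda>_. unit_measure). blockwise V x"
  unfolding blockwise_def
proof (intro AE_finite_allI V)
  fix u v assume uv: "u \<in> V" "v \<in> V"
  show "AE x in PiM V (\<lambda>_. unit_measure). u \<noteq> v \<longrightarrow> (\<forall>i\<in>{..<r}. \<forall>k\<in>{..<r}. x u \<in> A i \<longrightarrow> x v \<in> A k \<longrightarrow>
     (if i = k then W (x u) (x v) = 0 \<or> W (x u) (x v) = 1 else W (x u) (x v) = 1 / 2))"
  proof (cases "u = v")
    case False
    have "AE x in PiM V (\<lambda>_. unit_measure). x u \<in> A i \<longrightarrow> x v \<in> A k \<longrightarrow>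
       (if i = k then W (x u) (x v) = 0 \<or> W (x u) (x v) = 1 else W (x u) (x v) = 1 / 2)"
      if ik: "i \<in> {..<r}" "k \<in> {..<r}" for i k
    proof -
      have [measurable]: "A i \<in> sets unit_measure" "A k \<in> sets unit_measure" using A ik by simp_all
      have "Measurable.pred (unit_measure \<Otimes>\<^sub>M unit_measure) (\<lambda>p. fst p \<in> A i \<longrightarrow> snd p \<in> A k \<longrightarrow>
          (if i = k then W (fst p) (snd p) = 0 \<or> W (fst p) (snd p) = 1 else W (fst p) (snd p) = 1 / 2))"
        by measurable
      from unit.AE_PiM_pair[OF V uv False, of "\<lambda>a b. a \<in> A i \<longrightarrow> b \<in> A k \<longrightarrow>
          (if i = k then W a b = 0 \<or> W a b = 1 else W a b = 1 / 2)", OF this W_blocks] ik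
      show ?thesis by simp
    qed
    then have "AE x in PiM V (\<lambda>_. unit_measure). \<forall>i\<in>{..<r}. \<forall>k\<in>{..<r}. x u \<in> A i \<longrightarrow> x v \<in> A k \<longrightarrow>
       (if i = k then W (x u) (x v) = 0 \<or> W (x u) (x v) = 1 else W (x u) (x v) = 1 / 2)"
      by (intro AE_finite_allI) auto
    then show ?thesis by (rule eventually_mono) (rule impI)
  qed simp
qed

lemma pick:
  assumes V: "finite V" and pos: "\<not> (AE x in PiM V (\<lambda>_. unit_measure). \<not> Q x)"
  obtains x where "x \<in> space (PiM V (\<lambda>_. unit_measure))" "generic P W V x" "blockwise V x" "Q x"
proof -
  have "\<exists>x\<in>space (PiM V (\<lambda>_. unit_measure)). generic P W V x \<and> blockwise V x \<and> Q x"
  proof (rule ccontr)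
    assume *: "\<not> ?thesis"
    have "AE x in PiM V (\<lambda>_. unit_measure). \<not> Q x"
      using gen[OF V] AE_blockwise[OF V] AE_space by eventually_elim (use * in blast)
    with pos show False ..
  qed
  then show ?thesis using that by blast
qed

lemma positive_boxes:
  assumes "finite V" "\<And>v. v \<in> V \<Longrightarrow> D v \<in> sets unit_measure" "\<And>v. v \<in> V \<Longrightarrow> emeasure unit_measure (D v) \<noteq> 0"
  shows "\<not> (AE x in PiM V (\<lambda>_. unit_measure). \<not> (\<forall>v\<in>V. x v \<in> D v))"
proof -
  have "\<not> (AE x in PiM ({} \<union> V) (\<lambda>_. unit_measure). \<not> (True \<and> (\<forall>v\<in>V. x v \<in> D v)))"
  proof (rule unit.positive_points[where Q = "\<lambda>_. True"])
    show "\<not> (AE x in PiM {} (\<lambda>_. unit_measure). \<not> True)"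
      unfolding PiM_empty AE_count_space by simp
  qed (use assms in auto)
  then show ?thesis unfolding Un_empty_left simp_thms .
qed

definition located :: "nat set \<Rightarrow> (nat \<Rightarrow> nat) \<Rightarrow> (nat \<Rightarrow> real) \<Rightarrow> bool" where
  "located V b x \<longleftrightarrow> (\<forall>v\<in>V. b v < r \<and> x v \<in> A (b v))"

lemma located_cross:
  assumes "blockwise V x" "located V b x" "u \<in> V" "v \<in> V" "b u \<noteq> b v"
  shows "0 < W (x u) (x v) \<and> W (x u) (x v) < 1"
proof -
  have ne: "u \<noteq> v" using assms(5) by auto
  have u: "b u \<in> {..<r}" "x u \<in> A (b u)" and v: "b v \<in> {..<r}" "x v \<in> A (b v)"
    using assms(2-4) by (simp_all add: located_def)
  have "W (x u) (x v) = 1 / 2"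
    using assms(1)[unfolded blockwise_def, rule_format, OF assms(3,4) ne u(1) v(1) u(2) v(2)]
    unfolding if_not_P[OF assms(5)] .
  then show ?thesis by simp
qed

lemma embeds_color_class:
  assumes b: "bij_betw \<sigma> {..<r} {..<r}" and g: "\<And>S. S \<in> pverts K \<Longrightarrow> g S < r"
    and i: "i \<in> (\<lambda>S. \<sigma> (g S)) ` pverts K"
  obtains c where "c < r" "i = \<sigma> c" "{S \<in> pverts K. \<sigma> (g S) = i} = {S \<in> pverts K. g S = c}"
proof -
  obtain S where S: "S \<in> pverts K" "i = \<sigma> (g S)" using i by (elim imageE)
  have "\<sigma> (g T) = i \<longleftrightarrow> g T = g S" if T: "T \<in> pverts K" for T
    unfolding S(2) by (rule inj_on_eq_iff[OF bij_betw_imp_inj_on[OF b]]) (use g S T in simp_all)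
  then have "{T \<in> pverts K. \<sigma> (g T) = i} = {T \<in> pverts K. g T = g S}" by (intro Collect_cong conj_cong refl)
  then show ?thesis using that[of "g S"] g[OF S(1)] S(2) by simp
qed

lemma transpose_bij: "k < r \<Longrightarrow> bij_betw (Transposition.transpose 0 k) {..<r} {..<r}"
  using r by (intro bij_betw_byWitness[of _ "Transposition.transpose 0 k"]) (auto simp: Transposition.transpose_def)

text \<open>Color 0 of \<open>path_color\<close> or \<open>triple_color\<close> goes to the block k
  that contains the three points. The transposition of 0 and k distributes the remaining colors, all
  of them cliques, over the other blocks, which hold large enough cliques by assumption.\<close>

lemma G_graph_belongs:
  assumes V: "finite V" and x: "x \<in> space (PiM V (\<lambda>_. unit_measure))" "generic P W V x" "blockwise V x" "located V b x"
    and k: "k < r" and p: "p0 \<in> V" "p1 \<in> V" "p2 \<in> V" "b p0 = k" "b p1 = k" "b p2 = k" "p0 \<noteq> p1" "p1 \<noteq> p2" "p0 \<noteq> p2"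
    and pattern: "0 < W (x p0) (x p1) \<and> 0 < W (x p1) (x p2) \<and> W (x p0) (x p2) < 1 \<or>
      W (x p0) (x p1) < 1 \<and> W (x p1) (x p2) < 1 \<and> W (x p0) (x p2) < 1"
    and cl: "\<And>i. i < r \<Longrightarrow> i \<noteq> k \<Longrightarrow> \<exists>T\<subseteq>{v \<in> V. b v = i}. card (small_subsets (r + 1)) \<le> card T \<and>
      (\<forall>u\<in>T. \<forall>v\<in>T. u \<noteq> v \<longrightarrow> 0 < W (x u) (x v))"
  shows "belongs_to (G_graph (r + 1)) P"
proof -
  let ?K = "G_graph (r + 1)"
  let ?\<sigma> = "Transposition.transpose 0 k"
  have pv: "pverts ?K = small_subsets (r + 1)" by (simp add: G_graph_def)
  have sym: "W (x u) (x v) = W (x v) (x u)" if "u \<in> V" "v \<in> V" for u v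
    using that x(1) by (intro W_sym) (auto simp: space_PiM PiE_iff)
  have main: "belongs_to ?K P" if g: "\<And>S. S \<in> small_subsets (r + 1) \<Longrightarrow> g S < r"
    and gc: "\<And>c. 1 \<le> c \<Longrightarrow> Defs.clique ?K {S \<in> small_subsets (r + 1). g S = c}"
    and g0: "embeds W x ?K {S \<in> small_subsets (r + 1). g S = 0} {p0, p1, p2}" for g
  proof (rule generic_embed_parts[OF P x(2) W x(1) V pair_graph_G_graph, where b = b and col = "\<lambda>S. ?\<sigma> (g S)"])
    show "0 < W (x u) (x v) \<and> W (x u) (x v) < 1" if "u \<in> V" "v \<in> V" "b u \<noteq> b v" for u v
      by (rule located_cross[OF x(3,4) that])
    fix i assume i: "i \<in> (\<lambda>S. ?\<sigma> (g S)) ` pverts ?K"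
    have gK: "g S < r" if "S \<in> pverts ?K" for S
      by (rule g) (use that in \<open>simp only: pv\<close>)
    obtain c where c: "c < r" "i = ?\<sigma> c" "{S \<in> pverts ?K. ?\<sigma> (g S) = i} = {S \<in> pverts ?K. g S = c}"
      by (rule embeds_color_class[OF transpose_bij[OF k] gK i])
    show "embeds W x ?K {S \<in> pverts ?K. ?\<sigma> (g S) = i} {v \<in> V. b v = i}"
      unfolding c(3) unfolding pv
    proof (cases "c = 0")
      case True
      then have "i = k" using c(2) by simp
      then have "{p0, p1, p2} \<subseteq> {v \<in> V. b v = i}" using p by simp
      then show "embeds W x ?K {S \<in> small_subsets (r + 1). g S = c} {v \<in> V. b v = i}"
        unfolding True by (rule embeds_mono[OF g0])
    next
      case False
      have ik: "i \<noteq> k" using c(2) False by (auto simp: Transposition.transpose_def split: if_splits)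
      have ir: "i < r" using c(1,2) k by (auto simp: Transposition.transpose_def)
      obtain T where T: "T \<subseteq> {v \<in> V. b v = i}" "card (small_subsets (r + 1)) \<le> card T"
        "\<forall>u\<in>T. \<forall>v\<in>T. u \<noteq> v \<longrightarrow> 0 < W (x u) (x v)" using cl[OF ir ik] by (elim exE conjE)
      let ?S = "{S \<in> small_subsets (r + 1). g S = c}"
      have "card ?S \<le> card (small_subsets (r + 1))" by (rule card_mono[OF finite_small_subsets]) simp
      moreover have "finite T" by (rule finite_subset[OF T(1)]) (use V in simp)
      moreover have "finite ?S" using finite_small_subsets by simp
      moreover have "Defs.clique ?K ?S" by (rule gc) (use False in simp)
      ultimately have "embeds W x ?K ?S T" using T(2,3) by (intro embeds_clique) simp_all
      then show "embeds W x ?K ?S {v \<in> V. b v = i}" using T(1) by (rule embeds_mono)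
    qed
  qed
  from pattern show ?thesis
  proof
    assume pat: "0 < W (x p0) (x p1) \<and> 0 < W (x p1) (x p2) \<and> W (x p0) (x p2) < 1"
    \<comment> \<open>The middle p1 of the path is the image of {2, 3}, which meets both {2} and
      {3}, while these two are disjoint.\<close>
    let ?\<phi> = "\<lambda>S :: nat set. if S = {2} then p0 else if S = {2, 3} then p1 else p2"
    let ?S = "{S \<in> small_subsets (r + 1). path_color S = 0}"
    have S: "S = {2} \<or> S = {3} \<or> S = {2, 3}" if "S \<in> ?S" for S
      using path_color_0[of S "r + 1"] that by simp
    have pat': "0 < W (x p1) (x p0)" "0 < W (x p2) (x p1)" "W (x p2) (x p0) < 1"
      using pat sym[OF p(1,2)] sym[OF p(2,3)] sym[OF p(1,3)] by simp_all
    have "?\<phi> S \<noteq> ?\<phi> T \<and> (if (S, T) \<in> parcs ?K then 0 < W (x (?\<phi> S)) (x (?\<phi> T)) else W (x (?\<phi> S)) (x (?\<phi> T)) < 1)"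
      if ST: "S \<in> ?S" "T \<in> ?S" "S \<noteq> T" for S T
    proof -
      have arc: "(S, T) \<in> parcs ?K \<longleftrightarrow> S \<inter> T \<noteq> {}" using ST by (simp add: parcs_G_graph_iff)
      show ?thesis unfolding arc using S[OF ST(1)] S[OF ST(2)] ST(3) pat pat' p(7-9)
        by (elim disjE; hypsubst) (simp_all add: doubleton_eq_iff)
    qed
    note \<phi> = this
    have "embeds W x ?K ?S {p0, p1, p2}"
      unfolding embeds_def
    proof (intro exI[of _ ?\<phi>] conjI ballI impI)
      show "inj_on ?\<phi> ?S" by (rule inj_onI, rule ccontr) (use \<phi> in blast)
      show "?\<phi> ` ?S \<subseteq> {p0, p1, p2}" by (rule image_subsetI) simp
    qed (rule \<phi>[THEN conjunct2])
    then show ?thesis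
      using r by (intro main[of path_color] path_color_clique top_color_less) simp_all
  next
    assume pat: "W (x p0) (x p1) < 1 \<and> W (x p1) (x p2) < 1 \<and> W (x p0) (x p2) < 1"
    let ?\<phi> = "\<lambda>S :: nat set. if S = {1} then p0 else if S = {2} then p1 else p2"
    let ?S = "{S \<in> small_subsets (r + 1). triple_color S = 0}"
    have S: "S = {1} \<or> S = {2} \<or> S = {3}" if "S \<in> ?S" for S
      using triple_color_0[of S "r + 1"] that by simp
    have pat': "W (x p1) (x p0) < 1" "W (x p2) (x p1) < 1" "W (x p2) (x p0) < 1"
      using pat sym[OF p(1,2)] sym[OF p(2,3)] sym[OF p(1,3)] by simp_all
    have "?\<phi> S \<noteq> ?\<phi> T \<and> (if (S, T) \<in> parcs ?K then 0 < W (x (?\<phi> S)) (x (?\<phi> T)) else W (x (?\<phi> S)) (x (?\<phi> T)) < 1)"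
      if ST: "S \<in> ?S" "T \<in> ?S" "S \<noteq> T" for S T
    proof -
      have arc: "(S, T) \<in> parcs ?K \<longleftrightarrow> S \<inter> T \<noteq> {}" using ST by (simp add: parcs_G_graph_iff)
      show ?thesis unfolding arc using S[OF ST(1)] S[OF ST(2)] ST(3) pat pat' p(7-9)
        by (elim disjE; hypsubst) simp_all
    qed
    note \<phi> = this
    have "embeds W x ?K ?S {p0, p1, p2}"
      unfolding embeds_def
    proof (intro exI[of _ ?\<phi>] conjI ballI impI)
      show "inj_on ?\<phi> ?S" by (rule inj_onI, rule ccontr) (use \<phi> in blast)
      show "?\<phi> ` ?S \<subseteq> {p0, p1, p2}" by (rule image_subsetI) simp
    qed (rule \<phi>[THEN conjunct2])
    then show ?thesis
      using r by (intro main[of triple_color] triple_color_clique top_color_less) simp_all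
  qed
qed

text \<open>The singletons go to one block and the two-element sets to the other. Both classes are
  independent in B, so two blocks suffice whatever r is.\<close>

lemma B_graph_belongs:
  assumes V: "finite V" and x: "x \<in> space (PiM V (\<lambda>_. unit_measure))" "generic P W V x" "blockwise V x" "located V b x"
    and k: "k1 \<noteq> k2"
    and T1: "T1 \<subseteq> {v \<in> V. b v = k1}" "card (small_subsets (r + 1)) \<le> card T1" "\<forall>u\<in>T1. \<forall>v\<in>T1. u \<noteq> v \<longrightarrow> W (x u) (x v) < 1"
    and T2: "T2 \<subseteq> {v \<in> V. b v = k2}" "card (small_subsets (r + 1)) \<le> card T2" "\<forall>u\<in>T2. \<forall>v\<in>T2. u \<noteq> v \<longrightarrow> W (x u) (x v) < 1"
  shows "belongs_to (B_graph (r + 1)) P"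
proof -
  let ?K = "B_graph (r + 1)"
  let ?col = "\<lambda>S :: nat set. if card S = 1 then k1 else k2"
  have pv: "pverts ?K = small_subsets (r + 1)" by (simp add: B_graph_def)
  have fin: "finite T1" "finite T2" using finite_subset[OF T1(1)] finite_subset[OF T2(1)] V by simp_all
  have ind: "embeds W x ?K {S \<in> small_subsets (r + 1). Q S} T"
    if Q: "Defs.independent ?K {S \<in> small_subsets (r + 1). Q S}" and T: "finite T" "card (small_subsets (r + 1)) \<le> card T"
      "\<forall>u\<in>T. \<forall>v\<in>T. u \<noteq> v \<longrightarrow> W (x u) (x v) < 1" for Q T
  proof -
    have "card {S \<in> small_subsets (r + 1). Q S} \<le> card (small_subsets (r + 1))"
      by (rule card_mono[OF finite_small_subsets]) simp
    moreover have "finite {S \<in> small_subsets (r + 1). Q S}" using finite_small_subsets by simp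
    ultimately show ?thesis using T Q by (intro embeds_independent) simp_all
  qed
  have one: "Defs.independent ?K {S \<in> small_subsets (r + 1). card S = 1}"
  proof -
    have "(S, T) \<notin> parcs (G_graph (r + 1))" if cS: "card S = 1" and cT: "card T = 1" for S T
    proof -
      obtain a where "S = {a}" using cS by (rule card_1_singletonE)
      moreover obtain b where "T = {b}" using cT by (rule card_1_singletonE)
      ultimately show ?thesis by (auto simp: parcs_G_graph_iff)
    qed
    then show ?thesis by (simp add: independent_def B_graph_def)
  qed
  have two: "Defs.independent ?K {S \<in> small_subsets (r + 1). card S \<noteq> 1}"
    by (auto simp: independent_def B_graph_def small_subsets_def)
  show ?thesis
  proof (rule generic_embed_parts[OF P x(2) W x(1) V pair_graph_B_graph, where b = b and col = ?col])
    show "0 < W (x u) (x v) \<and> W (x u) (x v) < 1" if "u \<in> V" "v \<in> V" "b u \<noteq> b v" for u v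
      by (rule located_cross[OF x(3,4) that])
    fix i assume "i \<in> ?col ` pverts ?K"
    then consider "i = k1" | "i = k2" by (auto split: if_splits)
    then show "embeds W x ?K {S \<in> pverts ?K. ?col S = i} {v \<in> V. b v = i}"
    proof cases
      case 1
      have "{S \<in> pverts ?K. ?col S = i} = {S \<in> small_subsets (r + 1). card S = 1}"
        unfolding pv 1 using k by auto
      then show ?thesis using embeds_mono[OF ind[OF one fin(1) T1(2,3)] T1(1)] 1 by simp
    next
      case 2
      have "{S \<in> pverts ?K. ?col S = i} = {S \<in> small_subsets (r + 1). card S \<noteq> 1}"
        unfolding pv 2 using k by auto
      then show ?thesis using embeds_mono[OF ind[OF two fin(2) T2(2,3)] T2(1)] 2 by simp
    qed
  qed
qed

end

section \<open>Almost every block is free of bad triples and splits into two cliques\<close>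

lemma card_small_subsets_ge_3: "2 \<le> r \<Longrightarrow> 3 \<le> card (small_subsets (r + 1))"
proof -
  assume r: "2 \<le> r"
  have "{{1}, {2}, {3}} \<subseteq> small_subsets (r + 1)" using r by (auto simp: small_subsets_def)
  then have "card {{1 :: nat}, {2}, {3}} \<le> card (small_subsets (r + 1))" by (rule card_mono[OF finite_small_subsets])
  then show ?thesis by simp
qed

lemma obtain_three:
  assumes "3 \<le> card T"
  obtains p0 p1 p2 where "p0 \<in> T" "p1 \<in> T" "p2 \<in> T" "p0 \<noteq> p1" "p1 \<noteq> p2" "p0 \<noteq> p2"
proof -
  obtain U where U: "U \<subseteq> T" "card U = 3" using obtain_subset_with_card_n[OF assms] by metis
  then obtain a b c where "U = {a, b, c}" "a \<noteq> b" "b \<noteq> c" "a \<noteq> c" by (auto simp: card_3_iff)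
  then show ?thesis using that[of a b c] U(1) by auto
qed

lemma bij_two_points:
  assumes "k0 < r" "k1 < r" "k0 \<noteq> k1"
  obtains \<sigma> where "bij_betw \<sigma> {..<r} {..<r :: nat}" "\<sigma> 0 = k0" "\<sigma> 1 = k1"
proof -
  have r: "2 \<le> r" using assms by linarith
  have tb: "bij_betw (Transposition.transpose a b) {..<r} {..<r}" if "a < r" "b < r" for a b :: nat
    using that by (intro bij_betw_byWitness[of _ "Transposition.transpose a b"]) (auto simp: Transposition.transpose_def)
  let ?a = "Transposition.transpose 0 k0 1"
  \<comment> \<open>The first transposition takes 0 to k0 and 1 to ?a. The second moves ?a to k1 and
    leaves k0 alone, since k0 differs from both.\<close>
  let ?\<sigma> = "Transposition.transpose ?a k1 \<circ> Transposition.transpose 0 k0"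
  have a: "?a < r" using assms r by (auto simp: Transposition.transpose_def)
  have "bij_betw ?\<sigma> {..<r} {..<r}"
    by (rule bij_betw_trans[OF tb tb]) (use a assms r in auto)
  moreover have "?a \<noteq> k0" by (auto simp: Transposition.transpose_def)
  then have "?\<sigma> 0 = k0" using assms(3) by (simp add: Transposition.transpose_def)
  moreover have "?\<sigma> 1 = k1" by (simp add: Transposition.transpose_def)
  ultimately show ?thesis by (rule that)
qed

context block_limit
begin

text \<open>
  The pattern of three points of a block that no union of two disjoint cliques contains: an
  induced path or an independent triple.
\<close>

definition bad :: "nat \<Rightarrow> real \<Rightarrow> real \<Rightarrow> real \<Rightarrow> bool" where
  "bad j a b c \<longleftrightarrow> a \<in> A j \<and> b \<in> A j \<and> c \<in> A j \<and>
    (0 < W a b \<and> 0 < W b c \<and> W a c < 1 \<or> W a b < 1 \<and> W b c < 1 \<and> W a c < 1)"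

lemma pred_bad:
  assumes j: "j < r" and [measurable]: "f \<in> measurable N unit_measure" "g \<in> measurable N unit_measure" "h \<in> measurable N unit_measure"
  shows "Measurable.pred N (\<lambda>w. bad j (f w) (g w) (h w))"
proof -
  have [measurable]: "A j \<in> sets unit_measure" using A j by simp
  show ?thesis unfolding bad_def by measurable
qed

text \<open>Sample a bad triple in block j together with many points in every block, and apply
  Ramsey's theorem in each block. If all blocks contain large cliques, the triple yields G.
  Otherwise some block k contains a large independent set; the others must then contain cliques, as
  a second independent set would yield B. Three points of the independent set form a bad triple in
  block k, which again yields G.\<close>

lemma AE_not_bad:
  assumes G: "\<not> belongs_to (G_graph (r + 1)) P" and B: "\<not> belongs_to (B_graph (r + 1)) P" and j: "j < r"
  shows "AE a in unit_measure. AE b in unit_measure. AE c in unit_measure. \<not> bad j a b c"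
proof (rule ccontr)
  assume n: "\<not> ?thesis"
  let ?three = "{0, 1, 2 :: nat}" and ?n = "card (small_subsets (r + 1))"
  have pos3: "\<not> (AE x in PiM ?three (\<lambda>_. unit_measure). \<not> bad j (x 0) (x 1) (x 2))"
  proof
    assume ae: "AE x in PiM ?three (\<lambda>_. unit_measure). \<not> bad j (x 0) (x 1) (x 2)"
    have "Measurable.pred (unit_measure \<Otimes>\<^sub>M unit_measure \<Otimes>\<^sub>M unit_measure) (\<lambda>q. \<not> bad j (fst q) (fst (snd q)) (snd (snd q)))"
      by (intro pred_intros_logic pred_bad[OF j]) measurable
    from n unit.AE_PiM_tripleD[of "\<lambda>a b c. \<not> bad j a b c", OF this ae] show False ..
  qed
  have n3: "3 \<le> ?n" by (rule card_small_subsets_ge_3[OF r])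
  obtain N where N: "N \<ge> 1" and ramsey: "\<forall>(w :: nat \<Rightarrow> nat \<Rightarrow> real) V. finite V \<and> card V \<ge> N \<and>
      (\<forall>u\<in>V. \<forall>v\<in>V. w u v = w v u) \<longrightarrow>
      (\<exists>T\<subseteq>V. card T = ?n \<and> ((\<forall>u\<in>T. \<forall>v\<in>T. u \<noteq> v \<longrightarrow> 0 < w u v) \<or> (\<forall>u\<in>T. \<forall>v\<in>T. u \<noteq> v \<longrightarrow> w u v < 1)))"
    using ramsey_weights[of ?n] by (elim exE conjE)
  let ?rest = "{3..<r * N + 3}"
  let ?all = "?three \<union> ?rest"
  \<comment> \<open>Coordinates 0, 1, 2 carry the triple in block j. The others are dealt in turn to
    the r blocks, N to each.\<close>
  define b where "b v = (if v < 3 then j else (v - 3) mod r)" for v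
  have b_less: "b v < r" for v using j r by (simp add: b_def)
  have fV: "finite ?all" by simp
  have disj: "?three \<inter> ?rest = {}" by simp
  have predQ: "Measurable.pred (PiM ?three (\<lambda>_. unit_measure)) (\<lambda>x. bad j (x 0) (x 1) (x 2))"
    by (intro pred_bad[OF j]) measurable
  have "\<not> (AE x in PiM ?all (\<lambda>_. unit_measure). \<not> (bad j (restrict x ?three 0) (restrict x ?three 1) (restrict x ?three 2) \<and> (\<forall>v\<in>?rest. x v \<in> A (b v))))"
    by (rule unit.positive_points[OF _ _ disj predQ pos3]) (simp_all add: A A_pos b_less)
  from pick[OF fV this] obtain x where x: "x \<in> space (PiM ?all (\<lambda>_. unit_measure))" "generic P W ?all x" "blockwise ?all x"
    and xQ: "bad j (restrict x ?three 0) (restrict x ?three 1) (restrict x ?three 2) \<and> (\<forall>v\<in>?rest. x v \<in> A (b v))" by this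
  have bad: "bad j (x 0) (x 1) (x 2)" using xQ by simp
  have loc: "located ?all b x"
    unfolding located_def
  proof (intro ballI conjI b_less)
    fix v assume "v \<in> ?all"
    then consider "v \<in> ?three" | "v \<in> ?rest" by blast
    then show "x v \<in> A (b v)"
    proof cases
      case 1
      then have "x v \<in> A j" using bad unfolding bad_def by (elim insertE emptyE) simp_all
      moreover have "b v = j" using 1 by (auto simp: b_def)
      ultimately show ?thesis by simp
    next
      case 2
      then show ?thesis using xQ by blast
    qed
  qed
  have sym: "W (x u) (x v) = W (x v) (x u)" if "u \<in> ?all" "v \<in> ?all" for u v
    using that x(1) by (intro W_sym) (auto simp: space_PiM PiE_iff)
  let ?homog = "\<lambda>T. (\<forall>u\<in>T. \<forall>v\<in>T. u \<noteq> v \<longrightarrow> 0 < W (x u) (x v)) \<or> (\<forall>u\<in>T. \<forall>v\<in>T. u \<noteq> v \<longrightarrow> W (x u) (x v) < 1)"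
  have "\<forall>i\<in>{..<r}. \<exists>T. T \<subseteq> {v \<in> ?all. b v = i} \<and> card T = ?n \<and> ?homog T"
  proof
    fix i assume "i \<in> {..<r}"
    then have "N \<le> card {v \<in> {..<r * N}. v mod r = i}" by (intro residue_class_card) simp
    also have "\<dots> = card ((\<lambda>v. v + 3) ` {v \<in> {..<r * N}. v mod r = i})"
      by (rule card_image[symmetric]) simp
    also have "\<dots> \<le> card {v \<in> ?all. b v = i}"
      by (rule card_mono) (auto simp: b_def)
    finally have c: "N \<le> card {v \<in> ?all. b v = i}" .
    have "finite {v \<in> ?all. b v = i} \<and> N \<le> card {v \<in> ?all. b v = i} \<and>
        (\<forall>u\<in>{v \<in> ?all. b v = i}. \<forall>v\<in>{v \<in> ?all. b v = i}. W (x u) (x v) = W (x v) (x u))"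
    proof (intro conjI c ballI)
      show "finite {v \<in> ?all. b v = i}" using fV by (rule rev_finite_subset) blast
      fix u v assume "u \<in> {v \<in> ?all. b v = i}" "v \<in> {v \<in> ?all. b v = i}"
      then show "W (x u) (x v) = W (x v) (x u)" by (intro sym) (simp_all only: mem_Collect_eq)
    qed
    then show "\<exists>T. T \<subseteq> {v \<in> ?all. b v = i} \<and> card T = ?n \<and> ?homog T"
      by (rule mp[OF spec[OF spec[OF ramsey, of "\<lambda>u v. W (x u) (x v)"], of "{v \<in> ?all. b v = i}"]])
  qed
  from bchoice[OF this] obtain T where "\<forall>i\<in>{..<r}. T i \<subseteq> {v \<in> ?all. b v = i} \<and> card (T i) = ?n \<and> ?homog (T i)"
    by (elim exE)
  then have T: "T i \<subseteq> {v \<in> ?all. b v = i}" "card (T i) = ?n" "?homog (T i)" if "i < r" for i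
    using that by (simp_all only: lessThan_iff)
  let ?cl = "\<lambda>i. \<forall>u\<in>T i. \<forall>v\<in>T i. u \<noteq> v \<longrightarrow> 0 < W (x u) (x v)"
  let ?ind = "\<lambda>i. \<forall>u\<in>T i. \<forall>v\<in>T i. u \<noteq> v \<longrightarrow> W (x u) (x v) < 1"
  have one_ind: "?cl i" if "i < r" "k < r" "i \<noteq> k" "?ind k" for i k
  proof (rule ccontr)
    assume n: "\<not> ?cl i"
    have "?ind i" by (rule disjE[OF T(3)[OF that(1)] notE[OF n]])
    have "belongs_to (B_graph (r + 1)) P"
      by (rule B_graph_belongs[OF fV x loc that(3) T(1)[OF that(1)] _ \<open>?ind i\<close> T(1)[OF that(2)] _ that(4)])
        (simp_all only: T(2)[OF that(1)] T(2)[OF that(2)] order_refl)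
    with B show False ..
  qed
  have "belongs_to (G_graph (r + 1)) P"
  proof (cases "\<forall>i<r. ?cl i")
    case True
    show ?thesis
    proof (rule G_graph_belongs[OF fV x loc j, of 0 1 2])
      show "0 < W (x 0) (x 1) \<and> 0 < W (x 1) (x 2) \<and> W (x 0) (x 2) < 1 \<or>
        W (x 0) (x 1) < 1 \<and> W (x 1) (x 2) < 1 \<and> W (x 0) (x 2) < 1"
        using bad by (simp add: bad_def)
      fix i assume i: "i < r" "i \<noteq> j"
      show "\<exists>T\<subseteq>{v \<in> ?all. b v = i}. ?n \<le> card T \<and> (\<forall>u\<in>T. \<forall>v\<in>T. u \<noteq> v \<longrightarrow> 0 < W (x u) (x v))"
        by (intro exI[of _ "T i"] conjI T(1)[OF i(1)] mp[OF spec[OF True, of i] i(1)]) (simp only: T(2)[OF i(1)] order_refl)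
    qed (simp_all add: b_def)
  next
    case False
    then obtain k where k: "k < r" "\<not> ?cl k" unfolding not_all not_imp by (elim exE conjE)
    have ind: "?ind k" by (rule disjE[OF T(3)[OF k(1)] notE[OF k(2)]])
    obtain p0 p1 p2 where p: "p0 \<in> T k" "p1 \<in> T k" "p2 \<in> T k" "p0 \<noteq> p1" "p1 \<noteq> p2" "p0 \<noteq> p2"
      by (rule obtain_three[of "T k"]) (use n3 T(2)[OF k(1)] in simp)
    have pV: "p0 \<in> ?all \<and> b p0 = k" "p1 \<in> ?all \<and> b p1 = k" "p2 \<in> ?all \<and> b p2 = k"
      using subsetD[OF T(1)[OF k(1)] p(1)] subsetD[OF T(1)[OF k(1)] p(2)] subsetD[OF T(1)[OF k(1)] p(3)]
      by (simp_all only: mem_Collect_eq)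
    have lt: "W (x p0) (x p1) < 1 \<and> W (x p1) (x p2) < 1 \<and> W (x p0) (x p2) < 1"
      using ind[rule_format, OF p(1,2,4)] ind[rule_format, OF p(2,3,5)] ind[rule_format, OF p(1,3,6)] by (intro conjI)
    show ?thesis
    proof (rule G_graph_belongs[OF fV x loc k(1) pV[THEN conjunct1] pV[THEN conjunct2] p(4-6) disjI2[OF lt]])
      fix i assume i: "i < r" "i \<noteq> k"
      show "\<exists>T\<subseteq>{v \<in> ?all. b v = i}. ?n \<le> card T \<and> (\<forall>u\<in>T. \<forall>v\<in>T. u \<noteq> v \<longrightarrow> 0 < W (x u) (x v))"
        by (intro exI[of _ "T i"] conjI T(1)[OF i(1)] one_ind[OF i(1) k(1) i(2) ind]) (simp only: T(2)[OF i(1)] order_refl)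
    qed
  qed
  with G show False ..
qed

text \<open>Either of the two cliques B and A j - B may be null, and then the block is a single
  clique up to a null set.\<close>

definition splits :: "nat \<Rightarrow> real set \<Rightarrow> bool" where
  "splits j B \<longleftrightarrow> B \<in> sets unit_measure \<and> B \<subseteq> A j \<and> (AE x in unit_measure. AE y in unit_measure.
     x \<in> A j \<longrightarrow> y \<in> A j \<longrightarrow> W x y = (if x \<in> B \<longleftrightarrow> y \<in> B then 1 else 0))"

text \<open>Take a typical point x of the block and let B be its neighbourhood there. Two neighbours
  of x are adjacent, since otherwise x is the middle of an induced path; two non-neighbours are
  adjacent, since otherwise they form an independent triple with x; a neighbour and a non-neighbour
  are not adjacent, since otherwise x is the end of an induced path.\<close>

lemma block_splits:
  assumes j: "j < r" and nb: "AE a in unit_measure. AE b in unit_measure. AE c in unit_measure. \<not> bad j a b c"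
  shows "\<exists>B. splits j B"
proof -
  interpret pair_sigma_finite unit_measure unit_measure ..
  have [measurable]: "A j \<in> sets unit_measure" using A j by simp
  have "Measurable.pred (unit_measure \<Otimes>\<^sub>M unit_measure \<Otimes>\<^sub>M unit_measure) (\<lambda>q. \<not> bad j (fst q) (fst (snd q)) (snd (snd q)))"
    by (intro pred_intros_logic pred_bad[OF j]) measurable
  from unit.AE_triple_rotate[of "\<lambda>a b c. \<not> bad j a b c", OF this nb]
  have nb2: "AE b in unit_measure. AE a in unit_measure. AE c in unit_measure. \<not> bad j a b c" .
  have vals: "AE y in unit_measure. AE z in unit_measure. y \<in> A j \<longrightarrow> z \<in> A j \<longrightarrow> W y z = 0 \<or> W y z = 1"
    using W_blocks[OF j j] by (simp only: simp_thms if_True)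
  have "\<exists>x\<in>{0..1}. x \<in> A j \<and> (AE b in unit_measure. AE c in unit_measure. \<not> bad j x b c) \<and>
      (AE a in unit_measure. AE c in unit_measure. \<not> bad j a x c) \<and>
      (AE z in unit_measure. x \<in> A j \<longrightarrow> z \<in> A j \<longrightarrow> W x z = 0 \<or> W x z = 1)"
  proof (rule ccontr)
    assume *: "\<not> ?thesis"
    have "AE x in unit_measure. x \<notin> A j"
      using nb nb2 vals AE_space by eventually_elim (use * in \<open>simp only: space_unit_measure, blast\<close>)
    then have "emeasure unit_measure (A j) = 0"
      by (subst (asm) AE_iff_measurable[of "A j"]) (use sets.sets_into_space[of "A j" unit_measure] in auto)
    with A_pos[OF j] show False ..
  qed
  then obtain x where x: "x \<in> {0..1}" "x \<in> A j" "AE b in unit_measure. AE c in unit_measure. \<not> bad j x b c"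
    "AE a in unit_measure. AE c in unit_measure. \<not> bad j a x c"
    "AE z in unit_measure. x \<in> A j \<longrightarrow> z \<in> A j \<longrightarrow> W x z = 0 \<or> W x z = 1"
    by (elim bexE conjE)
  \<comment> \<open>\<open>bad\<close> is not symmetric in its arguments: x has to be allowed as the
    middle, and as an end with the other two points in either order.\<close>
  have x6: "AE c in unit_measure. AE b in unit_measure. \<not> bad j x b c"
  proof -
    have "Measurable.pred (unit_measure \<Otimes>\<^sub>M unit_measure) (\<lambda>p. \<not> bad j x (fst p) (snd p))"
      by (intro pred_intros_logic pred_bad[OF j]) (use x(1) in simp_all)
    then have "{p \<in> space (unit_measure \<Otimes>\<^sub>M unit_measure). \<not> bad j x (fst p) (snd p)} \<in> sets (unit_measure \<Otimes>\<^sub>M unit_measure)"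
      by (simp only: pred_def)
    from iffD1[OF AE_commute[OF this] x(3)] show ?thesis .
  qed
  have [measurable]: "(\<lambda>y. W x y) \<in> borel_measurable unit_measure"
    using x(1) by (intro W_meas) simp_all
  define B where "B = {y \<in> space unit_measure. y \<in> A j \<and> W x y = 1}"
  have B: "B \<in> sets unit_measure" unfolding B_def by measurable
  have "AE y in unit_measure. AE z in unit_measure.
     y \<in> A j \<longrightarrow> z \<in> A j \<longrightarrow> W y z = (if y \<in> B \<longleftrightarrow> z \<in> B then 1 else 0)"
    using x(3,4,5) vals AE_space x6
  proof eventually_elim
    case (elim y)
    show ?case using elim(1,2) x(5) elim(4) AE_space elim(6)
    proof eventually_elim
      case (elim z)
      have yz: "y \<in> {0..1}" "z \<in> {0..1}" using elim(5) \<open>y \<in> space unit_measure\<close> by simp_all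
      show ?case
      proof (intro impI)
        assume yA: "y \<in> A j" and zA: "z \<in> A j"
        have Wyz: "W y z = 0 \<or> W y z = 1" using elim(4) yA zA by simp
        have Wxy: "W x y = 0 \<or> W x y = 1" using \<open>x \<in> A j \<longrightarrow> y \<in> A j \<longrightarrow> W x y = 0 \<or> W x y = 1\<close> x(2) yA by simp
        have Wxz: "W x z = 0 \<or> W x z = 1" using elim(3) x(2) zA by simp
        have yx: "W y x = W x y" using W_sym x(1) yz by simp
        have By: "y \<in> B \<longleftrightarrow> W x y = 1" and Bz: "z \<in> B \<longleftrightarrow> W x z = 1" using yA zA yz by (simp_all add: B_def)
        have b1: "\<not> (0 < W x y \<and> 0 < W y z \<and> W x z < 1)" "\<not> (W x y < 1 \<and> W y z < 1 \<and> W x z < 1)"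
          using elim(1) x(2) yA zA by (simp_all add: bad_def)
        have b2: "\<not> (0 < W x y \<and> 0 < W x z \<and> W y z < 1)"
          using elim(2) x(2) yA zA yx by (simp add: bad_def)
        have b3: "\<not> (0 < W x z \<and> 0 < W y z \<and> W x y < 1)"
          using elim(6) x(2) yA zA W_sym[OF yz] by (simp add: bad_def)
        show "W y z = (if y \<in> B \<longleftrightarrow> z \<in> B then 1 else 0)"
          unfolding By Bz using Wyz Wxy Wxz b1 b2 b3 by (elim disjE) simp_all
      qed
    qed
  qed
  then show ?thesis using B unfolding splits_def by (intro exI[of _ B]) (auto simp: B_def)
qed

text \<open>The two halves of the hexagon in H are placed into the blocks k0 and k1, with the sides
  given by \<open>hexagon_side\<close> going to B and to its complement, all of positive measure.
  Each remaining color is a clique and is placed into one side of another block, where W is 1. By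
  \<open>hexagon_arc\<close> the values of W then agree with the edges inside each block.\<close>

lemma not_two_nontrivial:
  assumes H: "\<not> belongs_to (H_graph (r + 1)) P" and B: "\<And>i. i < r \<Longrightarrow> splits i (B i)"
    and k: "k0 < r" "k1 < r" "k0 \<noteq> k1"
    and k0: "emeasure unit_measure (B k0) \<noteq> 0" "emeasure unit_measure (A k0 - B k0) \<noteq> 0"
    and k1: "emeasure unit_measure (B k1) \<noteq> 0" "emeasure unit_measure (A k1 - B k1) \<noteq> 0"
  shows False
proof -
  let ?K = "H_graph (r + 1)" and ?S = "small_subsets (r + 1)"
  have Bs: "B i \<in> sets unit_measure" "B i \<subseteq> A i" if "i < r" for i using B[OF that] by (simp_all add: splits_def)
  \<comment> \<open>A side of positive measure, to host a clique color. One exists because the block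
    itself is not null.\<close>
  define E where "E i = (if emeasure unit_measure (B i) \<noteq> 0 then B i else A i - B i)" for i
  have E: "E i \<in> sets unit_measure" "E i \<subseteq> A i" "emeasure unit_measure (E i) \<noteq> 0" if i: "i < r" for i
  proof -
    show "E i \<in> sets unit_measure" "E i \<subseteq> A i" using Bs[OF i] A[OF i] by (auto simp: E_def)
    show "emeasure unit_measure (E i) \<noteq> 0"
    proof
      assume 0: "emeasure unit_measure (E i) = 0"
      then have b0: "emeasure unit_measure (B i) = 0" by (auto simp: E_def split: if_splits)
      then have c0: "emeasure unit_measure (A i - B i) = 0" using 0 by (simp add: E_def)
      have "emeasure unit_measure (B i \<union> (A i - B i)) \<le> emeasure unit_measure (B i) + emeasure unit_measure (A i - B i)"
        by (rule emeasure_subadditive) (use Bs[OF i] A[OF i] in auto)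
      moreover have "B i \<union> (A i - B i) = A i" using Bs(2)[OF i] by auto
      ultimately show False using A_pos[OF i] b0 c0 by simp
    qed
  qed
  obtain \<sigma> where \<sigma>: "bij_betw \<sigma> {..<r} {..<r}" "\<sigma> 0 = k0" "\<sigma> 1 = k1" by (rule bij_two_points[OF k])
  let ?c = hexagon_color
  have c_less: "?c S < r" if "S \<in> ?S" for S by (rule top_color_less[OF r that])
  have \<sigma>_less: "\<sigma> (?c S) < r" if "S \<in> ?S" for S
    using bij_betwE[OF \<sigma>(1)] c_less[OF that] by blast
  \<comment> \<open>The region from which the sample point for the vertex S is drawn.\<close>
  define D where "D S = (if ?c S < 2 then (if hexagon_side S then B (\<sigma> (?c S)) else A (\<sigma> (?c S)) - B (\<sigma> (?c S))) else E (\<sigma> (?c S)))" for S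
  have D: "D S \<in> sets unit_measure" "D S \<subseteq> A (\<sigma> (?c S))" "emeasure unit_measure (D S) \<noteq> 0" if S: "S \<in> ?S" for S
  proof -
    let ?i = "\<sigma> (?c S)"
    note i = \<sigma>_less[OF S]
    show "D S \<in> sets unit_measure" "D S \<subseteq> A ?i" using Bs[OF i] A[OF i] E(1,2)[OF i] by (auto simp: D_def)
    show "emeasure unit_measure (D S) \<noteq> 0"
    proof (cases "?c S < 2")
      case True
      then have "?c S = 0 \<or> ?c S = 1" by linarith
      then have "?i = k0 \<or> ?i = k1" using \<sigma>(2,3) by (elim disjE) simp_all
      then show ?thesis unfolding D_def if_P[OF True] using k0 k1 by (elim disjE) simp_all
    next
      case False
      then show ?thesis unfolding D_def if_not_P[OF False] by (rule_tac E(3)[OF i])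
    qed
  qed
  \<comment> \<open>Sample coordinates are natural numbers, so the vertices of H, which are sets,
    are numbered.\<close>
  obtain \<iota> :: "nat set \<Rightarrow> nat" where \<iota>: "inj_on \<iota> ?S"
    using finite_imp_inj_to_nat_seg[OF finite_small_subsets] by metis
  let ?V = "\<iota> ` ?S"
  have V: "finite ?V" using finite_small_subsets by simp
  define D' where "D' v = D (inv_into ?S \<iota> v)" for v
  have D': "D' (\<iota> S) = D S" if "S \<in> ?S" for S unfolding D'_def using inv_into_f_f[OF \<iota> that] by simp
  have ae: "AE x in PiM ?V (\<lambda>_. unit_measure). \<forall>u\<in>?V. \<forall>v\<in>?V. \<forall>i\<in>{..<r}. u \<noteq> v \<longrightarrow>
      x u \<in> A i \<longrightarrow> x v \<in> A i \<longrightarrow> W (x u) (x v) = (if x u \<in> B i \<longleftrightarrow> x v \<in> B i then 1 else 0)"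
  proof (intro AE_finite_allI V)
    fix u v i assume uv: "u \<in> ?V" "v \<in> ?V" and "i \<in> {..<r}"
    then have i: "i < r" by simp
    show "AE x in PiM ?V (\<lambda>_. unit_measure). u \<noteq> v \<longrightarrow>
      x u \<in> A i \<longrightarrow> x v \<in> A i \<longrightarrow> W (x u) (x v) = (if x u \<in> B i \<longleftrightarrow> x v \<in> B i then 1 else 0)"
    proof (cases "u = v")
      case False
      have [measurable]: "A i \<in> sets unit_measure" "B i \<in> sets unit_measure" using A[OF i] Bs[OF i] by simp_all
      have "Measurable.pred (unit_measure \<Otimes>\<^sub>M unit_measure) (\<lambda>p. fst p \<in> A i \<longrightarrow> snd p \<in> A i \<longrightarrow>
          W (fst p) (snd p) = (if fst p \<in> B i \<longleftrightarrow> snd p \<in> B i then 1 else 0))"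
        by measurable
      from unit.AE_PiM_pair[OF V uv False, of "\<lambda>a b. a \<in> A i \<longrightarrow> b \<in> A i \<longrightarrow> W a b = (if a \<in> B i \<longleftrightarrow> b \<in> B i then 1 else 0)", OF this]
      have "AE x in PiM ?V (\<lambda>_. unit_measure). x u \<in> A i \<longrightarrow> x v \<in> A i \<longrightarrow> W (x u) (x v) = (if x u \<in> B i \<longleftrightarrow> x v \<in> B i then 1 else 0)"
        using B[OF i] unfolding splits_def by blast
      then show ?thesis by (rule eventually_mono) (rule impI)
    qed simp
  qed simp
  have pos: "\<not> (AE x in PiM ?V (\<lambda>_. unit_measure). \<not> (\<forall>v\<in>?V. x v \<in> D' v))"
  proof (rule positive_boxes[OF V])
    fix v assume "v \<in> ?V"
    then obtain S where S: "S \<in> ?S" "v = \<iota> S" by (elim imageE)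
    show "D' v \<in> sets unit_measure" "emeasure unit_measure (D' v) \<noteq> 0"
      unfolding S(2) D'[OF S(1)] by (rule D[OF S(1)])+
  qed
  have "\<not> (AE x in PiM ?V (\<lambda>_. unit_measure). \<not> ((\<forall>v\<in>?V. x v \<in> D' v) \<and> (\<forall>u\<in>?V. \<forall>v\<in>?V. \<forall>i\<in>{..<r}. u \<noteq> v \<longrightarrow>
      x u \<in> A i \<longrightarrow> x v \<in> A i \<longrightarrow> W (x u) (x v) = (if x u \<in> B i \<longleftrightarrow> x v \<in> B i then 1 else 0))))"
  proof
    assume "AE x in PiM ?V (\<lambda>_. unit_measure). \<not> ((\<forall>v\<in>?V. x v \<in> D' v) \<and> (\<forall>u\<in>?V. \<forall>v\<in>?V. \<forall>i\<in>{..<r}. u \<noteq> v \<longrightarrow>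
      x u \<in> A i \<longrightarrow> x v \<in> A i \<longrightarrow> W (x u) (x v) = (if x u \<in> B i \<longleftrightarrow> x v \<in> B i then 1 else 0)))"
    then have "AE x in PiM ?V (\<lambda>_. unit_measure). \<not> (\<forall>v\<in>?V. x v \<in> D' v)"
      using ae by eventually_elim (erule contrapos_nn, rule conjI)
    with pos show False ..
  qed
  from pick[OF V this] obtain x where x: "x \<in> space (PiM ?V (\<lambda>_. unit_measure))" "generic P W ?V x" "blockwise ?V x"
    and xQ: "(\<forall>v\<in>?V. x v \<in> D' v) \<and> (\<forall>u\<in>?V. \<forall>v\<in>?V. \<forall>i\<in>{..<r}. u \<noteq> v \<longrightarrow>
      x u \<in> A i \<longrightarrow> x v \<in> A i \<longrightarrow> W (x u) (x v) = (if x u \<in> B i \<longleftrightarrow> x v \<in> B i then 1 else 0))" by this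
  have xD: "x (\<iota> S) \<in> D S" if "S \<in> ?S" for S
    using bspec[OF conjunct1[OF xQ], of "\<iota> S"] D'[OF that] that by simp
  have xA: "x (\<iota> S) \<in> A (\<sigma> (?c S))" if "S \<in> ?S" for S
    using subsetD[OF D(2)[OF that] xD[OF that]] .
  have pv: "pverts ?K = ?S" by (simp add: H_graph_def)
  have "belongs_to ?K P"
  proof (rule generic_embed[OF P x(2) W x(1) V pair_graph_H_graph, where \<phi> = \<iota>])
    show "inj_on \<iota> (pverts ?K)" "\<iota> ` pverts ?K \<subseteq> ?V" unfolding pv using \<iota> by simp_all
    show "compat W ?K (x \<circ> \<iota>)"
      unfolding compat_def pv comp_apply
    proof (intro ballI impI)
      fix S T assume ST: "S \<in> ?S" "T \<in> ?S" "S \<noteq> T"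
      have ne: "\<iota> S \<noteq> \<iota> T" using ST inj_onD[OF \<iota>, of S T] by blast
      have iV: "\<iota> S \<in> ?V" "\<iota> T \<in> ?V" using ST by simp_all
      show "if (S, T) \<in> parcs ?K then 0 < W (x (\<iota> S)) (x (\<iota> T)) else W (x (\<iota> S)) (x (\<iota> T)) < 1"
      proof (cases "?c S = ?c T")
        case False
        have "\<sigma> (?c S) \<noteq> \<sigma> (?c T)"
          using False inj_on_eq_iff[OF bij_betw_imp_inj_on[OF \<sigma>(1)], of "?c S" "?c T"] c_less[OF ST(1)] c_less[OF ST(2)] by simp
        moreover have "located ?V (\<lambda>v. \<sigma> (?c (inv_into ?S \<iota> v))) x"
          unfolding located_def
        proof (intro ballI)
          fix v assume "v \<in> ?V"
          then obtain U where U: "U \<in> ?S" "v = \<iota> U" by (elim imageE)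
          show "\<sigma> (?c (inv_into ?S \<iota> v)) < r \<and> x v \<in> A (\<sigma> (?c (inv_into ?S \<iota> v)))"
            unfolding U(2) inv_into_f_f[OF \<iota> U(1)] using \<sigma>_less[OF U(1)] xA[OF U(1)] by (rule conjI)
        qed
        ultimately have "0 < W (x (\<iota> S)) (x (\<iota> T)) \<and> W (x (\<iota> S)) (x (\<iota> T)) < 1"
          using located_cross[OF x(3) _ iV, of "\<lambda>v. \<sigma> (?c (inv_into ?S \<iota> v))",
            unfolded inv_into_f_f[OF \<iota> ST(1)] inv_into_f_f[OF \<iota> ST(2)]] by blast
        then show ?thesis by (cases "(S, T) \<in> parcs ?K") simp_all
      next
        case True
        let ?i = "\<sigma> (?c S)"
        have i: "?i \<in> {..<r}" using \<sigma>_less[OF ST(1)] by simp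
        have Wval: "W (x (\<iota> S)) (x (\<iota> T)) = (if x (\<iota> S) \<in> B ?i \<longleftrightarrow> x (\<iota> T) \<in> B ?i then 1 else 0)"
          using bspec[OF bspec[OF bspec[OF conjunct2[OF xQ] iV(1)] iV(2)] i] ne xA[OF ST(1)] xA[OF ST(2), folded True] by blast
        have "(x (\<iota> S) \<in> B ?i \<longleftrightarrow> x (\<iota> T) \<in> B ?i) \<longleftrightarrow> (S, T) \<in> parcs ?K"
        proof (cases "2 \<le> ?c S")
          case c: True
          then have "\<not> ?c S < 2" by linarith
          then have "x (\<iota> S) \<in> E ?i" "x (\<iota> T) \<in> E ?i"
            using xD[OF ST(1)] xD[OF ST(2)] unfolding D_def True[symmetric] by simp_all
          then have "x (\<iota> S) \<in> B ?i \<longleftrightarrow> x (\<iota> T) \<in> B ?i" unfolding E_def by (auto split: if_splits)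
          then show ?thesis using hexagon_arc[OF ST True] c by blast
        next
          case c: False
          then have lt: "?c S < 2" by linarith
          have "x (\<iota> S) \<in> B ?i \<longleftrightarrow> hexagon_side S" "x (\<iota> T) \<in> B ?i \<longleftrightarrow> hexagon_side T"
            using xD[OF ST(1)] xD[OF ST(2)] unfolding D_def True[symmetric] if_P[OF lt] by (auto split: if_splits)
          then show ?thesis using hexagon_arc[OF ST True] c by blast
        qed
        then show ?thesis unfolding Wval by simp
      qed
    qed
  qed
  with H show False ..
qed

text \<open>If one side of a split is null, then W = 1 almost everywhere on the block, and by
  \<open>not_two_nontrivial\<close> at most one block has no null side. That block is
  \<open>i0\<close>; if there is none, block 0 takes its place.\<close>

theorem block_structure:
  assumes G: "\<not> belongs_to (G_graph (r + 1)) P" and B: "\<not> belongs_to (B_graph (r + 1)) P" and H: "\<not> belongs_to (H_graph (r + 1)) P"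
  obtains i0 B where "i0 < r" "splits i0 B"
    "\<And>i. i < r \<Longrightarrow> i \<noteq> i0 \<Longrightarrow> AE x in unit_measure. AE y in unit_measure. x \<in> A i \<longrightarrow> y \<in> A i \<longrightarrow> W x y = 1"
proof -
  have "\<forall>i\<in>{..<r}. \<exists>B. splits i B" using block_splits AE_not_bad[OF G B] by simp
  from bchoice[OF this] obtain C where "\<forall>i\<in>{..<r}. splits i (C i)" by (elim exE)
  then have C: "splits i (C i)" if "i < r" for i using that by simp
  let ?nt = "\<lambda>i. emeasure unit_measure (C i) \<noteq> 0 \<and> emeasure unit_measure (A i - C i) \<noteq> 0"
  have triv: "AE x in unit_measure. AE y in unit_measure. x \<in> A i \<longrightarrow> y \<in> A i \<longrightarrow> W x y = 1"
    if i: "i < r" and "\<not> ?nt i" for i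
  proof -
    have Ci: "C i \<in> sets unit_measure" "A i - C i \<in> sets unit_measure" "C i \<subseteq> A i" using C[OF i] A[OF i] by (auto simp: splits_def)
    have "(AE x in unit_measure. x \<notin> C i) \<or> (AE x in unit_measure. x \<notin> A i - C i)"
      using that(2) Ci(1,2)[THEN null_setsI[rotated]] AE_not_in by blast
    then obtain s where s: "AE x in unit_measure. x \<in> A i \<longrightarrow> (x \<in> C i \<longleftrightarrow> s)"
    proof
      assume "AE x in unit_measure. x \<notin> C i"
      then show ?thesis by (intro that[of False]) (auto elim: eventually_mono)
    next
      assume "AE x in unit_measure. x \<notin> A i - C i"
      then show ?thesis by (intro that[of True]) (auto elim: eventually_mono)
    qed
    have "AE x in unit_measure. AE y in unit_measure. x \<in> A i \<longrightarrow> y \<in> A i \<longrightarrow> W x y = (if x \<in> C i \<longleftrightarrow> y \<in> C i then 1 else 0)"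
      using C[OF i] by (simp add: splits_def)
    then show ?thesis using s
    proof eventually_elim
      case (elim x)
      show ?case using elim(1) s by eventually_elim (use elim(2) in auto)
    qed
  qed
  show ?thesis
  proof (cases "\<exists>i<r. ?nt i")
    case True
    then obtain k where k: "k < r" "?nt k" by (elim exE conjE) simp
    show ?thesis
    proof (rule that[OF k(1) C[OF k(1)]])
      fix i assume i: "i < r" "i \<noteq> k"
      show "AE x in unit_measure. AE y in unit_measure. x \<in> A i \<longrightarrow> y \<in> A i \<longrightarrow> W x y = 1"
      proof (rule triv[OF i(1)], rule notI)
        assume nt: "?nt i"
        show False
          by (rule not_two_nontrivial[OF H C i(1) k(1) i(2) conjunct1[OF nt] conjunct2[OF nt] conjunct1[OF k(2)] conjunct2[OF k(2)]])
      qed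
    qed
  next
    case False
    have "0 < r" using r by simp
    show ?thesis
    proof (rule that[OF \<open>0 < r\<close> C[OF \<open>0 < r\<close>]])
      fix i assume i: "i < r" "i \<noteq> 0"
      show "AE x in unit_measure. AE y in unit_measure. x \<in> A i \<longrightarrow> y \<in> A i \<longrightarrow> W x y = 1"
        by (rule triv[OF i(1)]) (use False i in blast)
    qed
  qed
qed

end

section \<open>The maximal entropy limits\<close>

text \<open>Gibbs' inequality against the uniform distribution on two points: (1 - h(x)) ln 2 is the
  relative entropy -x ln a - (1 - x) ln b with a = 1/(2x) and b = 1/(2(1 - x)). As x a + (1 - x) b =
  1, it is a sum of two nonnegative terms by ln t \<le> t - 1, with equality only at t = 1.\<close>

lemma binary_entropy_le_1:
  assumes x: "0 < x" "x < 1"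
  shows "binary_entropy x \<le> 1" "binary_entropy x = 1 \<Longrightarrow> x = 1 / 2"
proof -
  let ?a = "1 / (2 * x)" and ?b = "1 / (2 * (1 - x))"
  have ab: "0 < ?a" "0 < ?b" using x by simp_all
  have ln_z: "ln (1 / (2 * z)) = - (ln 2 + ln z)" if "0 < z" for z :: real
    using that by (simp add: ln_div ln_mult)
  have ln_a: "ln ?a = - (ln 2 + ln x)" and ln_b: "ln ?b = - (ln 2 + ln (1 - x))"
    by (rule ln_z, use x in simp)+
  have "(binary_entropy x - 1) * ln 2 = x * ln ?a + (1 - x) * ln ?b"
    unfolding ln_a ln_b binary_entropy_def log_def by (simp add: field_simps)
  note entropy = this
  have half: "x * ?a = 1 / 2" "(1 - x) * ?b = 1 / 2" using x by simp_all
  have eq: "(1 - binary_entropy x) * ln 2 = x * (?a - 1 - ln ?a) + (1 - x) * (?b - 1 - ln ?b)"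
  proof -
    have "x * (p - 1 - lp) + (1 - x) * (q - 1 - lq) = x * p + (1 - x) * q - 1 - (x * lp + (1 - x) * lq)" for p q lp lq
      by (simp add: algebra_simps)
    then have "x * (?a - 1 - ln ?a) + (1 - x) * (?b - 1 - ln ?b) = 1 / 2 + 1 / 2 - 1 - (binary_entropy x - 1) * ln 2"
      by (simp only: half entropy)
    then show ?thesis by (simp add: algebra_simps)
  qed
  have nn: "0 \<le> x * (?a - 1 - ln ?a)" "0 \<le> (1 - x) * (?b - 1 - ln ?b)"
    using x ln_le_minus_one[OF ab(1)] ln_le_minus_one[OF ab(2)] by simp_all
  then have "0 \<le> (1 - binary_entropy x) * ln 2" unfolding eq by (rule add_nonneg_nonneg)
  then show "binary_entropy x \<le> 1" by (simp add: zero_le_mult_iff)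
  assume "binary_entropy x = 1"
  then have "(1 - binary_entropy x) * ln 2 = 0" by simp
  then have "x * (?a - 1 - ln ?a) = 0 \<and> (1 - x) * (?b - 1 - ln ?b) = 0"
    unfolding eq by (simp only: add_nonneg_eq_0_iff[OF nn])
  then have "x = 0 \<or> ?a - 1 - ln ?a = 0" by (simp only: mult_eq_0_iff)
  then have "ln ?a = ?a - 1" using x by linarith
  then have "?a = 1" by (rule ln_eq_minus_one[OF ab(1)])
  with half(1) show "x = 1 / 2" by (simp only: mult_1_right)
qed

lemma binary_entropy_nonneg:
  assumes "0 \<le> x" "x \<le> 1"
  shows "0 \<le> binary_entropy x"
proof (cases "x = 0 \<or> x = 1")
  case True
  then show ?thesis by (auto simp: binary_entropy_def)
next
  case False
  then have x: "0 < x" "x < 1" using assms by auto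
  then have "log 2 x \<le> 0" "log 2 (1 - x) \<le> 0" by simp_all
  then have "x * log 2 x \<le> 0" "(1 - x) * log 2 (1 - x) \<le> 0" using x by (simp_all add: mult_nonneg_nonpos)
  then show ?thesis by (simp add: binary_entropy_def)
qed

lemma binary_entropy_0_1: "binary_entropy 0 = 0" "binary_entropy 1 = 0"
  by (simp_all add: binary_entropy_def)

lemma double_integral_eq_nn_integral:
  fixes f :: "real \<Rightarrow> real \<Rightarrow> real"
  assumes f: "(\<lambda>p. f (fst p) (snd p)) \<in> borel_measurable (unit_measure \<Otimes>\<^sub>M unit_measure)"
    and b: "\<And>x y. x \<in> {0..1} \<Longrightarrow> y \<in> {0..1} \<Longrightarrow> 0 \<le> f x y \<and> f x y \<le> 1"
  shows "ennreal (LINT x|unit_measure. (LINT y|unit_measure. f x y)) = (\<integral>\<^sup>+ x. \<integral>\<^sup>+ y. ennreal (f x y) \<partial>unit_measure \<partial>unit_measure)"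
proof -
  have meas: "(\<lambda>y. f x y) \<in> borel_measurable unit_measure" if "x \<in> space unit_measure" for x
    using measurable_compose[OF measurable_Pair1'[OF that] f] by simp
  have int: "integrable unit_measure (\<lambda>y. f x y)" if x: "x \<in> space unit_measure" for x
    by (rule unit.integrable_const_bound[of _ 1, OF AE_I2 meas[OF x]]) (use b x in auto)
  have inner: "ennreal (LINT y|unit_measure. f x y) = (\<integral>\<^sup>+ y. ennreal (f x y) \<partial>unit_measure)" if x: "x \<in> space unit_measure" for x
    by (rule nn_integral_eq_integral[symmetric, OF int[OF x] AE_I2]) (use b x in auto)
  have nn: "0 \<le> (LINT y|unit_measure. f x y)" if x: "x \<in> space unit_measure" for x
    by (rule Bochner_Integration.integral_nonneg) (use b x in auto)
  have le1: "(LINT y|unit_measure. f x y) \<le> 1" if x: "x \<in> space unit_measure" for x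
  proof -
    have "(LINT y|unit_measure. f x y) \<le> (LINT y|unit_measure. 1)"
      by (rule integral_mono[OF int[OF x]]) (use b x in auto)
    also have "\<dots> = 1" using unit.prob_space by simp
    finally show ?thesis .
  qed
  have "(\<lambda>x. LINT y|unit_measure. f x y) \<in> borel_measurable unit_measure"
    by (intro unit.borel_measurable_lebesgue_integral) (use f in \<open>simp add: split_beta'\<close>)
  then have "integrable unit_measure (\<lambda>x. LINT y|unit_measure. f x y)"
    by (intro unit.integrable_const_bound[of _ 1, OF AE_I2]) (use nn le1 in auto)
  then have "ennreal (LINT x|unit_measure. (LINT y|unit_measure. f x y)) = (\<integral>\<^sup>+ x. ennreal (LINT y|unit_measure. f x y) \<partial>unit_measure)"
    by (rule nn_integral_eq_integral[symmetric, OF _ AE_I2]) (rule nn)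
  also have "\<dots> = (\<integral>\<^sup>+ x. \<integral>\<^sup>+ y. ennreal (f x y) \<partial>unit_measure \<partial>unit_measure)"
    by (rule nn_integral_cong) (rule inner)
  finally show ?thesis .
qed

text \<open>The entropy of a pair is at most 1 if the pair is fractional and 0 otherwise. When the
  integrals agree the slack \<open>?d\<close> vanishes almost everywhere, and entropy 1 occurs only
  at 1/2.\<close>

lemma
  assumes W: "graphon W"
  shows graphon_entropy_le: "ennreal (graphon_entropy W) \<le> measurable_graph.edge_mass unit_measure (fractional W) {0..1}"
    and graphon_entropy_eq: "measurable_graph.edge_mass unit_measure (fractional W) {0..1} \<le> ennreal (graphon_entropy W) \<Longrightarrow>
      AE x in unit_measure. AE y in unit_measure. fractional W x y \<longrightarrow> W x y = 1 / 2"
proof -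
  interpret R: measurable_graph unit_measure "fractional W" by (rule measurable_graph_fractional[OF W])
  let ?h = "\<lambda>x y. binary_entropy (W x y)"
  have WM: "(\<lambda>p. W (fst p) (snd p)) \<in> borel_measurable (unit_measure \<Otimes>\<^sub>M unit_measure)"
    by (rule graphon_measurable[OF W])
  have hM: "(\<lambda>p. ?h (fst p) (snd p)) \<in> borel_measurable (unit_measure \<Otimes>\<^sub>M unit_measure)"
    unfolding binary_entropy_def log_def using WM by measurable
  have W01: "0 \<le> W x y" "W x y \<le> 1" if "x \<in> {0..1}" "y \<in> {0..1}" for x y using W that by (auto simp: graphon_def)
  have h_le: "0 \<le> ?h x y \<and> ?h x y \<le> (if fractional W x y then 1 else 0)" if xy: "x \<in> {0..1}" "y \<in> {0..1}" for x y
  proof (cases "fractional W x y")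
    case True
    then show ?thesis using binary_entropy_le_1(1)[of "W x y"] binary_entropy_nonneg[OF W01[OF xy]] by simp
  next
    case False
    then have "W x y = 0 \<or> W x y = 1" using W01[OF xy] by linarith
    then show ?thesis by (elim disjE) (simp_all add: binary_entropy_0_1)
  qed
  have h01: "0 \<le> ?h x y \<and> ?h x y \<le> 1" if xy: "x \<in> {0..1}" "y \<in> {0..1}" for x y
    using h_le[OF xy] by (auto split: if_splits)
  let ?d = "\<lambda>x y. (if fractional W x y then 1 else 0) - ?h x y"
  have ent: "ennreal (graphon_entropy W) = (\<integral>\<^sup>+ x. \<integral>\<^sup>+ y. ennreal (?h x y) \<partial>unit_measure \<partial>unit_measure)"
    unfolding graphon_entropy_def by (rule double_integral_eq_nn_integral[OF hM h01])
  have em: "R.edge_mass {0..1} = (\<integral>\<^sup>+ x. \<integral>\<^sup>+ y. ennreal (if fractional W x y then 1 else 0) \<partial>unit_measure \<partial>unit_measure)"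
    unfolding R.edge_mass_def R.deg_def R.u_def by (intro nn_integral_cong) (auto intro!: nn_integral_cong)
  show "ennreal (graphon_entropy W) \<le> R.edge_mass {0..1}"
    unfolding ent em using h_le by (intro nn_integral_mono ennreal_leI) simp_all
  assume le: "R.edge_mass {0..1} \<le> ennreal (graphon_entropy W)"
  have fM: "Measurable.pred (unit_measure \<Otimes>\<^sub>M unit_measure) (\<lambda>p. fractional W (fst p) (snd p))"
    by (rule R.R_pred)
  have dM: "(\<lambda>p. ennreal (?d (fst p) (snd p))) \<in> borel_measurable (unit_measure \<Otimes>\<^sub>M unit_measure)"
    using fM hM by measurable
  have hM': "(\<lambda>p. ennreal (?h (fst p) (snd p))) \<in> borel_measurable (unit_measure \<Otimes>\<^sub>M unit_measure)"
    using hM by measurable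
  have sM: "(\<lambda>y. f (x, y)) \<in> borel_measurable unit_measure"
    if "f \<in> borel_measurable (unit_measure \<Otimes>\<^sub>M unit_measure)" "x \<in> space unit_measure" for f :: "real \<times> real \<Rightarrow> ennreal" and x
    by (rule measurable_compose[OF measurable_Pair1'[OF that(2)] that(1)])
  have "R.edge_mass {0..1} = (\<integral>\<^sup>+ x. (\<integral>\<^sup>+ y. ennreal (?h x y) \<partial>unit_measure) + (\<integral>\<^sup>+ y. ennreal (?d x y) \<partial>unit_measure) \<partial>unit_measure)"
    unfolding em
  proof (rule nn_integral_cong)
    fix x assume x: "x \<in> space unit_measure"
    have "(\<integral>\<^sup>+ y. ennreal (if fractional W x y then 1 else 0) \<partial>unit_measure) = (\<integral>\<^sup>+ y. ennreal (?h x y) + ennreal (?d x y) \<partial>unit_measure)"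
    proof (rule nn_integral_cong)
      fix y assume y: "y \<in> space unit_measure"
      have "0 \<le> ?h x y" "0 \<le> ?d x y" using h_le[of x y] x y by simp_all
      then have "ennreal (?h x y) + ennreal (?d x y) = ennreal (?h x y + ?d x y)" by (rule ennreal_plus[symmetric])
      also have "?h x y + ?d x y = (if fractional W x y then 1 else 0)" by simp
      finally show "ennreal (if fractional W x y then 1 else 0) = ennreal (?h x y) + ennreal (?d x y)" by (rule sym)
    qed
    also have "\<dots> = (\<integral>\<^sup>+ y. ennreal (?h x y) \<partial>unit_measure) + (\<integral>\<^sup>+ y. ennreal (?d x y) \<partial>unit_measure)"
      using sM[OF hM' x] sM[OF dM x] by (intro nn_integral_add) simp_all
    finally show "(\<integral>\<^sup>+ y. ennreal (if fractional W x y then 1 else 0) \<partial>unit_measure) =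
      (\<integral>\<^sup>+ y. ennreal (?h x y) \<partial>unit_measure) + (\<integral>\<^sup>+ y. ennreal (?d x y) \<partial>unit_measure)" .
  qed
  also have "\<dots> = ennreal (graphon_entropy W) + (\<integral>\<^sup>+ x. \<integral>\<^sup>+ y. ennreal (?d x y) \<partial>unit_measure \<partial>unit_measure)"
    unfolding ent using unit.borel_measurable_nn_integral_fst[OF hM'] unit.borel_measurable_nn_integral_fst[OF dM]
    by (intro nn_integral_add) simp_all
  finally have "ennreal (graphon_entropy W) + (\<integral>\<^sup>+ x. \<integral>\<^sup>+ y. ennreal (?d x y) \<partial>unit_measure \<partial>unit_measure) \<le> ennreal (graphon_entropy W) + 0"
    using le by simp
  then have "(\<integral>\<^sup>+ x. \<integral>\<^sup>+ y. ennreal (?d x y) \<partial>unit_measure \<partial>unit_measure) = 0"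
    by (simp only: ennreal_add_left_cancel_le) simp
  then have "AE x in unit_measure. (\<integral>\<^sup>+ y. ennreal (?d x y) \<partial>unit_measure) = 0"
    using unit.borel_measurable_nn_integral_fst[OF dM] by (subst (asm) nn_integral_0_iff_AE) simp_all
  then show "AE x in unit_measure. AE y in unit_measure. fractional W x y \<longrightarrow> W x y = 1 / 2"
  proof (rule AE_mp[OF _ AE_I2], intro impI)
    fix x assume x: "x \<in> space unit_measure" and "(\<integral>\<^sup>+ y. ennreal (?d x y) \<partial>unit_measure) = 0"
    then have "AE y in unit_measure. ennreal (?d x y) = 0"
      using sM[OF dM x] by (subst (asm) nn_integral_0_iff_AE) simp_all
    then show "AE y in unit_measure. fractional W x y \<longrightarrow> W x y = 1 / 2"
    proof (rule AE_mp[OF _ AE_I2], intro impI)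
      fix y assume y: "y \<in> space unit_measure" and 0: "ennreal (?d x y) = 0" and f: "fractional W x y"
      have "?d x y \<le> 0" using 0 by (simp only: ennreal_eq_0_iff)
      then have "?h x y = 1" using h01[of x y] f x y by simp
      then show "W x y = 1 / 2" using binary_entropy_le_1(2)[of "W x y"] f by blast
    qed
  qed
qed

lemma coloring_number_eq:
  assumes "coloring_number P = enat r" "r \<ge> 1"
  shows "\<exists>s\<le>r. colorable_class r s \<subseteq> P" "\<not> (\<exists>s\<le>Suc r. colorable_class (Suc r) s \<subseteq> P)"
proof -
  let ?X = "{enat t | t. t \<ge> 1 \<and> (\<exists>s\<le>t. colorable_class t s \<subseteq> P)}"
  have S: "Sup ?X = enat r" using assms(1) by (simp add: coloring_number_def)
  have le: "t \<le> r" if "t \<ge> 1" "\<exists>s\<le>t. colorable_class t s \<subseteq> P" for t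
  proof -
    have "enat t \<le> Sup ?X" by (rule Sup_upper) (use that in blast)
    then show ?thesis unfolding S by simp
  qed
  show "\<not> (\<exists>s\<le>Suc r. colorable_class (Suc r) s \<subseteq> P)"
  proof
    assume "\<exists>s\<le>Suc r. colorable_class (Suc r) s \<subseteq> P"
    from le[OF _ this] show False by simp
  qed
  show "\<exists>s\<le>r. colorable_class r s \<subseteq> P"
  proof (rule ccontr)
    assume n: "\<not> ?thesis"
    \<comment> \<open>If r itself did not occur in the set, all its members would be at most r - 1,
      and so would be the supremum.\<close>
    have "Sup ?X \<le> enat (r - 1)"
    proof (rule Sup_least)
      fix z assume "z \<in> ?X"
      then obtain t where "z = enat t \<and> t \<ge> 1 \<and> (\<exists>s\<le>t. colorable_class t s \<subseteq> P)" by (elim CollectE exE)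
      then have t: "z = enat t" "t \<ge> 1" "\<exists>s\<le>t. colorable_class t s \<subseteq> P" by (simp_all only:)
      have "t \<noteq> r" using n t(3) by blast
      then show "z \<le> enat (r - 1)" using le[OF t(2,3)] t(1) by simp
    qed
    then show False unfolding S using assms(2) by simp
  qed
qed

text \<open>The weights of \<open>W_graphon\<close> on r + 1 cells: cells 0 and 1 are the two
  cliques that make up the first part, and cell k \<ge> 2 is the k-th part.\<close>

definition step_weight :: "nat \<Rightarrow> nat \<Rightarrow> real" where
  "step_weight k l = (if k = l then 1 else if k \<le> 1 \<and> l \<le> 1 then 0 else 1 / 2)"

lemma graphon_hom_density_partition:
  fixes D :: "nat \<Rightarrow> real set" and w :: "nat \<Rightarrow> nat \<Rightarrow> real" and n :: nat
  assumes W: "graphon W" and F: "pair_graph F"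
    and D: "\<And>k. k \<le> n \<Longrightarrow> D k \<in> sets unit_measure" and disj: "\<And>k l x. k \<le> n \<Longrightarrow> l \<le> n \<Longrightarrow> x \<in> D k \<Longrightarrow> x \<in> D l \<Longrightarrow> k = l"
    and cover: "AE x in unit_measure. \<exists>k\<le>n. x \<in> D k"
    and w: "\<And>k l. k \<le> n \<Longrightarrow> l \<le> n \<Longrightarrow> AE x in unit_measure. AE y in unit_measure. x \<in> D k \<longrightarrow> y \<in> D l \<longrightarrow> W x y = w k l"
  shows "graphon_hom_density F W = (\<Sum>c\<in>pverts F \<rightarrow>\<^sub>E {..n}. (\<Prod>v\<in>pverts F. measure unit_measure (D (c v))) * (\<Prod>(u, v)\<in>edges F. w (c u) (c v)))"
proof -
  \<comment> \<open>The label of the cell of x. The alternative n < k gives points outside all cells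
    the label n + 1, so that the minimum always exists.\<close>
  define p where "p x = (LEAST k. n < k \<or> x \<in> D k)" for x
  have p_eq: "p x = k \<longleftrightarrow> x \<in> D k" if k: "k \<le> n" for x k
  proof
    assume "p x = k"
    moreover have "n < p x \<or> x \<in> D (p x)" unfolding p_def by (rule LeastI[of _ "Suc n"]) simp
    ultimately show "x \<in> D k" using k by simp
  next
    assume x: "x \<in> D k"
    show "p x = k" unfolding p_def
    proof (rule Least_equality)
      show "n < k \<or> x \<in> D k" using x by simp
      fix l assume "n < l \<or> x \<in> D l"
      then show "k \<le> l" using disj[OF k _ x, of l] k by (cases "l \<le> n") auto
    qed
  qed
  have "Measurable.pred unit_measure (\<lambda>x. n < k \<or> x \<in> D k)" for k
  proof (cases "k \<le> n")
    case True
    note [measurable] = D[OF True]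
    show ?thesis by measurable
  next
    case False
    then show ?thesis by simp
  qed
  then have pM: "p \<in> measurable unit_measure (count_space UNIV)"
    unfolding p_def by (rule measurable_Least)
  have step: "AE x in unit_measure. AE y in unit_measure. W x y = w (p x) (p y)"
  proof -
    have "AE x in unit_measure. \<forall>k\<in>{..n}. \<forall>l\<in>{..n}. AE y in unit_measure. x \<in> D k \<longrightarrow> y \<in> D l \<longrightarrow> W x y = w k l"
      by (intro AE_finite_allI finite_atMost w) simp_all
    then show ?thesis using cover
    proof eventually_elim
      case (elim x)
      then obtain k where k: "k \<le> n" "x \<in> D k" by (elim exE conjE)
      have "AE y in unit_measure. \<forall>l\<in>{..n}. x \<in> D k \<longrightarrow> y \<in> D l \<longrightarrow> W x y = w k l"
        using elim(1) k(1) by (intro AE_finite_allI finite_atMost) simp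
      then show ?case using cover
      proof eventually_elim
        case (elim y)
        then obtain l where l: "l \<le> n" "y \<in> D l" by (elim exE conjE)
        have "p x = k" "p y = l" using p_eq[OF k(1)] p_eq[OF l(1)] k(2) l(2) by simp_all
        then show ?case using elim(1) k l by simp
      qed
    qed
  qed
  have I: "AE x in unit_measure. p x \<in> {..n}"
    using cover
  proof (rule eventually_mono)
    fix x assume "\<exists>k\<le>n. x \<in> D k"
    then obtain k where k: "k \<le> n" "x \<in> D k" by (elim exE conjE)
    then have "p x = k" using p_eq[OF k(1)] by simp
    then show "p x \<in> {..n}" using k(1) by simp
  qed
  have "graphon_hom_density F W = (\<Sum>c\<in>pverts F \<rightarrow>\<^sub>E {..n}.
    (\<Prod>v\<in>pverts F. measure unit_measure {x \<in> space unit_measure. p x = c v}) * (\<Prod>(u, v)\<in>edges F. w (c u) (c v)))"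
    by (rule graphon_hom_density_step[OF W F pM finite_atMost I step])
  also have "\<dots> = (\<Sum>c\<in>pverts F \<rightarrow>\<^sub>E {..n}. (\<Prod>v\<in>pverts F. measure unit_measure (D (c v))) * (\<Prod>(u, v)\<in>edges F. w (c u) (c v)))"
  proof (intro sum.cong prod.cong refl arg_cong2[where f = "(*)"] arg_cong[where f = "measure unit_measure"])
    fix c v assume "c \<in> pverts F \<rightarrow>\<^sub>E {..n}" "v \<in> pverts F"
    then have c: "c v \<le> n" by auto
    show "{x \<in> space unit_measure. p x = c v} = D (c v)"
      using p_eq[OF c] sets.sets_into_space[OF D[OF c]] by auto
  qed
  finally show ?thesis .
qed

section \<open>The cells and the homomorphism densities of the extremal graphons\<close>

lemma part_unique:
  assumes "r > 0" "x \<in> part r i" "x \<in> part r j" "1 \<le> i" "1 \<le> j"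
  shows "i = j"
proof -
  have "real i - 1 \<le> real r * x" "real r * x < real i" "real j - 1 \<le> real r * x" "real r * x < real j"
    using assms(1-3) by (simp_all add: part_def pos_divide_le_eq pos_less_divide_eq mult.commute)
  then have "real i - 1 < real j" "real j - 1 < real i" by linarith+
  then show ?thesis by linarith
qed

definition W_cell :: "nat \<Rightarrow> real \<Rightarrow> nat \<Rightarrow> real set" where
  "W_cell r a k = (if k = 0 then {0..<a / real r} else if k = 1 then {a / real r..<1 / real r} else part r k)"

lemma part_subset: "1 \<le> i \<Longrightarrow> i \<le> r \<Longrightarrow> part r i \<subseteq> {0..1}"
proof
  fix x assume i: "1 \<le> i" "i \<le> r" and x: "x \<in> part r i"
  have "0 \<le> (real i - 1) / real r" "real i / real r \<le> 1" using i by simp_all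
  then show "x \<in> {0..1}" using x unfolding part_def atLeastLessThan_iff atLeastAtMost_iff by linarith
qed

lemma W_cell_part:
  assumes "0 \<le> a" "a \<le> 1" "r > 0" "x \<in> W_cell r a k"
  shows "x \<in> part r (max 1 k)"
proof -
  have "a / real r \<le> 1 / real r" "0 \<le> a / real r" using assms(1-3) by (simp_all add: divide_right_mono)
  then show ?thesis using assms(4) unfolding W_cell_def
    by (cases "k = 0"; cases "k = 1") (simp_all add: part_def max_def)
qed

lemma W_graphon_cell:
  assumes a: "0 \<le> a" "a \<le> 1" and r: "r > 0" and k: "k \<le> r" "l \<le> r"
    and x: "x \<in> W_cell r a k" and y: "y \<in> W_cell r a l"
  shows "W_graphon r a x y = step_weight k l"
proof -
  note px = W_cell_part[OF a r x] and py = W_cell_part[OF a r y]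
  have ix: "x \<in> part r i \<longleftrightarrow> i = max 1 k" if "1 \<le> i" for i
    using part_unique[OF r _ px that] px by auto
  have iy: "y \<in> part r i \<longleftrightarrow> i = max 1 l" if "1 \<le> i" for i
    using part_unique[OF r _ py that] py by auto
  show ?thesis
  proof (cases "k \<le> 1 \<and> l \<le> 1")
    case True
    then have "x \<in> part r 1" "y \<in> part r 1" using ix[of 1] iy[of 1] by simp_all
    moreover have "k = 0 \<or> k = 1" "l = 0 \<or> l = 1" using True by auto
    ultimately show ?thesis using x y unfolding W_graphon_def step_weight_def W_cell_def
      by (elim disjE) simp_all
  next
    case False
    then have n1: "\<not> (x \<in> part r 1 \<and> y \<in> part r 1)" using ix[of 1] iy[of 1] by (auto simp: max_def split: if_splits)
    have "(\<exists>i\<in>{2..r}. x \<in> part r i \<and> y \<in> part r i) \<longleftrightarrow> k = l"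
    proof
      assume "\<exists>i\<in>{2..r}. x \<in> part r i \<and> y \<in> part r i"
      then obtain i where "2 \<le> i" "x \<in> part r i" "y \<in> part r i" by auto
      then have "i = max 1 k" "i = max 1 l" using ix[of i] iy[of i] by simp_all
      then show "k = l" using \<open>2 \<le> i\<close> by (simp add: max_def split: if_splits)
    next
      assume kl: "k = l"
      then have "2 \<le> k" using False by simp
      then have "x \<in> part r k" "y \<in> part r k" using ix[of k] iy[of k] kl by (simp_all add: max_def)
      then show "\<exists>i\<in>{2..r}. x \<in> part r i \<and> y \<in> part r i" using \<open>2 \<le> k\<close> k by auto
    qed
    then show ?thesis unfolding W_graphon_def if_not_P[OF n1] step_weight_def using False by auto
  qed
qed

lemma graphon_W_graphon: "graphon (W_graphon r a)"
proof -
  have [measurable]: "Measurable.pred unit_measure (\<lambda>x. x \<in> part r i)" for i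
    by (rule measurable_unit_measureI) (simp add: part_def)
  have [measurable]: "Measurable.pred unit_measure (\<lambda>x. x \<in> {b..<c})" for b c :: real
    by (rule measurable_unit_measureI) simp
  have ex: "Measurable.pred (unit_measure \<Otimes>\<^sub>M unit_measure) (\<lambda>p. \<exists>i\<in>{2..r}. fst p \<in> part r i \<and> snd p \<in> part r i)"
    by (rule pred_intros_finite) measurable
  have "(\<lambda>p. W_graphon r a (fst p) (snd p)) \<in> borel_measurable (unit_measure \<Otimes>\<^sub>M unit_measure)"
    unfolding W_graphon_def Un_iff mem_Sigma_iff using ex by measurable
  then have "(\<lambda>(x, y). W_graphon r a x y) \<in> borel_measurable (unit_measure \<Otimes>\<^sub>M unit_measure)"
    by (simp only: split_beta')
  moreover have "W_graphon r a x y = W_graphon r a y x" for x y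
  proof -
    have "(\<exists>i\<in>{2..r}. x \<in> part r i \<and> y \<in> part r i) \<longleftrightarrow> (\<exists>i\<in>{2..r}. y \<in> part r i \<and> x \<in> part r i)" by blast
    then show ?thesis unfolding W_graphon_def Un_iff mem_Sigma_iff
      by (intro if_cong) (simp_all only: conj_commute simp_thms, blast?)
  qed
  moreover have "0 \<le> W_graphon r a x y" "W_graphon r a x y \<le> 1" for x y
    unfolding W_graphon_def by simp_all
  ultimately show ?thesis unfolding graphon_def by blast
qed

lemma measure_part: "1 \<le> i \<Longrightarrow> i \<le> r \<Longrightarrow> measure unit_measure (part r i) = 1 / real r"
proof -
  assume i: "1 \<le> i" "i \<le> r"
  have "measure unit_measure (part r i) = real i / real r - (real i - 1) / real r"
    unfolding part_def by (rule measure_unit_interval) (use i in \<open>simp_all add: divide_right_mono\<close>)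
  then show ?thesis by (simp add: diff_divide_distrib)
qed

lemma W_graphon_density:
  assumes a: "0 \<le> a" "a \<le> 1" and r: "r > 0" and F: "pair_graph F"
  shows "graphon_hom_density F (W_graphon r a) = (\<Sum>c\<in>pverts F \<rightarrow>\<^sub>E {..r}.
    (\<Prod>v\<in>pverts F. if c v = 0 then a / real r else if c v = 1 then (1 - a) / real r else 1 / real r) *
    (\<Prod>(u, v)\<in>edges F. step_weight (c u) (c v)))"
proof -
  have ar: "a / real r \<le> 1 / real r" "0 \<le> a / real r" "1 / real r \<le> 1" using a r by (simp_all add: divide_right_mono)
  have "graphon_hom_density F (W_graphon r a) = (\<Sum>c\<in>pverts F \<rightarrow>\<^sub>E {..r}.
    (\<Prod>v\<in>pverts F. measure unit_measure (W_cell r a (c v))) * (\<Prod>(u, v)\<in>edges F. step_weight (c u) (c v)))"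
  proof (rule graphon_hom_density_partition[OF graphon_W_graphon F])
    fix k assume k: "k \<le> r"
    have "W_cell r a k \<in> sets borel" by (simp add: W_cell_def part_def)
    moreover have "W_cell r a k \<subseteq> {0..1}"
    proof
      fix x assume "x \<in> W_cell r a k"
      then have "x \<in> part r (max 1 k)" by (rule W_cell_part[OF a r])
      moreover have "1 \<le> max 1 k" "max 1 k \<le> r" using k r by simp_all
      ultimately show "x \<in> {0..1}" using part_subset by blast
    qed
    ultimately show "W_cell r a k \<in> sets unit_measure" by (rule sets_unit_measure_borel)
  next
    fix k l x assume "k \<le> r" "l \<le> r" and x: "x \<in> W_cell r a k" "x \<in> W_cell r a l"
    have m: "max 1 k = max 1 l" using part_unique[OF r W_cell_part[OF a r x(1)] W_cell_part[OF a r x(2)]] by simp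
    show "k = l"
    proof (cases "k \<le> 1 \<and> l \<le> 1")
      case True
      then have "k = 0 \<or> k = 1" "l = 0 \<or> l = 1" by auto
      then show ?thesis using x by (elim disjE) (simp_all add: W_cell_def)
    next
      case False
      then show ?thesis using m by (auto simp: max_def split: if_splits)
    qed
  next
    show "AE x in unit_measure. \<exists>k\<le>r. x \<in> W_cell r a k"
      using AE_unit_neq_1 AE_space
    proof eventually_elim
      case (elim x)
      let ?i = "block_index r x"
      have x: "x \<in> {0..1}" using elim by simp
      have i: "?i < r" by (rule block_index_less[OF r x elim(1)])
      have xi: "x \<in> {real ?i / real r..<real (Suc ?i) / real r}"
        using block_index_eq[OF r i] x by auto
      show ?case
      proof (cases "?i = 0")
        case False
        then have "x \<in> W_cell r a (Suc ?i)" using xi by (simp add: W_cell_def part_def)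
        then show ?thesis using i by (intro exI[of _ "Suc ?i"]) simp
      next
        case True
        then have "x \<in> W_cell r a 0 \<or> x \<in> W_cell r a 1" using xi by (auto simp: W_cell_def)
        then show ?thesis using r by (elim disjE) (force intro: exI[of _ 0], force intro: exI[of _ 1])
      qed
    qed
  next
    fix k l assume "k \<le> r" "l \<le> r"
    then show "AE x in unit_measure. AE y in unit_measure. x \<in> W_cell r a k \<longrightarrow> y \<in> W_cell r a l \<longrightarrow> W_graphon r a x y = step_weight k l"
      by (intro AE_I2 impI W_graphon_cell[OF a r])
  qed
  also have "\<dots> = (\<Sum>c\<in>pverts F \<rightarrow>\<^sub>E {..r}.
    (\<Prod>v\<in>pverts F. if c v = 0 then a / real r else if c v = 1 then (1 - a) / real r else 1 / real r) *
    (\<Prod>(u, v)\<in>edges F. step_weight (c u) (c v)))"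
  proof (intro sum.cong prod.cong refl arg_cong2[where f = "(*)"])
    fix c v assume "c \<in> pverts F \<rightarrow>\<^sub>E {..r}" "v \<in> pverts F"
    then have c: "c v \<le> r" by auto
    have "measure unit_measure {0..<a / real r} = a / real r" "measure unit_measure {a / real r..<1 / real r} = (1 - a) / real r"
      using ar measure_unit_interval[of 0 "a / real r"] measure_unit_interval[of "a / real r" "1 / real r"] by (simp_all add: diff_divide_distrib)
    then show "measure unit_measure (W_cell r a (c v)) = (if c v = 0 then a / real r else if c v = 1 then (1 - a) / real r else 1 / real r)"
      using c measure_part[of "c v" r] by (simp add: W_cell_def)
  qed
  finally show ?thesis .
qed

text \<open>Stated for every r \<ge> 2 with all three graphs excluded, so that it covers both parts
  of the result; for r = 2 the graph H_3 is B_3.\<close>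

theorem max_entropy_limit_structure:
  assumes P: "hereditary P" and col: "coloring_number P = enat r" and r: "2 \<le> r"
    and G: "\<not> belongs_to (G_graph (r + 1)) P" and B: "\<not> belongs_to (B_graph (r + 1)) P" and H: "\<not> belongs_to (H_graph (r + 1)) P"
    and \<Gamma>: "\<Gamma> \<in> max_entropy_limits P"
  shows "\<exists>a\<in>{0..1}. represents (W_graphon r a) \<Gamma>"
proof -
  obtain n where n: "r = n + 1" "1 \<le> n" using r by (intro that[of "r - 1"]) simp_all
  have r0: "r > 0" "r \<ge> 1" using r by simp_all
  obtain s where s: "s \<le> r" "colorable_class r s \<subseteq> P" using coloring_number_eq(1)[OF col r0(2)] by (elim exE conjE)
  obtain \<Gamma>0 where \<Gamma>0: "\<Gamma>0 \<in> class_limits P" "has_entropy \<Gamma>0 (1 - 1 / real r)"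
    using colorable_class_limit[OF s(2,1) r0(1)] by (elim bexE)
  obtain e where e: "has_entropy \<Gamma> e" and emax: "\<forall>\<Gamma>'\<in>class_limits P. \<forall>e'. has_entropy \<Gamma>' e' \<longrightarrow> e' \<le> e"
    and \<Gamma>c: "\<Gamma> \<in> class_limits P"
    using \<Gamma> unfolding max_entropy_limits_def mem_Collect_eq by (elim conjE exE)
  obtain W where W: "represents W \<Gamma>" "graphon_entropy W = e" using e unfolding has_entropy_def by (elim exE conjE)
  have Wg: "graphon W" and tW: "\<And>F. pair_graph F \<Longrightarrow> graphon_hom_density F W = \<Gamma> F" using W(1) by (simp_all add: represents_def)
  have ge: "1 - 1 / real r \<le> graphon_entropy W"
    using emax[rule_format, OF \<Gamma>0] W(2) by simp
  obtain Gs where Gs: "\<forall>n. Gs n \<in> P" "graphs_converge Gs \<Gamma>"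
    using \<Gamma>c unfolding class_limits_def mem_Collect_eq by (elim exE conjE)
  have gen: "AE x in PiM V (\<lambda>_. unit_measure). generic P W V x" if "finite V" for V
    by (rule AE_generic[OF P spec[OF Gs(1)] Gs(2) W(1) that])
  interpret R: measurable_graph unit_measure "fractional W" by (rule measurable_graph_fractional[OF Wg])
  have free: "AE x in PiM {..<Suc r} (\<lambda>_. unit_measure). \<not> R.clique_in (space unit_measure) {..<Suc r} x"
  proof (rule ccontr)
    assume "\<not> ?thesis"
    then have "\<not> (AE x in PiM {..<Suc r} (\<lambda>_. unit_measure). \<not> R.clique_in {0..1} {..<Suc r} x)"
      by (simp only: space_unit_measure not_False_eq_True)
    then have "\<exists>s\<le>Suc r. colorable_class (Suc r) s \<subseteq> P"
      by (intro colorable_subset[OF P gen Wg]) simp_all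
    with coloring_number_eq(2)[OF col r0(2)] show False by (rule notE)
  qed
  have card: "card {..<Suc r} = n + 2" using n by simp
  have dense: "R.edge_mass (space unit_measure) \<ge> ennreal (1 - 1 / real (n + 1))"
    using order_trans[OF ennreal_leI[OF ge] graphon_entropy_le[OF Wg]] unfolding n(1) space_unit_measure .
  \<comment> \<open>The extremal case fixes the mass of the fractional pairs at 1 - 1/r. The entropy
    is no smaller, so the equality case of the entropy bound applies.\<close>
  have "R.edge_mass {0..1} = ennreal (1 - 1 / real r)"
    using R.turan_extremal(1)[OF n(2) finite_lessThan card free dense] unfolding n(1) space_unit_measure .
  also have "\<dots> \<le> ennreal (graphon_entropy W)" using ge by (rule ennreal_leI)
  finally have half: "AE x in unit_measure. AE y in unit_measure. fractional W x y \<longrightarrow> W x y = 1 / 2"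
    by (rule graphon_entropy_eq[OF Wg])
  obtain A where parts0: "\<And>i. i < n + 1 \<Longrightarrow> A i \<in> sets unit_measure" "\<And>i. i < n + 1 \<Longrightarrow> measure unit_measure (A i) = 1 / real (n + 1)"
    "disjoint_family_on A {..<n + 1}" "\<And>i. i < n + 1 \<Longrightarrow> AE x in unit_measure. AE y in unit_measure. x \<in> A i \<longrightarrow> (fractional W x y \<longleftrightarrow> y \<notin> A i)"
    "AE x in unit_measure. x \<in> (\<Union>i<n + 1. A i)"
    by (rule R.turan_partition[OF n(2) finite_lessThan card free dense]) (rule that)
  note parts = parts0[folded n(1)]
  have A_disj: "i = k" if "i < r" "k < r" "x \<in> A i" "x \<in> A k" for i k x
    using that parts(3) unfolding disjoint_family_on_def by blast
  have blocks: "AE x in unit_measure. AE y in unit_measure. x \<in> A i \<longrightarrow> y \<in> A k \<longrightarrow>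
      (if i = k then W x y = 0 \<or> W x y = 1 else W x y = 1 / 2)" if ik: "i < r" "k < r" for i k
    using parts(4)[OF ik(1)] half AE_space
  proof eventually_elim
    case (elim x)
    show ?case using elim(1,2) AE_space
    proof eventually_elim
      case (elim y)
      have W01: "0 \<le> W x y" "W x y \<le> 1" using Wg elim(3) \<open>x \<in> space unit_measure\<close> by (auto simp: graphon_def)
      show ?case
      proof (intro impI)
        assume xy: "x \<in> A i" "y \<in> A k"
        show "if i = k then W x y = 0 \<or> W x y = 1 else W x y = 1 / 2"
        proof (cases "i = k")
          case True
          then have "\<not> fractional W x y" using elim(1) xy by simp
          then show ?thesis unfolding if_P[OF True] using W01 by linarith
        next
          case False
          then have "y \<notin> A i" using A_disj[OF ik, of y] xy by blast
          then have "fractional W x y" using elim(1) xy by blast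
          then show ?thesis unfolding if_not_P[OF False] using elim(2) by blast
        qed
      qed
    qed
  qed
  interpret block_limit P W A r
  proof
    show "emeasure unit_measure (A i) \<noteq> 0" if "i < r" for i
      using parts(2)[OF that] r0 by (simp add: unit.emeasure_eq_measure)
  qed (fact P Wg r gen parts(1) A_disj blocks)+
  obtain i0 C where i0: "i0 < r" "splits i0 C"
    and full: "\<And>i. i < r \<Longrightarrow> i \<noteq> i0 \<Longrightarrow> AE x in unit_measure. AE y in unit_measure. x \<in> A i \<longrightarrow> y \<in> A i \<longrightarrow> W x y = 1"
    by (rule block_structure[OF G B H]) (rule that)
  have C: "C \<in> sets unit_measure" "C \<subseteq> A i0" and CW: "AE x in unit_measure. AE y in unit_measure.
     x \<in> A i0 \<longrightarrow> y \<in> A i0 \<longrightarrow> W x y = (if x \<in> C \<longleftrightarrow> y \<in> C then 1 else 0)" using i0(2) by (simp_all add: splits_def)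
  \<comment> \<open>The mass of one side of the block i0 in units of 1/r, because the first clique
    of \<open>W_graphon\<close> has length a / r.\<close>
  define a where "a = real r * measure unit_measure C"
  have mC: "measure unit_measure C = a / real r" using r0 by (simp add: a_def)
  have "measure unit_measure C \<le> measure unit_measure (A i0)"
    using C parts(1)[OF i0(1)] by (intro unit.finite_measure_mono) 
  then have a: "0 \<le> a" "a \<le> 1" using parts(2)[OF i0(1)] r0 by (simp_all add: a_def field_simps)
  \<comment> \<open>The cells k = 2, ..., r enumerate the blocks other than i0: k - 1 avoids 0, so
    its image under the transposition of 0 and i0 avoids i0.\<close>
  define \<tau> where "\<tau> k = Transposition.transpose 0 i0 (k - 1)" for k
  define D where "D k = (if k = 0 then C else if k = 1 then A i0 - C else A (\<tau> k))" for k
  have \<tau>: "\<tau> k < r" "\<tau> k \<noteq> i0" if "2 \<le> k" "k \<le> r" for k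
    using that i0(1) by (auto simp: \<tau>_def Transposition.transpose_def)
  have \<tau>_inj: "k = l" if "2 \<le> k" "2 \<le> l" "\<tau> k = \<tau> l" for k l
  proof -
    have "k - 1 = l - 1" using arg_cong[OF that(3), of "Transposition.transpose 0 i0"] unfolding \<tau>_def
      by (simp only: transpose_involutory)
    then show ?thesis using that(1,2) by simp
  qed
  define blk where "blk k = (if k \<le> 1 then i0 else \<tau> k)" for k
  have blk: "blk k < r" "D k \<subseteq> A (blk k)" if "k \<le> r" for k
    using that i0(1) C(2) \<tau>(1)[of k] by (auto simp: blk_def D_def)
  have blk_eq: "k = l" if "k \<le> r" "l \<le> r" "blk k = blk l" "\<not> (k \<le> 1 \<and> l \<le> 1)" for k l
    using that \<tau>(2)[of k] \<tau>(2)[of l] \<tau>_inj[of k l] by (auto simp: blk_def not_le Suc_le_eq numeral_2_eq_2 split: if_splits)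
  have "represents (W_graphon r a) \<Gamma>"
    unfolding represents_def
  proof (intro conjI allI impI graphon_W_graphon)
    fix F :: ngraph assume F: "pair_graph F"
    have "graphon_hom_density F W = (\<Sum>c\<in>pverts F \<rightarrow>\<^sub>E {..r}.
      (\<Prod>v\<in>pverts F. measure unit_measure (D (c v))) * (\<Prod>(u, v)\<in>edges F. step_weight (c u) (c v)))"
    proof (rule graphon_hom_density_partition[OF Wg F])
      fix k assume k: "k \<le> r"
      show "D k \<in> sets unit_measure"
        using C(1) parts(1)[OF i0(1)] parts(1)[OF \<tau>(1)[of k]] k by (simp add: D_def)
    next
      fix k l x assume kl: "k \<le> r" "l \<le> r" and x: "x \<in> D k" "x \<in> D l"
      have b: "blk k = blk l" using A_disj[OF blk(1)[OF kl(1)] blk(1)[OF kl(2)]] blk(2)[OF kl(1)] blk(2)[OF kl(2)] x by blast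
      show "k = l"
      proof (cases "k \<le> 1 \<and> l \<le> 1")
        case True
        then have "k = 0 \<or> k = 1" "l = 0 \<or> l = 1" by auto
        then show ?thesis using x by (elim disjE) (simp_all add: D_def)
      next
        case False
        show ?thesis by (rule blk_eq[OF kl b False])
      qed
    next
      show "AE x in unit_measure. \<exists>k\<le>r. x \<in> D k"
        using parts(5)
      proof (rule eventually_mono)
        fix x assume "x \<in> (\<Union>i<r. A i)"
        then obtain i where i: "i < r" "x \<in> A i" by blast
        show "\<exists>k\<le>r. x \<in> D k"
        proof (cases "i = i0")
          case True
          show ?thesis
          proof (cases "x \<in> C")
            case xC: True
            then show ?thesis by (intro exI[of _ 0]) (simp add: D_def)
          next
            case False
            then show ?thesis using i True r0 by (intro exI[of _ 1]) (simp add: D_def)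
          qed
        next
          case False
          let ?k = "Suc (Transposition.transpose 0 i0 i)"
          have "?k \<le> r" using i(1) i0(1) by (auto simp: Transposition.transpose_def)
          moreover have "2 \<le> ?k" using False by (auto simp: Transposition.transpose_def)
          moreover have "\<tau> ?k = i" by (simp add: \<tau>_def)
          ultimately show ?thesis using i(2) by (intro exI[of _ ?k]) (simp add: D_def)
        qed
      qed
    next
      fix k l assume kl: "k \<le> r" "l \<le> r"
      have sub: "x \<in> A (blk k)" "y \<in> A (blk l)" if "x \<in> D k" "y \<in> D l" for x y
        using blk(2)[OF kl(1)] blk(2)[OF kl(2)] that by blast+
      consider "k \<le> 1 \<and> l \<le> 1" | "\<not> (k \<le> 1 \<and> l \<le> 1)" "k = l" | "\<not> (k \<le> 1 \<and> l \<le> 1)" "k \<noteq> l" by blast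
      then show "AE x in unit_measure. AE y in unit_measure. x \<in> D k \<longrightarrow> y \<in> D l \<longrightarrow> W x y = step_weight k l"
      proof cases
        case 1
        then have b: "blk k = i0" "blk l = i0" and "k = 0 \<or> k = 1" "l = 0 \<or> l = 1" by (auto simp: blk_def)
        then have "step_weight k l = (if x \<in> C \<longleftrightarrow> y \<in> C then 1 else 0)" if "x \<in> D k" "y \<in> D l" for x y
          using that by (elim disjE) (simp_all add: D_def step_weight_def)
        note val = this
        show ?thesis using CW
        proof (rule eventually_mono)
          fix x assume *: "AE y in unit_measure. x \<in> A i0 \<longrightarrow> y \<in> A i0 \<longrightarrow> W x y = (if x \<in> C \<longleftrightarrow> y \<in> C then 1 else 0)"
          show "AE y in unit_measure. x \<in> D k \<longrightarrow> y \<in> D l \<longrightarrow> W x y = step_weight k l"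
            using *
          proof (rule eventually_mono, intro impI)
            fix y assume "x \<in> A i0 \<longrightarrow> y \<in> A i0 \<longrightarrow> W x y = (if x \<in> C \<longleftrightarrow> y \<in> C then 1 else 0)" "x \<in> D k" "y \<in> D l"
            then show "W x y = step_weight k l" using val[of x y] sub[of x y] b by simp
          qed
        qed
      next
        case 2
        then have k2: "2 \<le> k" by simp
        then have bk: "blk k \<noteq> i0" using \<tau>(2)[OF k2 kl(1)] by (simp add: blk_def)
        have sw: "step_weight k l = 1" using 2 by (simp add: step_weight_def)
        show ?thesis unfolding sw using full[OF blk(1)[OF kl(1)] bk]
        proof (rule eventually_mono)
          fix x assume *: "AE y in unit_measure. x \<in> A (blk k) \<longrightarrow> y \<in> A (blk k) \<longrightarrow> W x y = 1"
          show "AE y in unit_measure. x \<in> D k \<longrightarrow> y \<in> D l \<longrightarrow> W x y = 1"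
            using * by (rule eventually_mono) (use sub 2(2) in blast)
        qed
      next
        case 3
        then have bk: "blk k \<noteq> blk l" using blk_eq[OF kl] by blast
        have sw: "step_weight k l = 1 / 2" using 3 by (simp add: step_weight_def)
        show ?thesis unfolding sw using blocks[OF blk(1)[OF kl(1)] blk(1)[OF kl(2)], unfolded if_not_P[OF bk]]
        proof (rule eventually_mono)
          fix x assume *: "AE y in unit_measure. x \<in> A (blk k) \<longrightarrow> y \<in> A (blk l) \<longrightarrow> W x y = 1 / 2"
          show "AE y in unit_measure. x \<in> D k \<longrightarrow> y \<in> D l \<longrightarrow> W x y = 1 / 2"
            using * by (rule eventually_mono) (use sub in blast)
        qed
      qed
    qed
    also have "\<dots> = graphon_hom_density F (W_graphon r a)"
      unfolding W_graphon_density[OF a r0(1) F]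
    proof (intro sum.cong prod.cong refl arg_cong2[where f = "(*)"])
      fix c v assume "c \<in> pverts F \<rightarrow>\<^sub>E {..r}" "v \<in> pverts F"
      then have c: "c v \<le> r" by auto
      have "measure unit_measure (A i0 - C) = measure unit_measure (A i0) - measure unit_measure C"
        by (rule unit.finite_measure_Diff) (use parts(1)[OF i0(1)] C in auto)
      then have m1: "measure unit_measure (A i0 - C) = (1 - a) / real r"
        using parts(2)[OF i0(1)] mC by (simp add: diff_divide_distrib)
      show "measure unit_measure (D (c v)) = (if c v = 0 then a / real r else if c v = 1 then (1 - a) / real r else 1 / real r)"
        using m1 mC parts(2)[OF \<tau>(1)[of "c v"]] c by (simp add: D_def)
    qed
    finally show "graphon_hom_density F (W_graphon r a) = \<Gamma> F" using tW[OF F] by simp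
  qed
  then show ?thesis using a by (intro bexI[of _ a]) simp_all
qed

theorem theorem1p4:
  fixes P :: "ngraph set" and r :: nat
  assumes "hereditary P"
    and "coloring_number P = enat r"
  shows "(3 \<le> r \<and> \<not> belongs_to (G_graph (r + 1)) P \<and> \<not> belongs_to (B_graph (r + 1)) P \<and>
            \<not> belongs_to (H_graph (r + 1)) P \<longrightarrow>
          (\<forall>\<Gamma>\<in>max_entropy_limits P. \<exists>a\<in>{0..1}. represents (W_graphon r a) \<Gamma>)) \<and>
         (r = 2 \<and> \<not> belongs_to (G_graph 3) P \<and> \<not> belongs_to (B_graph 3) P \<longrightarrow>
          (\<forall>\<Gamma>\<in>max_entropy_limits P. \<exists>a\<in>{0..1}. represents (W_graphon 2 a) \<Gamma>))"
proof (intro conjI impI ballI; elim conjE)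
  fix \<Gamma> assume "3 \<le> r" and *: "\<not> belongs_to (G_graph (r + 1)) P" "\<not> belongs_to (B_graph (r + 1)) P" "\<not> belongs_to (H_graph (r + 1)) P"
    and \<Gamma>: "\<Gamma> \<in> max_entropy_limits P"
  then have r: "2 \<le> r" by simp
  show "\<exists>a\<in>{0..1}. represents (W_graphon r a) \<Gamma>"
    by (rule max_entropy_limit_structure[OF assms r * \<Gamma>])
next
  fix \<Gamma> assume r: "r = 2" and *: "\<not> belongs_to (G_graph 3) P" "\<not> belongs_to (B_graph 3) P"
    and \<Gamma>: "\<Gamma> \<in> max_entropy_limits P"
  have 3: "(2 :: nat) + 1 = 3" by simp
  \<comment> \<open>The hypothesis on B_3 is used twice, the second time as the one on H_3.\<close>
  show "\<exists>a\<in>{0..1}. represents (W_graphon 2 a) \<Gamma>"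
    by (rule max_entropy_limit_structure[of P 2 \<Gamma>, unfolded 3,
          OF assms(1) assms(2)[unfolded r] order_refl *(1) *(2) *(2)[unfolded B_graph_3] \<Gamma>])
qed

end
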